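(* Let $n$ be a power of $2$ and let $f:[n]^d\to\{0,1\}$ be $\varepsilon$-far from being monotone. Then the tester described below, run on $f$ and $\varepsilon$, detects a violation (i.e. finds a pair $x\preceq y$ with $f(x)>f(y)$, and rejects) with probability $\Omega\!\left(\frac{\varepsilon^{4/3}}{d^{5/6}\log^{3/2}d\,\log^{4/3} n}\right)$. The tester: (1) Let $p$ be the largest integer with $2^p\le\sqrt{d/(10\log d)}$; choose $t\in\{0,1,\dots,p\}$ uniformly at random and set $\tau:=2^t$. (2) Choose $x\in[n]^d$ uniformly at random. (3) For each $i\in[d]$ independently choose $a_i\in\{0,1,\dots,\log_2 n-1\}$ and $c_i\in\{0,1\}$ uniformly at random and let $H_i:=H^{c_i}_{i,a_i}$. (4) Let $S\subseteq[d]$ be the set of coordinates $i$ such that $x$ is the lower endpoint of an edge of $H_i$. (5) If $|S|<\tau$, set $y=x$; otherwise choose $T\subseteq S$ with $|T|=\tau$ uniformly at random and set $y_i:=x_i+2^{a_i}$ for $i\in T$ and $y_j:=x_j$ for $j\notin T$. (6) If $f(x)>f(y)$ reject, otherwise accept.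
   Context: $[n]^d$ is partially ordered coordinatewise ($x\preceq y$ iff $x_i\le y_i$ for all $i$). $f$ is monotone if $f(x)\le f(y)$ whenever $x\preceq y$; $f$ is $\varepsilon$-far from monotone if $f$ differs from every monotone function on at least an $\varepsilon$ fraction of $[n]^d$. For $i\in[d]$, $a\ge 0$ an integer: $H^0_{i,a}$ is the set of pairs $(x,y)$ with $y_i-x_i=2^a$, $x_j=y_j$ for all $j\neq i$, and $x_i \bmod 2^{a+1}<2^a$; $H^1_{i,a}$ is the set of pairs $(x,y)$ with $y_i-x_i=2^a$, $x_j=y_j$ for $j\ne i$, and $x_i\bmod 2^{a+1}\ge 2^a$. In a pair $(x,y)$, $x$ is the lower and $y$ the upper endpoint. *)

theory Defs
  imports "HOL-Probability.Probability"
begin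

text \<open>
  Points of $[n]^d$ are functions from the coordinates \<open>{1..d}\<close> to \<open>{1..n}\<close>, extensional so
  that the hypergrid is a finite set of size \<open>n ^ d\<close>. Boolean functions on the hypergrid have
  codomain \<^typ>\<open>bool\<close>, with \<open>False < True\<close> in the role of \<open>0 < 1\<close>; their values off the
  hypergrid are never used.
\<close>

type_synonym point = "nat \<Rightarrow> nat"

definition hypergrid :: "nat \<Rightarrow> nat \<Rightarrow> point set" where
  "hypergrid n d = {1..d} \<rightarrow>\<^sub>E {1..n}"

definition coord_le :: "nat \<Rightarrow> point \<Rightarrow> point \<Rightarrow> bool" where
  "coord_le d x y \<longleftrightarrow> (\<forall>i\<in>{1..d}. x i \<le> y i)"

definition grid_monotone :: "nat \<Rightarrow> nat \<Rightarrow> (point \<Rightarrow> bool) \<Rightarrow> bool" where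
  "grid_monotone n d f \<longleftrightarrow> monotone_on (hypergrid n d) (coord_le d) (\<le>) f"

definition far_from_monotone :: "nat \<Rightarrow> nat \<Rightarrow> real \<Rightarrow> (point \<Rightarrow> bool) \<Rightarrow> bool" where
  "far_from_monotone n d \<epsilon> f \<longleftrightarrow>
     (\<forall>g. grid_monotone n d g \<longrightarrow>
        real (card {x \<in> hypergrid n d. f x \<noteq> g x}) \<ge> \<epsilon> * real (card (hypergrid n d)))"

definition H_edges :: "nat \<Rightarrow> nat \<Rightarrow> nat \<Rightarrow> nat \<Rightarrow> nat \<Rightarrow> (point \<times> point) set" where
  "H_edges n d c i a =
     {(x, y). x \<in> hypergrid n d \<and> y \<in> hypergrid n d \<and>
        int (y i) - int (x i) = 2 ^ a \<and> (\<forall>j\<in>{1..d} - {i}. x j = y j) \<and>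
        (if c = 0 then x i mod 2 ^ (a + 1) < 2 ^ a else x i mod 2 ^ (a + 1) \<ge> 2 ^ a)}"

text \<open>
  The number \<open>scale_bound d\<close> is the quantity bounding the step count \<open>2 ^ t\<close>. A nonnegative
  exponent \<open>p\<close> with \<open>2 ^ p \<le> scale_bound d\<close> exists iff \<open>scale_bound d \<ge> 1\<close>, and only then is
  the value of \<open>max_exponent d\<close> (and hence the tester) meaningful. Division by zero makes
  \<open>scale_bound d = 0\<close> for \<open>d \<le> 1\<close>.
\<close>

definition scale_bound :: "nat \<Rightarrow> real" where
  "scale_bound d = sqrt (real d / (10 * log 2 (real d)))"

definition max_exponent :: "nat \<Rightarrow> nat" where
  "max_exponent d = (GREATEST p. 2 ^ p \<le> scale_bound d)"

datatype verdict = Accept | Reject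

text \<open>
  The tester returns the queried pair along with its verdict. The set from which each exponent
  \<open>a i\<close> is drawn is $\{0, 1, \ldots, \log_2 n - 1\}$. The proximity parameter plays no part in
  the tester's random choices, so it is not an argument.
\<close>

definition tester :: "nat \<Rightarrow> nat \<Rightarrow> (point \<Rightarrow> bool) \<Rightarrow> (point \<times> point \<times> verdict) pmf" where
  "tester n d f =
     do {
       t \<leftarrow> pmf_of_set {0..max_exponent d};
       let \<tau> = 2 ^ t;
       x \<leftarrow> pmf_of_set (hypergrid n d);
       a \<leftarrow> Pi_pmf {1..d} 0 (\<lambda>_. pmf_of_set {e::nat. real e \<le> log 2 (real n) - 1});
       c \<leftarrow> Pi_pmf {1..d} 0 (\<lambda>_. pmf_of_set {0, 1});
       let S = {i \<in> {1..d}. \<exists>z. (x, z) \<in> H_edges n d (c i) i (a i)};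
       y \<leftarrow> (if card S < \<tau> then return_pmf x
            else do {
              T \<leftarrow> pmf_of_set {T. T \<subseteq> S \<and> card T = \<tau>};
              return_pmf (\<lambda>i. if i \<in> T then x i + 2 ^ a i else x i)
            });
       return_pmf (x, y, if f x > f y then Reject else Accept)
     }"

end

theory Submission
  imports Defs "HOL-Library.Function_Algebras"
begin

text \<open>
  Let \<open>n = 2 ^ k\<close>, and call the pairs \<open>(x, x + 2 ^ a)\<close> along a coordinate the augmented edges.

  The heart of the proof is a directed isoperimetric inequality: if \<open>f\<close> is \<open>\<epsilon>\<close>-far from monotone
  then the number of violated augmented edges times the size of a largest matching of violated
  edges is at least of the order \<open>\<epsilon>\<^sup>2 * (n ^ d)\<^sup>2 / k\<close>. Sorting \<open>f\<close> along one coordinate after the other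
  moves the values \<open>True\<close> upwards and yields a large matching of violating pairs \<open>x \<preceq> y\<close>, whose
  total Hamming distance is bounded by the number of violated edges, because on a line the
  number of moves is bounded by the number of violated edges. Close pairs of the matching are then
  joined by paths of augmented edges such that at each time the paths are at distinct points (a
  variant of the Lehman-Ron theorem that holds in every abelian group); each path contains a
  violated edge, so many of these are disjoint.

  A single step of the tester finds a violated edge with probability proportional to their number.
  For a longer walk, start at the lower end of an edge of the matching and use its direction; it
  suffices that the rest of the walk, which starts at the upper end, does not change the value of
  \<open>f\<close>. This is likely for most points since the total influence of \<open>f\<close> is at most of the order \<open>sqrt d\<close>
  plus the number of violated edges per point, and a short walk from a uniform point is nearly uniform.
\<close>

section \<open>Linkages in abelian groups\<close>

text \<open>The exponents balance two ways of detection. Let \<open>\<Phi>\<close> and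
  \<open>\<Gamma>\<close> count all violated edges and the matched ones per point, and let
  \<open>D = log 2 d\<close>. Up to constants, the isoperimetric inequality says that
  \<open>\<Gamma> * \<Phi>\<close> is at least \<open>\<epsilon>\<^sup>2 / k\<close>. Single steps
  succeed with probability \<open>\<Phi> / (d * k * D)\<close>, walks of length \<open>z\<close>
  with \<open>z * \<Gamma> / (d * k * D)\<close>, provided that \<open>z\<close> is at most
  \<open>sqrt (d / D)\<close> (the walk stays nearly uniform) and at most
  \<open>\<Gamma> * sqrt d * k\<close> (its chance \<open>z / (sqrt d * k)\<close> of crossing the
  boundary of \<open>f\<close> stays below \<open>\<Gamma>\<close>). For the latter
  \<open>z\<close>, the first probability squared times the second is \<open>(\<Gamma> *
  \<Phi>)\<^sup>2 / (d powr (5 / 2) * k\<^sup>2 * D ^ 3)\<close>; its cube root has the powers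
  \<open>4 / 3\<close>, \<open>5 / 6\<close>, \<open>4 / 3\<close> of \<open>\<epsilon>\<close>,
  \<open>d\<close>, \<open>k\<close>. The obstacle to disjoint paths is that augmented edges have
  different lengths, so there are no levels to climb one by one. Time replaces the level: paths may
  wait, and edges are collected at one common time.\<close>

lemma hall_marriage:
  fixes A :: "'i \<Rightarrow> 'b set"
  assumes "finite I" and "\<And>i. i \<in> I \<Longrightarrow> finite (A i)"
    and "\<And>J. J \<subseteq> I \<Longrightarrow> card J \<le> card (\<Union>(A ` J))"
  shows "\<exists>F. inj_on F I \<and> (\<forall>i\<in>I. F i \<in> A i)"
  using assms
proof (induction "card I" arbitrary: I A rule: less_induct)
  case less
  note fin = less.prems(1) and finA = less.prems(2) and hall = less.prems(3)
  show ?case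
  proof (cases "I = {}")
    case True
    then show ?thesis by auto
  next
    case False
    then obtain i0 where i0: "i0 \<in> I" by blast
    show ?thesis
    \<comment> \<open>The Halmos-Vaughan induction: a tight proper subset is matched first and the
      rest avoids its neighbourhood; if there is none, any single value can be given away.\<close>
    proof (cases "\<exists>J. J \<subset> I \<and> J \<noteq> {} \<and> card J = card (\<Union>(A ` J))")
      case True
      then obtain J where J: "J \<subset> I" "J \<noteq> {}" "card J = card (\<Union>(A ` J))" by blast
      let ?U = "\<Union>(A ` J)"
      have finJ: "finite J" using J(1) fin finite_subset by blast
      have "card J < card I" using J(1) fin by (simp add: psubset_card_mono)
      then have "\<exists>F. inj_on F J \<and> (\<forall>i\<in>J. F i \<in> A i)"
        using J(1) by (intro less.hyps finJ) (auto intro!: finA hall)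
      then obtain F where F: "inj_on F J" "\<forall>i\<in>J. F i \<in> A i" by blast
      have "card (I - J) < card I"
        using J fin by (intro psubset_card_mono) auto
      moreover have "card K \<le> card (\<Union>((\<lambda>i. A i - ?U) ` K))" if K: "K \<subseteq> I - J" for K
      proof -
        have finK: "finite K" using K fin finite_subset by blast
        have "card K + card J = card (K \<union> J)"
          using K finK finJ by (subst card_Un_disjoint) auto
        also have "\<dots> \<le> card (\<Union>(A ` (K \<union> J)))"
          using K J(1) by (intro hall) auto
        also have "\<Union>(A ` (K \<union> J)) = \<Union>((\<lambda>i. A i - ?U) ` K) \<union> ?U" by auto
        also have "card \<dots> \<le> card (\<Union>((\<lambda>i. A i - ?U) ` K)) + card ?U" by (rule card_Un_le)
        finally show ?thesis using J(3) by simp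
      qed
      ultimately have "\<exists>F. inj_on F (I - J) \<and> (\<forall>i\<in>I - J. F i \<in> A i - ?U)"
        using fin finA by (intro less.hyps) auto
      then obtain F' where F': "inj_on F' (I - J)" "\<forall>i\<in>I - J. F' i \<in> A i - ?U" by blast
      let ?F = "\<lambda>i. if i \<in> J then F i else F' i"
      have "inj_on ?F I"
      proof (rule inj_onI)
        fix x y assume xy: "x \<in> I" "y \<in> I" "?F x = ?F y"
        show "x = y"
        proof (cases "x \<in> J"; cases "y \<in> J")
          assume "x \<in> J" "y \<in> J"
          then show ?thesis using xy F(1) by (auto dest: inj_onD)
        next
          assume "x \<notin> J" "y \<notin> J"
          then show ?thesis using xy F'(1) by (auto dest: inj_onD)
        next
          assume "x \<in> J" "y \<notin> J"
          then have "F x \<in> ?U" "F' y \<notin> ?U" using xy(1,2) F(2) F'(2) by blast+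
          then show ?thesis using xy(3) \<open>x \<in> J\<close> \<open>y \<notin> J\<close> by simp
        next
          assume "x \<notin> J" "y \<in> J"
          then have "F y \<in> ?U" "F' x \<notin> ?U" using xy(1,2) F(2) F'(2) by blast+
          then show ?thesis using xy(3) \<open>x \<notin> J\<close> \<open>y \<in> J\<close> by simp
        qed
      qed
      moreover have "\<forall>i\<in>I. ?F i \<in> A i" using F(2) F'(2) by auto
      ultimately show ?thesis by blast
    next
      case False
      have "card {i0} \<le> card (\<Union>(A ` {i0}))" using i0 by (intro hall) auto
      then have "A i0 \<noteq> {}" by auto
      then obtain b where b: "b \<in> A i0" by blast
      have "card (I - {i0}) < card I" using i0 fin by (rule card_Diff1_less[rotated])
      moreover have "card K \<le> card (\<Union>((\<lambda>i. A i - {b}) ` K))" if K: "K \<subseteq> I - {i0}" for K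
      proof (cases "K = {}")
        case False2: False
        have "K \<subset> I" using K i0 by auto
        then have "card K \<noteq> card (\<Union>(A ` K))" "card K \<le> card (\<Union>(A ` K))"
          using False False2 hall by blast+
        moreover have "(\<Union>((\<lambda>i. A i - {b}) ` K)) = \<Union>(A ` K) - {b}" by auto
        moreover have "card (\<Union>(A ` K)) - 1 \<le> card (\<Union>(A ` K) - {b})"
          by (cases "b \<in> \<Union>(A ` K)") (simp_all add: card_Diff_singleton)
        ultimately show ?thesis by simp
      qed simp
      ultimately have "\<exists>F. inj_on F (I - {i0}) \<and> (\<forall>i\<in>I - {i0}. F i \<in> A i - {b})"
        using fin finA by (intro less.hyps) auto
      then obtain F where F: "inj_on F (I - {i0})" "\<forall>i\<in>I - {i0}. F i \<in> A i - {b}" by blast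
      have "inj_on (F(i0 := b)) I"
        using F by (auto simp: inj_on_def)
      moreover have "\<forall>i\<in>I. (F(i0 := b)) i \<in> A i" using F(2) b by auto
      ultimately show ?thesis by blast
    qed
  qed
qed


text \<open>The layer-cake formula. It lets degree sums be compared threshold by threshold, and
  equality of the sums be carried back to each threshold.\<close>

lemma sum_eq_sum_card_ge:
  fixes h :: "'a \<Rightarrow> nat"
  assumes "finite A" and "\<And>a. a \<in> A \<Longrightarrow> h a \<le> B"
  shows "sum h A = (\<Sum>t\<in>{1..B}. card {a\<in>A. t \<le> h a})"
proof -
  have "(\<Sum>t\<in>{1..B}. card {a\<in>A. t \<le> h a}) = (\<Sum>t\<in>{1..B}. \<Sum>a\<in>A. of_bool (t \<le> h a))"
    using assms(1) by (simp add: Int_def)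
  also have "\<dots> = (\<Sum>a\<in>A. \<Sum>t\<in>{1..B}. of_bool (t \<le> h a))" by (rule sum.swap)
  also have "\<dots> = (\<Sum>a\<in>A. h a)"
  proof (rule sum.cong[OF refl])
    fix a assume "a \<in> A"
    then have "{1..B} \<inter> {t. t \<le> h a} = {1..h a}" using assms(2)[of a] by auto
    then show "(\<Sum>t\<in>{1..B}. of_bool (t \<le> h a)) = h a" by simp
  qed
  finally show ?thesis by simp
qed

lemma sum_card_swap:
  assumes "finite A" "finite B"
  shows "(\<Sum>a\<in>A. card {b\<in>B. P a b}) = (\<Sum>b\<in>B. card {a\<in>A. P a b})"
proof -
  have "(\<Sum>a\<in>A. card {b\<in>B. P a b}) = (\<Sum>a\<in>A. \<Sum>b\<in>B. of_bool (P a b))"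
    using assms by (simp add: Int_def)
  also have "\<dots> = (\<Sum>b\<in>B. \<Sum>a\<in>A. of_bool (P a b))" by (rule sum.swap)
  finally show ?thesis using assms by (simp add: Int_def)
qed

text \<open>The middle layer of the two-step paths from \<open>S\<close> to \<open>R\<close>.
  Removing these points together with the sources outside \<open>S\<close> and the targets outside
  \<open>R\<close> cuts all paths, which is the vertex cut to be bounded.\<close>

definition midpoints :: "'a::ab_group_add set \<Rightarrow> 'a set \<Rightarrow> 'a set \<Rightarrow> 'a set" where
  "midpoints D S R = {w. (\<exists>x\<in>S. w - x \<in> D) \<and> (\<exists>u\<in>R. u - w \<in> D)}"

lemma finite_midpoints: "finite D \<Longrightarrow> finite S \<Longrightarrow> finite (midpoints D S R)"
proof -
  assume "finite D" "finite S"
  moreover have "midpoints D S R \<subseteq> (\<lambda>(x, a). x + a) ` (S \<times> D)"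
  proof
    fix w assume "w \<in> midpoints D S R"
    then obtain x where "x \<in> S" "w - x \<in> D" unfolding midpoints_def by blast
    then show "w \<in> (\<lambda>(x, a). x + a) ` (S \<times> D)" by (intro image_eqI[where x = "(x, w - x)"]) auto
  qed
  ultimately show ?thesis by (meson finite_SigmaI finite_imageI finite_subset)
qed

text \<open>
  Mapping \<open>u\<close> to \<open>x + (u - w)\<close> shows that out-degrees decrease and in-degrees increase along the
  edges between the layers. Together with the minimality of the cut this makes all inequalities
  between the degree sums equalities.
\<close>

lemma midpoint_cut_bound:
  fixes D :: "'a::ab_group_add set"
  assumes fin: "finite S" "finite D" and inj: "inj_on \<phi> S"
    and two: "\<And>x. x \<in> S \<Longrightarrow> \<exists>a\<in>D. \<exists>b\<in>D. \<phi> x = x + a + b"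
    and S0: "S0 \<subseteq> S" and R0: "R0 \<subseteq> \<phi> ` S"
  shows "card S \<le> card (S - S0) + card (\<phi> ` S - R0) + card (midpoints D S0 R0)"
proof -
  let ?R = "\<phi> ` S"
  \<comment> \<open>The size of the vertex cut that belongs to a pair of subsets of \<open>S\<close>
    and \<open>?R\<close>; a cut of minimum size is fixed.\<close>
  define g where "g p = card (S - fst p) + card (?R - snd p) + card (midpoints D (fst p) (snd p))" for p
  have "\<exists>p. is_arg_min g (\<lambda>p. p \<in> Pow S \<times> Pow ?R) p"
    using fin(1) by (intro ex_is_arg_min_if_finite) auto
  then obtain p where p: "p \<in> Pow S \<times> Pow ?R" "\<And>q. q \<in> Pow S \<times> Pow ?R \<Longrightarrow> g p \<le> g q"
    unfolding is_arg_min_linorder by blast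
  obtain S1 R1 where p_eq: "p = (S1, R1)" by (cases p)
  have S1: "S1 \<subseteq> S" and R1: "R1 \<subseteq> ?R" using p(1) unfolding p_eq by auto
  have min: "card (S - S1) + card (?R - R1) + card (midpoints D S1 R1)
      \<le> card (S - S2) + card (?R - R2) + card (midpoints D S2 R2)"
    if "S2 \<subseteq> S" "R2 \<subseteq> ?R" for S2 R2
    using p(2)[of "(S2, R2)"] that unfolding p_eq g_def by simp
  define N where "N = midpoints D S1 R1"
  have finS1: "finite S1" and finR1: "finite R1" and finR: "finite ?R"
    using S1 R1 fin finite_subset by blast+
  have finN: "finite N" using finite_midpoints fin(2) finS1 unfolding N_def by blast
  define od where "od w = card {u\<in>R1. u - w \<in> D}" for w
  define idg where "idg w = card {x\<in>S1. w - x \<in> D}" for w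
  define al where "al x = card {w\<in>N. w - x \<in> D}" for x
  define be where "be u = card {w\<in>N. u - w \<in> D}" for u
  \<comment> \<open>Moving \<open>Y\<close> into the cut costs \<open>card Y\<close> and saves the
    midpoints reachable only from \<open>Y\<close>, so by minimality there are at most
    \<open>card Y\<close> of these.\<close>
  have privS: "card (N - midpoints D (S1 - Y) R1) \<le> card Y" if Y: "Y \<subseteq> S1" for Y
  proof -
    have finY: "finite Y" using Y finS1 finite_subset by blast
    have sub: "midpoints D (S1 - Y) R1 \<subseteq> N" unfolding N_def midpoints_def by blast
    have "S - (S1 - Y) = (S - S1) \<union> Y" using Y S1 by blast
    then have "card (S - (S1 - Y)) = card (S - S1) + card Y"
      using card_Un_disjoint[of "S - S1" Y] fin finY Y by (metis Diff_disjoint Int_commute disjoint_iff finite_Diff subsetD)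
    then have "card N \<le> card Y + card (midpoints D (S1 - Y) R1)"
      using min[of "S1 - Y" R1] S1 R1 unfolding N_def by auto
    then show ?thesis using sub finN by (simp add: card_Diff_subset finite_subset)
  qed
  have privR: "card (N - midpoints D S1 (R1 - Y)) \<le> card Y" if Y: "Y \<subseteq> R1" for Y
  proof -
    have finY: "finite Y" using Y finR1 finite_subset by blast
    have sub: "midpoints D S1 (R1 - Y) \<subseteq> N" unfolding N_def midpoints_def by blast
    have "?R - (R1 - Y) = (?R - R1) \<union> Y" using Y R1 by blast
    then have "card (?R - (R1 - Y)) = card (?R - R1) + card Y"
      using card_Un_disjoint[of "?R - R1" Y] finR finY Y by (metis Diff_disjoint Int_commute disjoint_iff finite_Diff subsetD)
    then have "card N \<le> card Y + card (midpoints D S1 (R1 - Y))"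
      using min[of S1 "R1 - Y"] S1 R1 unfolding N_def by auto
    then show ?thesis using sub finN by (simp add: card_Diff_subset finite_subset)
  qed
  have od_le: "od w \<le> al x" if "x \<in> S1" "w \<in> N" "w - x \<in> D" for x w
    unfolding od_def al_def
  proof (rule card_inj_on_le[where f = "\<lambda>u. x + (u - w)"])
    show "(\<lambda>u. x + (u - w)) ` {u \<in> R1. u - w \<in> D} \<subseteq> {w \<in> N. w - x \<in> D}"
    proof (clarify, intro conjI)
      fix u assume u: "u \<in> R1" "u - w \<in> D"
      have "u - (x + (u - w)) = w - x" "x + (u - w) - x = u - w" by simp_all
      then show "x + (u - w) \<in> N" "x + (u - w) - x \<in> D"
        using u that unfolding N_def midpoints_def by (auto intro!: bexI)
    qed
  qed (use finN in \<open>auto simp: inj_on_def\<close>)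
  have idg_le: "idg w \<le> be u" if "u \<in> R1" "w \<in> N" "u - w \<in> D" for u w
    unfolding idg_def be_def
  proof (rule card_inj_on_le[where f = "\<lambda>x. x + (u - w)"])
    show "(\<lambda>x. x + (u - w)) ` {x \<in> S1. w - x \<in> D} \<subseteq> {w \<in> N. u - w \<in> D}"
    proof (clarify, intro conjI)
      fix x assume x: "x \<in> S1" "w - x \<in> D"
      have "u - (x + (u - w)) = w - x" "x + (u - w) - x = u - w" by simp_all
      then show "x + (u - w) \<in> N" "u - (x + (u - w)) \<in> D"
        using x that unfolding N_def midpoints_def by (auto intro!: bexI)
    qed
  qed (use finN in \<open>auto simp: inj_on_def\<close>)
  \<comment> \<open>All neighbours in \<open>S1\<close> of a midpoint with
    \<open>t \<le> od w\<close> lie in \<open>?Y\<close>, so the midpoint is reachable only from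
    \<open>?Y\<close>; by \<open>od_le\<close> the members of \<open>?Y\<close> have degree at least
    \<open>t\<close>.\<close>
  have layerS: "card {w\<in>N. t \<le> od w} \<le> card {x\<in>S1. t \<le> al x}" for t
  proof -
    let ?Y = "{x\<in>S1. \<exists>w\<in>N. t \<le> od w \<and> w - x \<in> D}"
    have "card {w\<in>N. t \<le> od w} \<le> card (N - midpoints D (S1 - ?Y) R1)"
      using finN by (intro card_mono) (auto simp: midpoints_def)
    also have "\<dots> \<le> card ?Y" by (rule privS) auto
    also have "\<dots> \<le> card {x\<in>S1. t \<le> al x}"
      using finS1 od_le by (intro card_mono) (auto intro: order_trans)
    finally show ?thesis .
  qed
  have layerR: "card {w\<in>N. t \<le> idg w} \<le> card {u\<in>R1. t \<le> be u}" for t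
  proof -
    let ?Y = "{u\<in>R1. \<exists>w\<in>N. t \<le> idg w \<and> u - w \<in> D}"
    have "card {w\<in>N. t \<le> idg w} \<le> card (N - midpoints D S1 (R1 - ?Y))"
      using finN by (intro card_mono) (auto simp: midpoints_def)
    also have "\<dots> \<le> card ?Y" by (rule privR) auto
    also have "\<dots> \<le> card {u\<in>R1. t \<le> be u}"
      using finR1 idg_le by (intro card_mono) (auto intro: order_trans)
    finally show ?thesis .
  qed
  \<comment> \<open>A common bound for all degrees. The \<open>Suc\<close> guarantees that the
    threshold \<open>1\<close>, which is singled out below, belongs to
    \<open>{1..B}\<close>.\<close>
  define B where "B = Suc (card S1 + card R1 + card N)"
  have bounds: "od w \<le> B" "idg w \<le> B" "al w \<le> B" "be w \<le> B" for w
    unfolding od_def idg_def al_def be_def B_def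
    using card_mono[OF finR1, of "{u\<in>R1. u - w \<in> D}"] card_mono[OF finS1, of "{x\<in>S1. w - x \<in> D}"]
      card_mono[OF finN, of "{v\<in>N. v - w \<in> D}"] card_mono[OF finN, of "{v\<in>N. w - v \<in> D}"]
    by fastforce+
  have so: "sum od N = (\<Sum>t\<in>{1..B}. card {w\<in>N. t \<le> od w})"
    and sa: "sum al S1 = (\<Sum>t\<in>{1..B}. card {x\<in>S1. t \<le> al x})"
    and si: "sum idg N = (\<Sum>t\<in>{1..B}. card {w\<in>N. t \<le> idg w})"
    and sb: "sum be R1 = (\<Sum>t\<in>{1..B}. card {u\<in>R1. t \<le> be u})"
    using sum_eq_sum_card_ge[OF finN] sum_eq_sum_card_ge[OF finS1] sum_eq_sum_card_ge[OF finR1] bounds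
    by blast+
  have "sum od N \<le> sum al S1" unfolding so sa by (intro sum_mono layerS)
  moreover have "sum al S1 = sum idg N"
    unfolding al_def idg_def by (rule sum_card_swap[OF finS1 finN])
  moreover have "sum idg N \<le> sum be R1" unfolding si sb by (intro sum_mono layerR)
  moreover have "sum be R1 = sum od N"
    unfolding be_def od_def by (rule sum_card_swap[OF finR1 finN])
  ultimately have "sum od N = sum al S1" by simp
  \<comment> \<open>Equal sums with termwise inequalities agree termwise. At threshold
    \<open>1\<close> this says that there are as many midpoints as sources with an edge to a
    midpoint.\<close>
  then have eq1: "card {w\<in>N. 1 \<le> od w} = card {x\<in>S1. 1 \<le> al x}"
    unfolding so sa by (rule sum_mono_inv) (use layerS in \<open>auto simp: B_def\<close>)
  have "{w\<in>N. 1 \<le> od w} = N"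
  proof -
    have "1 \<le> od w" if "w \<in> N" for w
    proof -
      have "{u\<in>R1. u - w \<in> D} \<noteq> {}" using that unfolding N_def midpoints_def by blast
      then have "od w > 0" using finR1 unfolding od_def by (subst card_gt_0_iff) auto
      then show ?thesis by simp
    qed
    then show ?thesis by blast
  qed
  with eq1 have cardN: "card N = card {x\<in>S1. 1 \<le> al x}" by simp
  \<comment> \<open>A source without midpoints has its own target \<open>\<phi> x\<close> outside
    \<open>R1\<close>, since otherwise the given two-step path would supply a midpoint. So
    \<open>\<phi>\<close> injects these sources into the cut targets.\<close>
  have "card {x\<in>S1. al x = 0} \<le> card (?R - R1)"
  proof (rule card_inj_on_le[where f = \<phi>])
    show "\<phi> ` {x \<in> S1. al x = 0} \<subseteq> ?R - R1"
    proof clarify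
      fix x assume x: "x \<in> S1" "al x = 0"
      have "\<phi> x \<notin> R1"
      proof
        assume u: "\<phi> x \<in> R1"
        obtain a b where ab: "a \<in> D" "b \<in> D" "\<phi> x = x + a + b" using two x S1 by blast
        then have "x + a - x \<in> D" "\<phi> x - (x + a) \<in> D" by simp_all
        then have "x + a \<in> {w\<in>N. w - x \<in> D}" using x u unfolding N_def midpoints_def by blast
        then show False using x(2) finN unfolding al_def by auto
      qed
      then show "\<phi> x \<in> ?R - R1" using x S1 by blast
    qed
  qed (use inj S1 finR in \<open>auto simp: inj_on_def\<close>)
  moreover have "card S1 = card {x\<in>S1. 1 \<le> al x} + card {x\<in>S1. al x = 0}"
    using finS1 by (subst card_Un_disjoint[symmetric]) (auto intro!: arg_cong[where f = card])
  moreover have "card S = card (S - S1) + card S1"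
    using S1 fin(1) finS1 by (simp add: card_Diff_subset card_mono)
  ultimately have "card S \<le> card (S - S1) + card (?R - R1) + card (midpoints D S1 R1)"
    using cardN unfolding N_def by simp
  also have "\<dots> \<le> card (S - S0) + card (?R - R0) + card (midpoints D S0 R0)" using S0 R0 by (rule min)
  finally show ?thesis .
qed

text \<open>
  Disjoint two-step paths from \<open>S\<close> to \<open>R\<close> through \<open>N\<close> are the matchings that saturate \<open>S + N\<close> in a
  bipartite graph between \<open>S + N\<close> and \<open>N + R\<close>, where joining the two copies of \<open>w\<close> means that \<open>w\<close>
  is unused.
\<close>

lemma two_step_linkage:
  fixes D :: "'a::ab_group_add set"
  assumes fin: "finite S" "finite D" and inj: "inj_on \<phi> S"
    and two: "\<And>x. x \<in> S \<Longrightarrow> \<exists>a\<in>D. \<exists>b\<in>D. \<phi> x = x + a + b"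
  shows "\<exists>\<psi> \<xi>. inj_on \<psi> S \<and> inj_on \<xi> S \<and> \<xi> ` S = \<phi> ` S \<and>
           (\<forall>x\<in>S. \<psi> x - x \<in> D \<and> \<xi> x - \<psi> x \<in> D)"
proof -
  let ?R = "\<phi> ` S"
  define N where "N = midpoints D S ?R"
  have finN: "finite N" using finite_midpoints fin unfolding N_def by blast
  have finR: "finite ?R" using fin by simp
  define A :: "'a + 'a \<Rightarrow> ('a + 'a) set" where
    "A v = (case v of Inl x \<Rightarrow> Inl ` {w\<in>N. w - x \<in> D}
                    | Inr w \<Rightarrow> insert (Inl w) (Inr ` {u\<in>?R. u - w \<in> D}))" for v
  have "\<exists>F. inj_on F (S <+> N) \<and> (\<forall>v\<in>S <+> N. F v \<in> A v)"
  proof (rule hall_marriage)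
    show "finite (S <+> N)" using fin finN by simp
    show "finite (A v)" for v using finN finR unfolding A_def by (auto split: sum.split)
    fix J assume J: "J \<subseteq> S <+> N"
    define S1 where "S1 = {x. Inl x \<in> J}"
    define N1 where "N1 = {w. Inr w \<in> J}"
    \<comment> \<open>The cut bound is applied to \<open>S1\<close> and the targets not adjacent to
      \<open>N1\<close>. The midpoints between these are not in \<open>N1\<close>, so they and the
      copies of \<open>N1\<close> count as different neighbours of \<open>J\<close>.\<close>
    define R2 where "R2 = {u\<in>?R. \<exists>w\<in>N1. u - w \<in> D}"
    have S1: "S1 \<subseteq> S" and N1: "N1 \<subseteq> N" using J unfolding S1_def N1_def by auto
    have f1: "finite S1" "finite N1" using S1 N1 fin finN finite_subset by blast+
    have "J = Inl ` S1 \<union> Inr ` N1"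
      unfolding S1_def N1_def by (auto simp: image_iff) (metis sum.exhaust)
    then have "card J = card S1 + card N1"
      using f1 by (subst \<open>J = _\<close>, subst card_Un_disjoint) (auto simp: card_image)
    also have "card S1 + card (S - S1) = card S"
      using S1 fin(1) f1 by (simp add: card_Diff_subset card_mono)
    then have "card S1 + card N1 \<le> card (?R - (?R - R2)) + card (midpoints D S1 (?R - R2)) + card N1"
      using midpoint_cut_bound[OF fin inj two S1, of "?R - R2"] by force
    also have "?R - (?R - R2) = R2" unfolding R2_def by blast
    also have "card R2 + card (midpoints D S1 (?R - R2)) + card N1
      = card (Inr ` R2 \<union> Inl ` (midpoints D S1 (?R - R2) \<union> N1) :: ('a + 'a) set)"
    proof -
      have "midpoints D S1 (?R - R2) \<inter> N1 = {}" unfolding midpoints_def R2_def by blast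
      then have "card (midpoints D S1 (?R - R2) \<union> N1) = card (midpoints D S1 (?R - R2)) + card N1"
        using finite_midpoints[OF fin(2) f1(1)] f1 by (intro card_Un_disjoint)
      moreover have "finite R2" unfolding R2_def using finR by simp
      ultimately show ?thesis
        using finite_midpoints[OF fin(2) f1(1), of "?R - R2"] f1
        by (subst card_Un_disjoint) (auto simp: card_image)
    qed
    also have "\<dots> \<le> card (\<Union>(A ` J))"
    proof (rule card_mono)
      have "finite J" using \<open>J = _\<close> f1 by simp
      then show "finite (\<Union>(A ` J))" using \<open>\<And>v. finite (A v)\<close> by blast
      have "midpoints D S1 (?R - R2) \<subseteq> {w\<in>N. \<exists>x\<in>S1. w - x \<in> D}"
        using S1 unfolding midpoints_def N_def by blast
      then show "Inr ` R2 \<union> Inl ` (midpoints D S1 (?R - R2) \<union> N1) \<subseteq> \<Union>(A ` J)"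
        unfolding R2_def N1_def S1_def A_def by (fastforce split: sum.splits)
    qed
    finally show "card J \<le> card (\<Union>(A ` J))" .
  qed
  then obtain F where F: "inj_on F (S <+> N)" "\<And>v. v \<in> S <+> N \<Longrightarrow> F v \<in> A v" by blast
  have "\<exists>w. F (Inl x) = Inl w \<and> w \<in> N \<and> w - x \<in> D" if "x \<in> S" for x
    using F(2)[of "Inl x"] that unfolding A_def by auto
  then obtain \<psi> where \<psi>: "\<And>x. x \<in> S \<Longrightarrow> F (Inl x) = Inl (\<psi> x) \<and> \<psi> x \<in> N \<and> \<psi> x - x \<in> D"
    by metis
  \<comment> \<open>The value \<open>Inl (\<psi> x)\<close>, which would mark
    \<open>\<psi> x\<close> as idle, is already taken by the source \<open>x\<close>; hence the
    midpoint must be matched to a target.\<close>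
  have "\<exists>u. F (Inr (\<psi> x)) = Inr u \<and> u \<in> ?R \<and> u - \<psi> x \<in> D" if x: "x \<in> S" for x
  proof -
    have "F (Inr (\<psi> x)) \<noteq> F (Inl x)"
      using inj_onD[OF F(1), of "Inr (\<psi> x)" "Inl x"] \<psi>[OF x] x by auto
    then show ?thesis using F(2)[of "Inr (\<psi> x)"] \<psi>[OF x] unfolding A_def by auto
  qed
  then obtain \<xi> where \<xi>: "\<And>x. x \<in> S \<Longrightarrow> F (Inr (\<psi> x)) = Inr (\<xi> x) \<and> \<xi> x \<in> ?R \<and> \<xi> x - \<psi> x \<in> D"
    by metis
  have inj\<psi>: "inj_on \<psi> S"
  proof (rule inj_onI)
    fix x y assume "x \<in> S" "y \<in> S" "\<psi> x = \<psi> y"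
    then show "x = y" using \<psi> inj_onD[OF F(1), of "Inl x" "Inl y"] by auto
  qed
  moreover have inj\<xi>: "inj_on \<xi> S"
  proof (rule inj_onI)
    fix x y assume "x \<in> S" "y \<in> S" "\<xi> x = \<xi> y"
    then have "\<psi> x = \<psi> y" using \<psi> \<xi> inj_onD[OF F(1), of "Inr (\<psi> x)" "Inr (\<psi> y)"] by auto
    then show "x = y" using inj\<psi> \<open>x \<in> S\<close> \<open>y \<in> S\<close> by (auto dest: inj_onD)
  qed
  moreover have "\<xi> ` S = ?R"
    using \<xi> finR inj\<xi> inj by (intro card_subset_eq) (auto simp: card_image)
  ultimately show ?thesis using \<psi> \<xi> by blast
qed

section \<open>Iterated sumsets and linkages of longer paths\<close>

primrec sumset_pow :: "'a::ab_group_add set \<Rightarrow> nat \<Rightarrow> 'a set" where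
  "sumset_pow D 0 = {0}"
| "sumset_pow D (Suc m) = (\<lambda>(a, b). a + b) ` (D \<times> sumset_pow D m)"

lemma finite_sumset_pow: "finite D \<Longrightarrow> finite (sumset_pow D m)"
  by (induction m) auto

lemma sumset_pow_add_iff:
  "v \<in> sumset_pow D (m + m') \<longleftrightarrow> (\<exists>a\<in>sumset_pow D m. \<exists>b\<in>sumset_pow D m'. v = a + b)"
proof (induction m arbitrary: v)
  case 0
  then show ?case by auto
next
  case (Suc m)
  show ?case
  proof
    assume "v \<in> sumset_pow D (Suc m + m')"
    then obtain e w where e: "e \<in> D" "w \<in> sumset_pow D (m + m')" "v = e + w" by auto
    then obtain a b where "a \<in> sumset_pow D m" "b \<in> sumset_pow D m'" "w = a + b" using Suc by blast
    then show "\<exists>a\<in>sumset_pow D (Suc m). \<exists>b\<in>sumset_pow D m'. v = a + b"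
      using e by (intro bexI[of _ "e + a"] bexI[of _ b]) (auto simp: add.assoc)
  next
    assume "\<exists>a\<in>sumset_pow D (Suc m). \<exists>b\<in>sumset_pow D m'. v = a + b"
    then obtain e a b where "e \<in> D" "a \<in> sumset_pow D m" "b \<in> sumset_pow D m'" "v = e + a + b" by auto
    moreover from this have "a + b \<in> sumset_pow D (m + m')" using Suc by blast
    ultimately show "v \<in> sumset_pow D (Suc m + m')"
      by (auto simp: add.assoc intro!: image_eqI[where x = "(e, a + b)"])
  qed
qed

text \<open>A path is padded by waiting: \<open>0\<close> counts as a step, so a set of pairs at
  various distances can share one path length.\<close>

lemma sumset_pow_mono:
  assumes "0 \<in> D" "m \<le> m'" "v \<in> sumset_pow D m"
  shows "v \<in> sumset_pow D m'"
  using assms(2,3)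
proof (induction m' rule: dec_induct)
  case (step j)
  then show ?case using assms(1) by (auto intro!: image_eqI[where x = "(0, v)"])
qed

text \<open>By doubling: the two-step linkage for the \<open>2 ^ q\<close>-fold sumset fixes the
  positions at half time, and both halves are refined recursively. Only the set of end points is
  preserved; which start leads to which end may change.\<close>

lemma linkage_pow2:
  fixes D :: "'a::ab_group_add set"
  assumes "finite S" "finite D" "inj_on \<phi> S"
    and "\<And>x. x \<in> S \<Longrightarrow> \<phi> x - x \<in> sumset_pow D (2 ^ q)"
  shows "\<exists>P. (\<forall>t\<le>2 ^ q. inj_on (P t) S) \<and> (\<forall>x\<in>S. P 0 x = x) \<and> P (2 ^ q) ` S = \<phi> ` S \<and>
           (\<forall>x\<in>S. \<forall>t<2 ^ q. P (Suc t) x - P t x \<in> D)"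
  using assms
proof (induction q arbitrary: S \<phi>)
  case 0
  let ?P = "\<lambda>t::nat. \<lambda>x. if t = 0 then x else \<phi> x"
  have "(\<forall>t\<le>2 ^ 0. inj_on (?P t) S) \<and> (\<forall>x\<in>S. ?P 0 x = x) \<and> ?P (2 ^ 0) ` S = \<phi> ` S \<and>
    (\<forall>x\<in>S. \<forall>t<2 ^ 0. ?P (Suc t) x - ?P t x \<in> D)"
  proof -
    have "(\<lambda>(a, b). a + b) ` (D \<times> {0}) = D" by force
    then have "\<phi> x - x \<in> D" if "x \<in> S" for x using 0(4)[OF that] by simp
    then show ?thesis using 0(3) by (auto simp: inj_on_def)
  qed
  then show ?case by (rule exI[of _ ?P])
next
  case (Suc q)
  let ?D = "sumset_pow D (2 ^ q)"
  have "\<exists>a\<in>?D. \<exists>b\<in>?D. \<phi> x = x + a + b" if "x \<in> S" for x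
  proof -
    have "\<phi> x - x \<in> sumset_pow D (2 ^ q + 2 ^ q)" using Suc.prems(4)[OF that] by (simp add: mult_2)
    then obtain a b where "a \<in> ?D" "b \<in> ?D" "\<phi> x - x = a + b" unfolding sumset_pow_add_iff by blast
    then show ?thesis by (intro bexI[of _ a] bexI[of _ b]) (auto simp: algebra_simps)
  qed
  then have "\<exists>\<psi> \<xi>. inj_on \<psi> S \<and> inj_on \<xi> S \<and> \<xi> ` S = \<phi> ` S \<and>
      (\<forall>x\<in>S. \<psi> x - x \<in> ?D \<and> \<xi> x - \<psi> x \<in> ?D)"
    by (rule two_step_linkage[OF Suc.prems(1) finite_sumset_pow[OF Suc.prems(2)] Suc.prems(3)])
  then obtain \<psi> \<xi> where \<psi>: "inj_on \<psi> S" "inj_on \<xi> S" "\<xi> ` S = \<phi> ` S"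
    "\<And>x. x \<in> S \<Longrightarrow> \<psi> x - x \<in> ?D" "\<And>x. x \<in> S \<Longrightarrow> \<xi> x - \<psi> x \<in> ?D"
    by metis
  obtain P1 where P1: "\<And>t. t \<le> 2 ^ q \<Longrightarrow> inj_on (P1 t) S" "\<And>x. x \<in> S \<Longrightarrow> P1 0 x = x"
    "P1 (2 ^ q) ` S = \<psi> ` S" "\<And>x t. x \<in> S \<Longrightarrow> t < 2 ^ q \<Longrightarrow> P1 (Suc t) x - P1 t x \<in> D"
    using Suc.IH[OF Suc.prems(1,2) \<psi>(1,4)] by metis
  \<comment> \<open>The second half starts at the half-time positions, so \<open>\<xi>\<close> is
    re-indexed by these.\<close>
  let ?W = "\<psi> ` S" and ?\<xi> = "\<lambda>w. \<xi> (inv_into S \<psi> w)"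
  have inv: "inv_into S \<psi> (\<psi> x) = x" if "x \<in> S" for x using \<psi>(1) that by simp
  have "inj_on ?\<xi> ?W" using \<psi>(1,2) by (auto simp: inj_on_def inv)
  moreover have "?\<xi> w - w \<in> ?D" if "w \<in> ?W" for w using that \<psi>(5) inv by auto
  ultimately have "\<exists>P. (\<forall>t\<le>2 ^ q. inj_on (P t) ?W) \<and> (\<forall>w\<in>?W. P 0 w = w) \<and> P (2 ^ q) ` ?W = ?\<xi> ` ?W \<and>
      (\<forall>w\<in>?W. \<forall>t<2 ^ q. P (Suc t) w - P t w \<in> D)"
    by (intro Suc.IH finite_imageI Suc.prems(1,2))
  then obtain P2 where P2: "\<And>t. t \<le> 2 ^ q \<Longrightarrow> inj_on (P2 t) ?W" "\<And>w. w \<in> ?W \<Longrightarrow> P2 0 w = w"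
    "P2 (2 ^ q) ` ?W = ?\<xi> ` ?W" "\<And>w t. w \<in> ?W \<Longrightarrow> t < 2 ^ q \<Longrightarrow> P2 (Suc t) w - P2 t w \<in> D"
    by metis
  have im\<xi>: "?\<xi> ` ?W = \<phi> ` S" using \<psi>(3) inv by (auto simp: image_image)
  \<comment> \<open>The refined first half may bring \<open>x\<close> to the half-time position of
    another source; the second half continues from the actual place of arrival.\<close>
  define P where "P t x = (if t \<le> 2 ^ q then P1 t x else P2 (t - 2 ^ q) (P1 (2 ^ q) x))" for t x
  have "inj_on (P t) S" if "t \<le> 2 ^ Suc q" for t
  proof (cases "t \<le> 2 ^ q")
    case True
    then show ?thesis using P1(1) unfolding P_def by simp
  next
    case False
    then have "inj_on (P2 (t - 2 ^ q)) (P1 (2 ^ q) ` S)" using P2(1) P1(3) that by simp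
    then show ?thesis using comp_inj_on[OF P1(1)[of "2 ^ q"]] False unfolding P_def by (simp add: o_def)
  qed
  moreover have "P 0 x = x" if "x \<in> S" for x using P1(2) that unfolding P_def by simp
  moreover have "P (2 ^ Suc q) ` S = \<phi> ` S"
  proof -
    have "P (2 ^ Suc q) ` S = P2 (2 ^ q) ` (P1 (2 ^ q) ` S)" unfolding P_def by (simp add: image_image)
    then show ?thesis using P1(3) P2(3) im\<xi> by simp
  qed
  moreover have "P (Suc t) x - P t x \<in> D" if x: "x \<in> S" and t: "t < 2 ^ Suc q" for x t
  proof (cases "t < 2 ^ q")
    case True
    then show ?thesis using P1(4) x unfolding P_def by simp
  next
    case False
    have w: "P1 (2 ^ q) x \<in> ?W" using P1(3) x by blast
    have "P t x = P2 (t - 2 ^ q) (P1 (2 ^ q) x)"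
      using False P2(2)[OF w] unfolding P_def by auto
    moreover have "P (Suc t) x = P2 (Suc (t - 2 ^ q)) (P1 (2 ^ q) x)"
      using False unfolding P_def by (simp add: Suc_diff_le)
    ultimately show ?thesis using P2(4)[OF w, of "t - 2 ^ q"] False t by simp
  qed
  ultimately show ?case by blast
qed

section \<open>Sorting on a line\<close>

definition descents :: "(nat \<Rightarrow> bool) \<Rightarrow> nat \<Rightarrow> nat \<Rightarrow> nat \<Rightarrow> nat set" where
  "descents g l r s = {t\<in>{l..<r}. t + s < r \<and> g t \<and> \<not> g (t + s)}"

lemma finite_descents [simp]: "finite (descents g l r s)"
  unfolding descents_def by simp

text \<open>A descent of length \<open>s + s'\<close> at \<open>t\<close> is a descent of length
  \<open>s\<close> at \<open>t\<close> unless \<open>g (t + s)\<close> holds, and then a descent of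
  length \<open>s'\<close> starts at \<open>t + s\<close>.\<close>

lemma card_descents_add: "card (descents g l r (s + s')) \<le> card (descents g l r s) + card (descents g l r s')"
proof -
  have "card (descents g l r (s + s') - descents g l r s) \<le> card (descents g l r s')"
    by (rule card_inj_on_le[where f = "\<lambda>t. t + s"]) (auto simp: descents_def add.assoc)
  moreover have "card (descents g l r (s + s')) \<le> card (descents g l r s) + card (descents g l r (s + s') - descents g l r s)"
    by (rule order_trans[OF card_mono card_Un_le]) auto
  ultimately show ?thesis by linarith
qed

definition dyadic_descents :: "(nat \<Rightarrow> bool) \<Rightarrow> nat \<Rightarrow> nat \<Rightarrow> nat \<Rightarrow> nat" where
  "dyadic_descents g k l r = (\<Sum>a<k. card (descents g l r (2 ^ a)))"

text \<open>Subadditivity along the binary expansion of \<open>s\<close>, in which each power of two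
  occurs at most once.\<close>

lemma card_descents_le_dyadic: "s < 2 ^ k \<Longrightarrow> card (descents g l r s) \<le> dyadic_descents g k l r"
proof (induction k arbitrary: s)
  case 0
  then show ?case by (simp add: descents_def)
next
  case (Suc k)
  show ?case
  proof (cases "s < 2 ^ k")
    case True
    then show ?thesis using Suc.IH[of s] by (simp add: dyadic_descents_def)
  next
    case False
    then obtain s' where s: "s = s' + 2 ^ k" by (metis add.commute le_Suc_ex not_less)
    then have "s' < 2 ^ k" using Suc.prems by simp
    then have "card (descents g l r s') \<le> dyadic_descents g k l r" by (rule Suc.IH)
    then show ?thesis using card_descents_add[of g l r s' "2 ^ k"] unfolding s
      by (simp add: dyadic_descents_def)
  qed
qed

lemma dyadic_descents_split:
  assumes "l \<le> m" "m \<le> r"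
  shows "dyadic_descents g k l m + dyadic_descents g k m r \<le> dyadic_descents g k l r"
proof -
  have "card (descents g l m s) + card (descents g m r s) \<le> card (descents g l r s)" for s
  proof -
    have "card (descents g l m s) + card (descents g m r s) = card (descents g l m s \<union> descents g m r s)"
      by (rule card_Un_disjoint[symmetric]) (auto simp: descents_def)
    also have "\<dots> \<le> card (descents g l r s)"
      using assms by (intro card_mono) (auto simp: descents_def)
    finally show ?thesis .
  qed
  then show ?thesis unfolding dyadic_descents_def sum.distrib[symmetric] by (intro sum_mono)
qed

definition ones :: "(nat \<Rightarrow> bool) \<Rightarrow> nat \<Rightarrow> nat \<Rightarrow> nat" where
  "ones g l r = card {t\<in>{l..<r}. g t}"

definition zeros :: "(nat \<Rightarrow> bool) \<Rightarrow> nat \<Rightarrow> nat \<Rightarrow> nat" where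
  "zeros g l r = card {t\<in>{l..<r}. \<not> g t}"

lemma ones_zeros: "l \<le> r \<Longrightarrow> ones g l r + zeros g l r = r - l"
proof -
  assume "l \<le> r"
  have "ones g l r + zeros g l r = card ({t\<in>{l..<r}. g t} \<union> {t\<in>{l..<r}. \<not> g t})"
    unfolding ones_def zeros_def by (rule card_Un_disjoint[symmetric]) auto
  also have "{t\<in>{l..<r}. g t} \<union> {t\<in>{l..<r}. \<not> g t} = {l..<r}" by auto
  finally show ?thesis by simp
qed

lemma ones_split: "l \<le> m \<Longrightarrow> m \<le> r \<Longrightarrow> ones g l r = ones g l m + ones g m r"
  unfolding ones_def by (subst card_Un_disjoint[symmetric]) (auto intro!: arg_cong[where f = card])

lemma zeros_split: "l \<le> m \<Longrightarrow> m \<le> r \<Longrightarrow> zeros g l r = zeros g l m + zeros g m r"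
  unfolding zeros_def by (subst card_Un_disjoint[symmetric]) (auto intro!: arg_cong[where f = card])

lemma ones_Suc: "ones g l (Suc l) = of_bool (g l)"
proof -
  have "{t\<in>{l..<Suc l}. g t} = (if g l then {l} else {})" by auto
  then show ?thesis unfolding ones_def by simp
qed

lemma zeros_Suc: "zeros g l (Suc l) = of_bool (\<not> g l)"
proof -
  have "{t\<in>{l..<Suc l}. \<not> g t} = (if g l then {} else {l})" by auto
  then show ?thesis unfolding zeros_def by simp
qed

text \<open>At least \<open>m * m / 4\<close> pairs consist of a one in the left half and a zero in
  the right half. Grouped by their distance, which is below \<open>2 * m\<close>, each group is a
  set of descents and so no larger than the dyadic count.\<close>

lemma balanced_block_descents:
  assumes m: "0 < m" "2 * m \<le> 2 ^ k"
    and half: "m \<le> 2 * ones g l (l + m)" "m \<le> 2 * zeros g (l + m) (l + 2 * m)"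
  shows "m \<le> 8 * dyadic_descents g k l (l + 2 * m)"
proof -
  let ?W = "dyadic_descents g k l (l + 2 * m)"
  let ?T = "{t\<in>{l..<l + m}. g t}" and ?U = "{u\<in>{l + m..<l + 2 * m}. \<not> g u}"
  have "ones g l (l + m) * zeros g (l + m) (l + 2 * m) = card (?T \<times> ?U)"
    unfolding ones_def zeros_def by (simp add: card_cartesian_product)
  also have "\<dots> \<le> card (SIGMA s:{1..<2 * m}. descents g l (l + 2 * m) s)"
    by (rule card_inj_on_le[where f = "\<lambda>(t, u). (u - t, t)"]) (auto simp: inj_on_def descents_def)
  also have "\<dots> = (\<Sum>s\<in>{1..<2 * m}. card (descents g l (l + 2 * m) s))" by simp
  also have "\<dots> \<le> (\<Sum>s\<in>{1..<2 * m}. ?W)"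
    using m(2) by (intro sum_mono card_descents_le_dyadic) auto
  also have "\<dots> \<le> 2 * m * ?W" by simp
  finally have 1: "ones g l (l + m) * zeros g (l + m) (l + 2 * m) \<le> 2 * m * ?W" .
  have "m * m \<le> (2 * ones g l (l + m)) * (2 * zeros g (l + m) (l + 2 * m))"
    using half by (rule mult_le_mono)
  also have "\<dots> \<le> m * (8 * ?W)" using 1 by simp
  finally show ?thesis using m(1) by simp
qed

text \<open>
  Peel off a maximal constant piece, or the first balanced prefix (last balanced suffix), whose
  minority symbols are paid for by the descents inside it.
\<close>

lemma threshold_le_dyadic_descents:
  "l \<le> r \<Longrightarrow> r - l \<le> 2 ^ k \<Longrightarrow>
     \<exists>p\<in>{l..r}. ones g l p + zeros g p r \<le> 8 * dyadic_descents g k l r"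
proof (induction "r - l" arbitrary: l r rule: less_induct)
  case less
  note lr = less.prems
  have z: "ones g p p = 0" "zeros g p p = 0" for p unfolding ones_def zeros_def by simp_all
  show ?case
  proof (cases "l = r")
    case True
    then show ?thesis by (intro bexI[of _ l]) (auto simp: z)
  next
    case False
    then have l_r: "l < r" using lr by simp
    show ?thesis
    proof (cases "ones g l r \<le> zeros g l r")
      case maj: True
      show ?thesis
      proof (cases "g l")
        case gl: False
        obtain p where p: "p \<in> {Suc l..r}" "ones g (Suc l) p + zeros g p r \<le> 8 * dyadic_descents g k (Suc l) r"
          using less.hyps[of r "Suc l"] l_r lr by fastforce
        have "ones g l p = ones g (Suc l) p" using p(1) gl ones_split[of l "Suc l" p g] ones_Suc[of g l] by simp
        moreover have "dyadic_descents g k (Suc l) r \<le> dyadic_descents g k l r"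
          using dyadic_descents_split[of l "Suc l" r g k] l_r by simp
        ultimately show ?thesis using p by (intro bexI[of _ p]) auto
      next
        case gl: True
        \<comment> \<open>The first balanced prefix: it exists because the window starts with a one
          but has at least as many zeros as ones.\<close>
        define p where "p = (LEAST p. l < p \<and> ones g l p \<le> zeros g l p)"
        have p: "l < p" "ones g l p \<le> zeros g l p"
          unfolding p_def using LeastI[of "\<lambda>p. l < p \<and> ones g l p \<le> zeros g l p" r] l_r maj by auto
        have pr: "p \<le> r" unfolding p_def using l_r maj by (intro Least_le) auto
        have before: "zeros g l q < ones g l q" if "l < q" "q < p" for q
          using not_less_Least[of q "\<lambda>p. l < p \<and> ones g l p \<le> zeros g l p"] that unfolding p_def by auto
        have "p \<noteq> Suc l" using p(2) gl by (auto simp: ones_Suc zeros_Suc)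
        then obtain q where q: "p = Suc q" "l < q" using p(1) by (cases p) auto
        \<comment> \<open>One position earlier the ones were in the strict majority and the
          difference changes by one per position, so it is zero at \<open>p\<close>.\<close>
        have "zeros g l p \<le> ones g l p"
          using before[of q] q ones_split[of l q p g] zeros_split[of l q p g] zeros_Suc[of g q]
          by (auto split: if_splits)
        define m where "m = ones g l p"
        have eq: "ones g l p = m" "zeros g l p = m" using \<open>zeros g l p \<le> ones g l p\<close> p(2) unfolding m_def by auto
        have pm: "p = l + 2 * m" using ones_zeros[of l p g] eq p(1) by simp
        have m0: "0 < m" using pm p(1) by simp
        \<comment> \<open>The midpoint of the block precedes the first balance, so ones prevail in
          the left half; as the block has \<open>m\<close> ones and \<open>m\<close> zeros, zeros
          prevail in the right half.\<close>
        have h: "zeros g l (l + m) < ones g l (l + m)" using before[of "l + m"] m0 pm by simp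
        have "m \<le> 8 * dyadic_descents g k l (l + 2 * m)"
        proof (rule balanced_block_descents[OF m0])
          show "2 * m \<le> 2 ^ k" using pm pr lr(2) by simp
          show "m \<le> 2 * ones g l (l + m)" using h ones_zeros[of l "l + m" g] by simp
          show "m \<le> 2 * zeros g (l + m) (l + 2 * m)"
            using h ones_zeros[of l "l + m" g] zeros_split[of l "l + m" p g] eq pm by simp
        qed
        then have block: "m \<le> 8 * dyadic_descents g k l p" unfolding pm .
        obtain p' where p': "p' \<in> {p..r}" "ones g p p' + zeros g p' r \<le> 8 * dyadic_descents g k p r"
          using less.hyps[of r p] p(1) pr lr by fastforce
        have "ones g l p' = m + ones g p p'" using ones_split[of l p p' g] p(1) p'(1) eq by simp
        then have "ones g l p' + zeros g p' r \<le> 8 * dyadic_descents g k l r"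
          using block p'(2) dyadic_descents_split[of l p r g k] p(1) pr by simp
        then show ?thesis using p' p(1) by (intro bexI[of _ p']) auto
      qed
    next
      case maj: False
      obtain r' where r': "r = Suc r'" "l \<le> r'" using l_r by (cases r) auto
      show ?thesis
      proof (cases "g r'")
        case gr: True
        obtain p where p: "p \<in> {l..r'}" "ones g l p + zeros g p r' \<le> 8 * dyadic_descents g k l r'"
          using less.hyps[of r' l] r' lr by fastforce
        have "zeros g p r = zeros g p r'" using p(1) gr zeros_split[of p r' r g] zeros_Suc[of g r'] r' by simp
        moreover have "dyadic_descents g k l r' \<le> dyadic_descents g k l r"
          using dyadic_descents_split[of l r' r g k] r' by simp
        ultimately show ?thesis using p r' by (intro bexI[of _ p]) auto
      next
        case gr: False
        \<comment> \<open>The mirror image of the first case: the shortest balanced suffix of a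
          window that ends with a zero and has more ones than zeros.\<close>
        let ?P = "\<lambda>p. p < r \<and> zeros g p r \<le> ones g p r"
        define p where "p = (GREATEST p. ?P p)"
        have Pl: "?P l" using l_r maj by auto
        have p: "p < r" "zeros g p r \<le> ones g p r"
          unfolding p_def using GreatestI_nat[of ?P l r] Pl by auto
        have lp: "l \<le> p" unfolding p_def using Greatest_le_nat[of ?P l r] Pl by auto
        have after: "ones g q r < zeros g q r" if "p < q" "q < r" for q
          using Greatest_le_nat[of ?P q r] that unfolding p_def by fastforce
        have "p \<noteq> r'" using p(2) gr r' by (auto simp: ones_Suc zeros_Suc)
        then have q: "Suc p < r" using p(1) r' by simp
        have "ones g p r \<le> zeros g p r"
          using after[of "Suc p"] q ones_split[of p "Suc p" r g] zeros_split[of p "Suc p" r g] ones_Suc[of g p]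
          by (auto split: if_splits)
        define m where "m = ones g p r"
        have eq: "ones g p r = m" "zeros g p r = m" using \<open>ones g p r \<le> zeros g p r\<close> p(2) unfolding m_def by auto
        have rm: "r = p + 2 * m" using ones_zeros[of p r g] eq p(1) by simp
        have m0: "0 < m" using rm p(1) by simp
        have h: "ones g (p + m) r < zeros g (p + m) r" using after[of "p + m"] m0 rm by simp
        have "m \<le> 8 * dyadic_descents g k p (p + 2 * m)"
        proof (rule balanced_block_descents[OF m0])
          show "2 * m \<le> 2 ^ k" using rm lp lr(2) by simp
          show "m \<le> 2 * zeros g (p + m) (p + 2 * m)" using h ones_zeros[of "p + m" r g] rm by simp
          show "m \<le> 2 * ones g p (p + m)"
            using h ones_zeros[of "p + m" r g] ones_split[of p "p + m" r g] eq rm by simp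
        qed
        then have block: "m \<le> 8 * dyadic_descents g k p r" unfolding rm[symmetric] .
        obtain p' where p': "p' \<in> {l..p}" "ones g l p' + zeros g p' p \<le> 8 * dyadic_descents g k l p"
          using less.hyps[of p l] p(1) lp lr by fastforce
        have "zeros g p' r = zeros g p' p + m" using zeros_split[of p' p r g] p(1) p'(1) eq by simp
        then have "ones g l p' + zeros g p' r \<le> 8 * dyadic_descents g k l r"
          using block p'(2) dyadic_descents_split[of l p r g k] p(1) lp by simp
        then show ?thesis using p' p(1) by (intro bexI[of _ p']) auto
      qed
    qed
  qed
qed

text \<open>With threshold \<open>z\<close> there are as many zeros above as ones below. Every other
  threshold \<open>p\<close> misplaces all of the former (if it is lower) or all of the latter (if
  it is higher), so the cheap threshold found above pays for the moves of sorting.\<close>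

lemma sorting_moves_le_descents:
  fixes g :: "nat \<Rightarrow> bool"
  assumes n: "n \<le> 2 ^ k" and z: "z = card {t\<in>{1..n}. \<not> g t}"
  shows "card {t\<in>{1..n}. z < t \<and> \<not> g t} \<le> 8 * (\<Sum>a<k. card {t\<in>{1..n}. t + 2 ^ a \<le> n \<and> g t \<and> \<not> g (t + 2 ^ a)})"
proof -
  have "z \<le> card {1..n}" unfolding z by (intro card_mono) auto
  then have zn: "z \<le> n" by simp
  have z': "z = zeros g 1 (Suc n)" unfolding z zeros_def by (rule arg_cong[where f = card]) auto
  have moved: "card {t\<in>{1..n}. z < t \<and> \<not> g t} = zeros g (Suc z) (Suc n)"
    unfolding zeros_def by (rule arg_cong[where f = card]) auto
  have "zeros g 1 (Suc n) = zeros g 1 (Suc z) + zeros g (Suc z) (Suc n)"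
    using zn by (intro zeros_split) auto
  then have moved': "ones g 1 (Suc z) = zeros g (Suc z) (Suc n)"
    using ones_zeros[of 1 "Suc z" g] z' by simp
  obtain p where p: "p \<in> {1..Suc n}"
    "ones g 1 p + zeros g p (Suc n) \<le> 8 * dyadic_descents g k 1 (Suc n)"
    using threshold_le_dyadic_descents[of 1 "Suc n" k g] n by auto
  have "zeros g (Suc z) (Suc n) \<le> ones g 1 p + zeros g p (Suc n)"
  proof (cases "p \<le> Suc z")
    case True
    then show ?thesis using zeros_split[of p "Suc z" "Suc n" g] zn by simp
  next
    case False
    then show ?thesis using ones_split[of 1 "Suc z" p g] moved' by simp
  qed
  moreover have "dyadic_descents g k 1 (Suc n) = (\<Sum>a<k. card {t\<in>{1..n}. t + 2 ^ a \<le> n \<and> g t \<and> \<not> g (t + 2 ^ a)})"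
    unfolding dyadic_descents_def descents_def
    by (intro sum.cong refl arg_cong[where f = card]) auto
  ultimately show ?thesis using p(2) moved by linarith
qed

section \<open>Sorting the hypergrid\<close>

definition violations :: "nat \<Rightarrow> nat \<Rightarrow> (point \<Rightarrow> bool) \<Rightarrow> nat \<Rightarrow> nat \<Rightarrow> point set" where
  "violations n d f i a = {x\<in>hypergrid n d. x i + 2 ^ a \<le> n \<and> f x \<and> \<not> f (x(i := x i + 2 ^ a))}"

lemma finite_hypergrid [simp]: "finite (hypergrid n d)"
  unfolding hypergrid_def by (intro finite_PiE) auto

lemma card_hypergrid: "card (hypergrid n d) = n ^ d"
  unfolding hypergrid_def by (simp add: card_PiE)

lemma hypergrid_upd: "x \<in> hypergrid n d \<Longrightarrow> i \<in> {1..d} \<Longrightarrow> t \<in> {1..n} \<Longrightarrow> x(i := t) \<in> hypergrid n d"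
  unfolding hypergrid_def by (auto simp: PiE_iff extensional_def)

lemma hypergrid_coord: "x \<in> hypergrid n d \<Longrightarrow> i \<in> {1..d} \<Longrightarrow> x i \<in> {1..n}"
  unfolding hypergrid_def by (rule PiE_mem)

lemma finite_violations [simp]: "finite (violations n d f i a)"
  unfolding violations_def by simp

text \<open>The grid is fibred into lines in direction \<open>i\<close>, each represented by its
  point with \<open>i\<close>-th coordinate \<open>1\<close>.\<close>

lemma card_hypergrid_lines:
  assumes i: "i \<in> {1..d}" and n: "1 \<le> n"
  shows "card {x\<in>hypergrid n d. P x} = (\<Sum>r\<in>{r\<in>hypergrid n d. r i = 1}. card {t\<in>{1..n}. P (r(i := t))})"
proof -
  let ?B = "{r\<in>hypergrid n d. r i = 1}"
  have "bij_betw (\<lambda>(r, t). r(i := t)) (SIGMA r:?B. {t\<in>{1..n}. P (r(i := t))}) {x\<in>hypergrid n d. P x}"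
  proof (rule bij_betw_byWitness[where f' = "\<lambda>x. (x(i := 1), x i)"])
    show "\<forall>a\<in>SIGMA r:?B. {t\<in>{1..n}. P (r(i := t))}. (\<lambda>x. (x(i := 1), x i)) ((\<lambda>(r, t). r(i := t)) a) = a"
      by (auto simp: fun_eq_iff)
    show "(\<lambda>(r, t). r(i := t)) ` (SIGMA r:?B. {t\<in>{1..n}. P (r(i := t))}) \<subseteq> {x\<in>hypergrid n d. P x}"
      using i by (auto intro: hypergrid_upd)
    show "(\<lambda>x. (x(i := 1), x i)) ` {x\<in>hypergrid n d. P x} \<subseteq> (SIGMA r:?B. {t\<in>{1..n}. P (r(i := t))})"
      using hypergrid_upd[OF _ i, of _ n 1] hypergrid_coord[OF _ i, of _ n] n by auto
  qed auto
  from bij_betw_same_card[OF this] show ?thesis by simp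
qed

definition line_zeros :: "nat \<Rightarrow> nat \<Rightarrow> (point \<Rightarrow> bool) \<Rightarrow> point \<Rightarrow> nat" where
  "line_zeros n i g x = card {t\<in>{1..n}. \<not> g (x(i := t))}"

text \<open>The rearrangement of every line in direction \<open>i\<close> that puts the zeros first:
  they now occupy exactly the positions up to their number.\<close>

definition sort_coord :: "nat \<Rightarrow> nat \<Rightarrow> (point \<Rightarrow> bool) \<Rightarrow> point \<Rightarrow> bool" where
  "sort_coord n i g x \<longleftrightarrow> line_zeros n i g x < x i"

lemma line_zeros_upd [simp]: "line_zeros n i g (x(i := s)) = line_zeros n i g x"
  unfolding line_zeros_def by simp

lemma card_sort_coord_moved:
  assumes i: "i \<in> {1..d}" and n: "n = 2 ^ k"
  shows "card {x\<in>hypergrid n d. sort_coord n i g x \<and> \<not> g x} \<le> 8 * (\<Sum>a<k. card (violations n d g i a))"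
proof -
  let ?B = "{r\<in>hypergrid n d. r i = 1}"
  have n1: "1 \<le> n" using n by simp
  have "card {x\<in>hypergrid n d. sort_coord n i g x \<and> \<not> g x}
      = (\<Sum>r\<in>?B. card {t\<in>{1..n}. line_zeros n i g r < t \<and> \<not> g (r(i := t))})"
    unfolding card_hypergrid_lines[OF i n1] by (simp add: sort_coord_def)
  also have "\<dots> \<le> (\<Sum>r\<in>?B. 8 * (\<Sum>a<k. card {t\<in>{1..n}. t + 2 ^ a \<le> n \<and> g (r(i := t)) \<and> \<not> g (r(i := t + 2 ^ a))}))"
    by (intro sum_mono sorting_moves_le_descents) (auto simp: n line_zeros_def)
  also have "\<dots> = 8 * (\<Sum>a<k. \<Sum>r\<in>?B. card {t\<in>{1..n}. t + 2 ^ a \<le> n \<and> g (r(i := t)) \<and> \<not> g (r(i := t + 2 ^ a))})"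
    by (subst sum_distrib_left[symmetric], rule arg_cong[where f = "(*) 8"], rule sum.swap)
  also have "\<dots> = 8 * (\<Sum>a<k. card (violations n d g i a))"
    unfolding violations_def card_hypergrid_lines[OF i n1] by simp
  finally show ?thesis .
qed

text \<open>The edges of one length in direction \<open>j\<close> compare two parallel lines. After
  sorting, both are threshold functions, and the number of violations between them is the surplus of
  zeros on the upper line, which violated positions had to produce before.\<close>

lemma card_violations_sort_coord:
  assumes i: "i \<in> {1..d}" and j: "j \<in> {1..d}" "j \<noteq> i" and n: "1 \<le> n"
  shows "card (violations n d (sort_coord n i g) j a) \<le> card (violations n d g j a)"
  unfolding violations_def card_hypergrid_lines[OF i n]
proof (rule sum_mono)
  fix r assume r: "r \<in> {r\<in>hypergrid n d. r i = 1}"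
  let ?r' = "r(j := r j + 2 ^ a)"
  have tw: "(r(i := t))(j := (r(i := t)) j + 2 ^ a) = ?r'(i := t)" for t
    using j(2) by (auto simp: fun_eq_iff)
  have sj: "sort_coord n i g (y(i := t)) \<longleftrightarrow> line_zeros n i g y < t" for y t
    by (simp add: sort_coord_def)
  have le: "line_zeros n i g ?r' \<le> n"
    unfolding line_zeros_def using card_mono[of "{1..n}" "{t\<in>{1..n}. \<not> g (?r'(i := t))}"] by force
  have "card {t\<in>{1..n}. line_zeros n i g r < t \<and> \<not> line_zeros n i g ?r' < t}
      = card {line_zeros n i g r<..line_zeros n i g ?r'}"
    using le by (intro arg_cong[where f = card]) auto
  also have "\<dots> = line_zeros n i g ?r' - line_zeros n i g r" by simp
  also have "\<dots> \<le> card {t\<in>{1..n}. g (r(i := t)) \<and> \<not> g (?r'(i := t))}"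
  proof -
    have "line_zeros n i g ?r' \<le> card ({t\<in>{1..n}. \<not> g (r(i := t))} \<union> {t\<in>{1..n}. g (r(i := t)) \<and> \<not> g (?r'(i := t))})"
      unfolding line_zeros_def by (intro card_mono) auto
    also have "\<dots> \<le> line_zeros n i g r + card {t\<in>{1..n}. g (r(i := t)) \<and> \<not> g (?r'(i := t))}"
      unfolding line_zeros_def by (rule card_Un_le)
    finally show ?thesis by simp
  qed
  finally have main: "card {t\<in>{1..n}. line_zeros n i g r < t \<and> \<not> line_zeros n i g ?r' < t}
      \<le> card {t\<in>{1..n}. g (r(i := t)) \<and> \<not> g (?r'(i := t))}" .
  show "card {t\<in>{1..n}. (r(i := t)) j + 2 ^ a \<le> n \<and> sort_coord n i g (r(i := t)) \<and>
          \<not> sort_coord n i g ((r(i := t))(j := (r(i := t)) j + 2 ^ a))}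
      \<le> card {t\<in>{1..n}. (r(i := t)) j + 2 ^ a \<le> n \<and> g (r(i := t)) \<and>
          \<not> g ((r(i := t))(j := (r(i := t)) j + 2 ^ a))}"
    using main j(2) unfolding tw sj by (cases "r j + 2 ^ a \<le> n") simp_all
qed

section \<open>Monotonicity along single coordinates\<close>

definition mono_coord :: "nat \<Rightarrow> nat \<Rightarrow> nat \<Rightarrow> (point \<Rightarrow> bool) \<Rightarrow> bool" where
  "mono_coord n d i g \<longleftrightarrow> (\<forall>x\<in>hypergrid n d. \<forall>t\<in>{1..n}. x i \<le> t \<longrightarrow> g x \<longrightarrow> g (x(i := t)))"

lemma mono_coord_sort_coord_same: "mono_coord n d i (sort_coord n i g)"
  unfolding mono_coord_def sort_coord_def by simp

text \<open>If \<open>g\<close> increases from a line to a parallel one then the upper line has no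
  more zeros, hence a lower threshold. So later sortings do not spoil earlier ones.\<close>

lemma mono_coord_sort_coord:
  assumes i: "i \<in> {1..d}" and j: "j \<noteq> i" and mono: "mono_coord n d j g"
  shows "mono_coord n d j (sort_coord n i g)"
  unfolding mono_coord_def
proof (intro ballI impI)
  fix x t assume x: "x \<in> hypergrid n d" and t: "t \<in> {1..n}" "x j \<le> t" and s: "sort_coord n i g x"
  have "line_zeros n i g (x(j := t)) \<le> line_zeros n i g x"
    unfolding line_zeros_def
  proof (intro card_mono subsetI)
    fix s assume s: "s \<in> {s\<in>{1..n}. \<not> g ((x(j := t))(i := s))}"
    have tw: "(x(j := t))(i := s) = (x(i := s))(j := t)" using j by (simp add: fun_upd_twist)
    have "x(i := s) \<in> hypergrid n d" using hypergrid_upd[OF x i] s by simp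
    moreover have "(x(i := s)) j \<le> t" using j t(2) by simp
    ultimately have "g (x(i := s)) \<Longrightarrow> g ((x(i := s))(j := t))"
      using mono t(1) unfolding mono_coord_def by blast
    then show "s \<in> {s\<in>{1..n}. \<not> g (x(i := s))}" using s by (auto simp: tw)
  qed simp
  then show "sort_coord n i g (x(j := t))" using s j unfolding sort_coord_def by simp
qed

lemma grid_monotone_if_mono_coord:
  assumes "\<And>i. i \<in> {1..d} \<Longrightarrow> mono_coord n d i g"
  shows "grid_monotone n d g"
  unfolding grid_monotone_def
proof (rule monotone_onI)
  fix x y assume x: "x \<in> hypergrid n d" and y: "y \<in> hypergrid n d" and le: "coord_le d x y"
  define h where "h m = (\<lambda>i. if i \<le> m then y i else x i)" for m :: nat
  have ext: "x \<in> extensional {1..d}" "y \<in> extensional {1..d}"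
    using x y unfolding hypergrid_def PiE_def by simp_all
  have out: "x i = undefined" "y i = undefined" if "i \<notin> {1..d}" for i
    using extensional_arb[OF ext(1) that] extensional_arb[OF ext(2) that] by auto
  have h: "h m \<in> hypergrid n d" for m
  proof -
    have "h m i \<in> {1..n}" if "i \<in> {1..d}" for i
      using hypergrid_coord[OF x that] hypergrid_coord[OF y that] unfolding h_def by auto
    moreover have "h m \<in> extensional {1..d}" using out unfolding h_def extensional_def by simp
    ultimately show ?thesis unfolding hypergrid_def by (auto simp: PiE_iff)
  qed
  have "h 0 = x" using out[of 0] unfolding h_def by auto
  have "g x \<longrightarrow> g (h m)" if "m \<le> d" for m
    using that
  proof (induction m)
    case 0
    then show ?case using \<open>h 0 = x\<close> by simp
  next
    case (Suc m)
    have "h (Suc m) = (h m)(Suc m := y (Suc m))" unfolding h_def by (auto simp: fun_eq_iff le_Suc_eq)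
    moreover have "h m (Suc m) \<le> y (Suc m)" using le Suc.prems unfolding h_def coord_le_def by auto
    moreover have "y (Suc m) \<in> {1..n}" using hypergrid_coord[OF y] Suc.prems by simp
    moreover have "mono_coord n d (Suc m) g" using assms[of "Suc m"] Suc.prems by simp
    ultimately have "g (h m) \<Longrightarrow> g (h (Suc m))"
      using h[of m] unfolding mono_coord_def by metis
    then show ?case using Suc by simp
  qed
  moreover have "h d = y" using out unfolding h_def by (fastforce simp: fun_eq_iff)
  ultimately show "g x \<le> g y" by (metis le_boolI order_refl)
qed

section \<open>Bijections that record the moves of sorting\<close>

lemma line_sort_bij:
  fixes g :: "nat \<Rightarrow> bool"
  assumes z: "z = card {t\<in>{1..n}. \<not> g t}"
  shows "\<exists>\<sigma>. bij_betw \<sigma> {t\<in>{1..n}. z < t} {t\<in>{1..n}. g t} \<and>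
           (\<forall>t\<in>{1..n}. z < t \<longrightarrow> \<sigma> t \<le> t \<and> (g t \<longrightarrow> \<sigma> t = t))"
proof -
  let ?A = "{t\<in>{1..n}. z < t \<and> \<not> g t}" and ?B = "{t\<in>{1..n}. t \<le> z \<and> g t}" and ?C = "{t\<in>{1..n}. z < t \<and> g t}"
  have "z \<le> card {1..n}" unfolding z by (intro card_mono) auto
  then have zn: "z \<le> n" by simp
  have "card ?A + card ?C = card (?A \<union> ?C)" by (rule card_Un_disjoint[symmetric]) auto
  also have "?A \<union> ?C = {z<..n}" by auto
  finally have "card ?A + card ?C = n - z" by simp
  moreover have "card ?B + card ?C = card {t\<in>{1..n}. g t}"
    by (subst card_Un_disjoint[symmetric]) (auto intro!: arg_cong[where f = card])
  moreover have "card {t\<in>{1..n}. g t} + z = n"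
  proof -
    have "card {t\<in>{1..n}. g t} + z = card ({t\<in>{1..n}. g t} \<union> {t\<in>{1..n}. \<not> g t})"
      unfolding z by (rule card_Un_disjoint[symmetric]) auto
    also have "{t\<in>{1..n}. g t} \<union> {t\<in>{1..n}. \<not> g t} = {1..n}" by auto
    finally show ?thesis by simp
  qed
  ultimately have "card ?A = card ?B" using zn by simp
  then obtain \<beta> where \<beta>: "bij_betw \<beta> ?A ?B"
    using finite_same_card_bij[of ?A ?B] by auto
  let ?\<sigma> = "\<lambda>t. if g t then t else \<beta> t"
  have "bij_betw ?\<sigma> (?C \<union> ?A) (?C \<union> ?B)"
  proof (rule bij_betw_combine)
    have "bij_betw id ?C ?C" by simp
    then show "bij_betw ?\<sigma> ?C ?C" by (rule bij_betw_cong[THEN iffD1, rotated]) auto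
    show "bij_betw ?\<sigma> ?A ?B" by (rule bij_betw_cong[THEN iffD1, OF _ \<beta>]) auto
  qed auto
  moreover have "?C \<union> ?A = {t\<in>{1..n}. z < t}" "?C \<union> ?B = {t\<in>{1..n}. g t}" by auto
  moreover have "?\<sigma> t \<le> t" if "t \<in> {1..n}" "z < t" for t
  proof (cases "g t")
    case False
    then have "\<beta> t \<in> ?B" using bij_betw_apply[OF \<beta>, of t] that by simp
    then show ?thesis using False that(2) by simp
  qed simp
  ultimately show ?thesis by (intro exI[of _ ?\<sigma>]) auto
qed

text \<open>The bijections of the single lines are glued. The map goes from the sorted function back
  to \<open>g\<close> and fixes the points that had the value \<open>True\<close> before, so that
  only new ones are charged a move.\<close>

lemma sort_coord_bij:
  assumes i: "i \<in> {1..d}" and n: "1 \<le> n"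
  shows "\<exists>\<rho>. bij_betw \<rho> {y\<in>hypergrid n d. sort_coord n i g y} {x\<in>hypergrid n d. g x} \<and>
           (\<forall>y\<in>hypergrid n d. sort_coord n i g y \<longrightarrow>
              (\<exists>t\<le>y i. \<rho> y = y(i := t)) \<and> (g y \<longrightarrow> \<rho> y = y))"
proof -
  have "\<forall>r. \<exists>\<sigma>. bij_betw \<sigma> {t\<in>{1..n}. line_zeros n i g r < t} {t\<in>{1..n}. g (r(i := t))} \<and>
           (\<forall>t\<in>{1..n}. line_zeros n i g r < t \<longrightarrow> \<sigma> t \<le> t \<and> (g (r(i := t)) \<longrightarrow> \<sigma> t = t))"
    by (intro allI line_sort_bij) (simp add: line_zeros_def)
  from choice[OF this] obtain \<sigma> where \<sigma>0: "\<forall>r. bij_betw (\<sigma> r) {t\<in>{1..n}. line_zeros n i g r < t} {t\<in>{1..n}. g (r(i := t))} \<and>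
           (\<forall>t\<in>{1..n}. line_zeros n i g r < t \<longrightarrow> \<sigma> r t \<le> t \<and> (g (r(i := t)) \<longrightarrow> \<sigma> r t = t))" ..
  then have \<sigma>: "\<And>r. bij_betw (\<sigma> r) {t\<in>{1..n}. line_zeros n i g r < t} {t\<in>{1..n}. g (r(i := t))}"
    "\<And>r t. t \<in> {1..n} \<Longrightarrow> line_zeros n i g r < t \<Longrightarrow> \<sigma> r t \<le> t"
    "\<And>r t. t \<in> {1..n} \<Longrightarrow> line_zeros n i g r < t \<Longrightarrow> g (r(i := t)) \<Longrightarrow> \<sigma> r t = t"
    by (simp_all del: atLeastAtMost_iff)
  define \<rho> where "\<rho> y = y(i := \<sigma> (y(i := 1)) (y i))" for y
  let ?S = "{y\<in>hypergrid n d. sort_coord n i g y}"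
  have \<rho>1: "\<sigma> (y(i := 1)) (y i) \<in> {t\<in>{1..n}. g (y(i := t))}" if "y \<in> ?S" for y
    using bij_betwE[OF \<sigma>(1)[of "y(i := 1)"]] hypergrid_coord[OF _ i, of y n] that
    by (auto simp: sort_coord_def)
  have "bij_betw \<rho> ?S {x\<in>hypergrid n d. g x}"
  proof (rule bij_betwI')
    fix x y assume xy: "x \<in> ?S" "y \<in> ?S"
    show "\<rho> x = \<rho> y \<longleftrightarrow> x = y"
    proof
      assume eq: "\<rho> x = \<rho> y"
      then have "(\<rho> x)(i := 1) = (\<rho> y)(i := 1)" by simp
      then have r: "x(i := 1) = y(i := 1)" unfolding \<rho>_def by simp
      have "\<rho> x i = \<rho> y i" using eq by simp
      then have "\<sigma> (x(i := 1)) (x i) = \<sigma> (x(i := 1)) (y i)" unfolding \<rho>_def r by simp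
      moreover have "x i \<in> {t\<in>{1..n}. line_zeros n i g (x(i := 1)) < t}"
        using xy(1) hypergrid_coord[OF _ i, of x n] by (auto simp: sort_coord_def)
      moreover have "y i \<in> {t\<in>{1..n}. line_zeros n i g (x(i := 1)) < t}"
        unfolding r using xy(2) hypergrid_coord[OF _ i, of y n] by (auto simp: sort_coord_def)
      ultimately have "x i = y i" using bij_betw_imp_inj_on[OF \<sigma>(1)] by (metis inj_onD)
      then show "x = y" using r by (metis fun_upd_triv fun_upd_upd)
    qed simp
  next
    fix y assume "y \<in> ?S"
    then show "\<rho> y \<in> {x\<in>hypergrid n d. g x}"
      using \<rho>1[of y] hypergrid_upd[OF _ i, of y n] unfolding \<rho>_def by auto
  next
    fix x assume x: "x \<in> {x\<in>hypergrid n d. g x}"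
    let ?r = "x(i := 1)"
    have "x i \<in> {t\<in>{1..n}. g (?r(i := t))}" using x hypergrid_coord[OF _ i, of x n] by simp
    then obtain t where t: "t \<in> {t\<in>{1..n}. line_zeros n i g ?r < t}" "x i = \<sigma> ?r t"
      using bij_betw_imp_surj_on[OF \<sigma>(1)[of ?r]] by blast
    have "x(i := t) \<in> ?S" using t(1) x hypergrid_upd[OF _ i, of x n t] by (simp add: sort_coord_def)
    moreover have "x = \<rho> (x(i := t))" by (simp only: \<rho>_def fun_upd_upd fun_upd_same t(2)[symmetric] fun_upd_triv)
    ultimately show "\<exists>y\<in>?S. x = \<rho> y" by blast
  qed
  moreover have "(\<exists>t\<le>y i. \<rho> y = y(i := t)) \<and> (g y \<longrightarrow> \<rho> y = y)" if "y \<in> hypergrid n d" "sort_coord n i g y" for y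
  proof -
    have y: "y i \<in> {1..n}" "line_zeros n i g (y(i := 1)) < y i"
      using that hypergrid_coord[OF _ i, of y n] by (auto simp: sort_coord_def)
    show ?thesis
      using \<sigma>(2)[OF y] \<sigma>(3)[OF y] unfolding \<rho>_def by (auto intro: exI[of _ "\<sigma> (y(i := 1)) (y i)"])
  qed
  ultimately show ?thesis by blast
qed

primrec sort_upto :: "nat \<Rightarrow> (point \<Rightarrow> bool) \<Rightarrow> nat \<Rightarrow> point \<Rightarrow> bool" where
  "sort_upto n g 0 = g"
| "sort_upto n g (Suc m) = sort_coord n (Suc m) (sort_upto n g m)"

lemma mono_coord_sort_upto: "m \<le> d \<Longrightarrow> i \<in> {1..m} \<Longrightarrow> mono_coord n d i (sort_upto n g m)"
proof (induction m)
  case (Suc m)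
  show ?case
  proof (cases "i = Suc m")
    case True
    then show ?thesis by (simp add: mono_coord_sort_coord_same)
  next
    case False
    then show ?thesis using Suc by (auto intro!: mono_coord_sort_coord)
  qed
qed simp

lemma card_violations_sort_upto:
  "j \<in> {m<..d} \<Longrightarrow> 1 \<le> n \<Longrightarrow> card (violations n d (sort_upto n g m) j a) \<le> card (violations n d g j a)"
proof (induction m)
  case (Suc m)
  then have "card (violations n d (sort_upto n g (Suc m)) j a) \<le> card (violations n d (sort_upto n g m) j a)"
    by (auto intro!: card_violations_sort_coord)
  also have "\<dots> \<le> card (violations n d g j a)" using Suc by auto
  finally show ?case .
qed simp

definition hamming :: "nat \<Rightarrow> point \<Rightarrow> point \<Rightarrow> nat" where
  "hamming d x y = card {i\<in>{1..d}. x i \<noteq> y i}"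

lemma hamming_triangle: "hamming d x z \<le> hamming d x y + hamming d y z"
proof -
  have "hamming d x z \<le> card ({i\<in>{1..d}. x i \<noteq> y i} \<union> {i\<in>{1..d}. y i \<noteq> z i})"
    unfolding hamming_def by (intro card_mono) auto
  also have "\<dots> \<le> hamming d x y + hamming d y z" unfolding hamming_def by (rule card_Un_le)
  finally show ?thesis .
qed

lemma hamming_upd: "hamming d (y(i := t)) y \<le> 1"
proof -
  have "hamming d (y(i := t)) y \<le> card {i}" unfolding hamming_def by (intro card_mono) auto
  then show ?thesis by simp
qed

text \<open>
  Sorting moves each value \<open>True\<close> upwards along a line, by one coordinate at a time. The point \<open>\<pi> y\<close>
  is where the value \<open>True\<close> found at \<open>y\<close> after sorting came from.
\<close>

lemma sort_upto_bij:
  assumes n: "n = 2 ^ k" and "m \<le> d"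
  shows "\<exists>\<pi>. bij_betw \<pi> {y\<in>hypergrid n d. sort_upto n g m y} {x\<in>hypergrid n d. g x} \<and>
           (\<forall>y\<in>hypergrid n d. sort_upto n g m y \<longrightarrow> coord_le d (\<pi> y) y) \<and>
           (\<Sum>y\<in>{y\<in>hypergrid n d. sort_upto n g m y}. hamming d (\<pi> y) y)
             \<le> 8 * (\<Sum>i\<in>{1..m}. \<Sum>a<k. card (violations n d g i a))"
  using assms(2)
proof (induction m)
  case 0
  show ?case by (intro exI[of _ "\<lambda>x. x"]) (auto simp: coord_le_def hamming_def bij_betw_def)
next
  case (Suc m)
  have n1: "1 \<le> n" using n by simp
  have i: "Suc m \<in> {1..d}" using Suc.prems by simp
  let ?h = "sort_upto n g m"
  let ?S = "{y\<in>hypergrid n d. ?h y}" and ?S' = "{y\<in>hypergrid n d. sort_coord n (Suc m) ?h y}"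
  obtain \<pi> where \<pi>: "bij_betw \<pi> ?S {x\<in>hypergrid n d. g x}"
    "\<And>y. y \<in> hypergrid n d \<Longrightarrow> ?h y \<Longrightarrow> coord_le d (\<pi> y) y"
    "(\<Sum>y\<in>?S. hamming d (\<pi> y) y) \<le> 8 * (\<Sum>i\<in>{1..m}. \<Sum>a<k. card (violations n d g i a))"
    using Suc.IH Suc.prems by auto
  obtain \<rho> where \<rho>: "bij_betw \<rho> ?S' ?S"
    "\<And>y. y \<in> hypergrid n d \<Longrightarrow> sort_coord n (Suc m) ?h y \<Longrightarrow> \<exists>t\<le>y (Suc m). \<rho> y = y(Suc m := t)"
    "\<And>y. y \<in> hypergrid n d \<Longrightarrow> sort_coord n (Suc m) ?h y \<Longrightarrow> ?h y \<Longrightarrow> \<rho> y = y"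
    using sort_coord_bij[OF i n1, of ?h] by blast
  have bij: "bij_betw (\<pi> \<circ> \<rho>) ?S' {x\<in>hypergrid n d. g x}" using \<rho>(1) \<pi>(1) by (rule bij_betw_trans)
  have le: "coord_le d ((\<pi> \<circ> \<rho>) y) y" if "y \<in> ?S'" for y
  proof -
    have "\<rho> y \<in> ?S" using \<rho>(1) that by (rule bij_betw_apply)
    then have "coord_le d (\<pi> (\<rho> y)) (\<rho> y)" using \<pi>(2) by simp
    moreover have "coord_le d (\<rho> y) y" using \<rho>(2)[of y] that unfolding coord_le_def by auto
    ultimately show ?thesis unfolding coord_le_def by (auto intro: order_trans)
  qed
  have "(\<Sum>y\<in>?S'. hamming d ((\<pi> \<circ> \<rho>) y) y) \<le> (\<Sum>y\<in>?S'. hamming d (\<pi> (\<rho> y)) (\<rho> y) + hamming d (\<rho> y) y)"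
    by (intro sum_mono) (simp add: hamming_triangle)
  also have "\<dots> = (\<Sum>y\<in>?S'. hamming d (\<pi> (\<rho> y)) (\<rho> y)) + (\<Sum>y\<in>?S'. hamming d (\<rho> y) y)"
    by (rule sum.distrib)
  also have "(\<Sum>y\<in>?S'. hamming d (\<pi> (\<rho> y)) (\<rho> y)) = (\<Sum>y\<in>?S. hamming d (\<pi> y) y)"
    by (rule sum.reindex_bij_betw[OF \<rho>(1)])
  \<comment> \<open>Points that keep their value \<open>True\<close> are fixed by
    \<open>\<rho>\<close>; all others change in the single coordinate \<open>Suc m\<close>.\<close>
  also have "(\<Sum>y\<in>?S'. hamming d (\<rho> y) y) \<le> (\<Sum>y\<in>?S'. of_bool (\<not> ?h y))"
  proof (rule sum_mono)
    fix y assume y: "y \<in> ?S'"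
    show "hamming d (\<rho> y) y \<le> of_bool (\<not> ?h y)"
    proof (cases "?h y")
      case True
      then have "\<rho> y = y" using \<rho>(3) y by simp
      then show ?thesis unfolding hamming_def by simp
    next
      case False
      then show ?thesis using \<rho>(2)[of y] y hamming_upd by auto
    qed
  qed
  also have "(\<Sum>y\<in>?S'. of_bool (\<not> ?h y)) = card {x\<in>hypergrid n d. sort_coord n (Suc m) ?h x \<and> \<not> ?h x}"
    by (simp add: Int_def conj_ac)
  also have "\<dots> \<le> 8 * (\<Sum>a<k. card (violations n d ?h (Suc m) a))"
    by (rule card_sort_coord_moved[OF i n])
  \<comment> \<open>The moves are paid for by violations of the partially sorted function in a
    direction not yet sorted, and there are no more of these than in \<open>g\<close>.\<close>
  also have "\<dots> \<le> 8 * (\<Sum>a<k. card (violations n d g (Suc m) a))"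
    using i n1 by (intro mult_le_mono2 sum_mono card_violations_sort_upto) auto
  finally have sum: "(\<Sum>y\<in>?S'. hamming d ((\<pi> \<circ> \<rho>) y) y)
      \<le> 8 * (\<Sum>i\<in>{1..Suc m}. \<Sum>a<k. card (violations n d g i a))"
    using \<pi>(3) by (simp add: algebra_simps)
  show ?case using bij le sum by (intro exI[of _ "\<pi> \<circ> \<rho>"]) (simp add: o_def)
qed

definition total_violations :: "nat \<Rightarrow> nat \<Rightarrow> nat \<Rightarrow> (point \<Rightarrow> bool) \<Rightarrow> nat" where
  "total_violations n d k f = (\<Sum>i\<in>{1..d}. \<Sum>a<k. card (violations n d f i a))"

text \<open>Sorting preserves the number of ones, so as many points gain the value
  \<open>True\<close> as lose it. The gaining points form \<open>M\<close>, at least half of the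
  distance to the sorted function, and each is matched to the place that its value came
  from.\<close>

lemma far_from_monotone_matching:
  assumes n: "n = 2 ^ k" and far: "far_from_monotone n d \<epsilon> f"
  shows "\<exists>M \<pi>. M \<subseteq> hypergrid n d \<and> inj_on \<pi> M \<and>
           (\<forall>y\<in>M. \<pi> y \<in> hypergrid n d \<and> f (\<pi> y) \<and> \<not> f y \<and> coord_le d (\<pi> y) y) \<and>
           \<epsilon> * real (n ^ d) \<le> 2 * real (card M) \<and>
           (\<Sum>y\<in>M. hamming d (\<pi> y) y) \<le> 8 * total_violations n d k f"
proof -
  let ?g = "sort_upto n f d"
  obtain \<pi> where \<pi>: "bij_betw \<pi> {y\<in>hypergrid n d. ?g y} {x\<in>hypergrid n d. f x}"
    "\<And>y. y \<in> hypergrid n d \<Longrightarrow> ?g y \<Longrightarrow> coord_le d (\<pi> y) y"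
    "(\<Sum>y\<in>{y\<in>hypergrid n d. ?g y}. hamming d (\<pi> y) y) \<le> 8 * total_violations n d k f"
    using sort_upto_bij[OF n order_refl, of d f] unfolding total_violations_def by blast
  let ?M = "{y\<in>hypergrid n d. ?g y \<and> \<not> f y}" and ?M' = "{y\<in>hypergrid n d. f y \<and> \<not> ?g y}"
    and ?C = "{y\<in>hypergrid n d. f y \<and> ?g y}"
  have "grid_monotone n d ?g" by (intro grid_monotone_if_mono_coord mono_coord_sort_upto) auto
  then have "\<epsilon> * real (n ^ d) \<le> real (card {x\<in>hypergrid n d. f x \<noteq> ?g x})"
    using far unfolding far_from_monotone_def by (simp add: card_hypergrid)
  also have "card {x\<in>hypergrid n d. f x \<noteq> ?g x} = card ?M + card ?M'"
    by (subst card_Un_disjoint[symmetric]) (auto intro!: arg_cong[where f = card])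
  also have "card ?M' = card ?M"
  proof -
    have "card ?M + card ?C = card {y\<in>hypergrid n d. ?g y}"
      by (subst card_Un_disjoint[symmetric]) (auto intro!: arg_cong[where f = card])
    moreover have "card ?M' + card ?C = card {y\<in>hypergrid n d. f y}"
      by (subst card_Un_disjoint[symmetric]) (auto intro!: arg_cong[where f = card])
    ultimately show ?thesis using bij_betw_same_card[OF \<pi>(1)] by simp
  qed
  finally have "\<epsilon> * real (n ^ d) \<le> 2 * real (card ?M)" by simp
  moreover have "inj_on \<pi> ?M" using bij_betw_imp_inj_on[OF \<pi>(1)] by (rule inj_on_subset) auto
  moreover have "\<forall>y\<in>?M. \<pi> y \<in> hypergrid n d \<and> f (\<pi> y) \<and> \<not> f y \<and> coord_le d (\<pi> y) y"
    using bij_betwE[OF \<pi>(1)] \<pi>(2) by auto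
  moreover have "(\<Sum>y\<in>?M. hamming d (\<pi> y) y) \<le> 8 * total_violations n d k f"
    by (rule order_trans[OF sum_mono2 \<pi>(3)]) auto
  ultimately show ?thesis by (intro exI[of _ ?M] exI[of _ \<pi>]) blast
qed

section \<open>The isoperimetric inequality\<close>

text \<open>The linkages live in an abelian group, so grid points are embedded into integer vectors
  that vanish outside \<open>{1..d}\<close>, with \<open>vec_point\<close> as the inverse on the
  grid.\<close>

definition point_vec :: "nat \<Rightarrow> point \<Rightarrow> nat \<Rightarrow> int" where
  "point_vec d x = (\<lambda>i. if i \<in> {1..d} then int (x i) else 0)"

definition vec_point :: "nat \<Rightarrow> (nat \<Rightarrow> int) \<Rightarrow> point" where
  "vec_point d v = (\<lambda>i. if i \<in> {1..d} then nat (v i) else undefined)"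

definition axis :: "nat \<Rightarrow> int \<Rightarrow> nat \<Rightarrow> int" where
  "axis i c = (\<lambda>j. if j = i then c else 0)"

text \<open>The augmented edges as translations, together with the waiting step
  \<open>0\<close>.\<close>

definition dyadic_steps :: "nat \<Rightarrow> nat \<Rightarrow> (nat \<Rightarrow> int) set" where
  "dyadic_steps d k = insert 0 ((\<lambda>(i, a). axis i (2 ^ a)) ` ({1..d} \<times> {..<k}))"

lemma finite_dyadic_steps: "finite (dyadic_steps d k)"
  unfolding dyadic_steps_def by simp

lemma zero_in_dyadic_steps: "0 \<in> dyadic_steps d k"
  unfolding dyadic_steps_def by simp

lemma vec_point_point_vec: "x \<in> hypergrid n d \<Longrightarrow> vec_point d (point_vec d x) = x"
  unfolding vec_point_def point_vec_def hypergrid_def PiE_def extensional_def by (auto simp: fun_eq_iff)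

text \<open>The binary expansion of \<open>v\<close>, one step per digit, where the digit
  \<open>0\<close> becomes a waiting step.\<close>

lemma axis_in_sumset_pow:
  "i \<in> {1..d} \<Longrightarrow> j \<le> k \<Longrightarrow> v < 2 ^ j \<Longrightarrow> axis i (int v) \<in> sumset_pow (dyadic_steps d k) j"
proof (induction j arbitrary: v)
  case 0
  then show ?case by (auto simp: axis_def fun_eq_iff)
next
  case (Suc j)
  show ?case
  proof (cases "v < 2 ^ j")
    case True
    then have "axis i (int v) \<in> sumset_pow (dyadic_steps d k) j" using Suc by simp
    then show ?thesis by (rule sumset_pow_mono[OF zero_in_dyadic_steps, rotated]) simp
  next
    case False
    then obtain w where w: "v = 2 ^ j + w" by (metis le_Suc_ex not_less)
    then have "axis i (int w) \<in> sumset_pow (dyadic_steps d k) j" using Suc by simp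
    moreover have "axis i (2 ^ j) \<in> dyadic_steps d k"
      using Suc.prems unfolding dyadic_steps_def by (auto intro!: image_eqI[where x = "(i, j)"])
    moreover have "axis i (int v) = axis i (2 ^ j) + axis i (int w)"
      unfolding w by (auto simp: axis_def fun_eq_iff)
    ultimately show ?thesis by (auto intro!: image_eqI[where x = "(axis i (2 ^ j), axis i (int w))"])
  qed
qed

lemma point_vec_diff_in_sumset_pow:
  assumes x: "x \<in> hypergrid n d" and y: "y \<in> hypergrid n d" and le: "coord_le d x y" and n: "n \<le> 2 ^ k"
  shows "point_vec d y - point_vec d x \<in> sumset_pow (dyadic_steps d k) (hamming d x y * k)"
proof -
  define v where "v I = (\<lambda>j. if j \<in> I then int (y j - x j) else 0)" for I
  have "v I \<in> sumset_pow (dyadic_steps d k) (card I * k)" if "finite I" "I \<subseteq> {1..d}" for I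
    using that
  proof (induction I rule: finite_induct)
    case empty
    then show ?case by (auto simp: v_def fun_eq_iff)
  next
    case (insert i I)
    have i: "i \<in> {1..d}" using insert.prems by simp
    have "y i \<le> n" "1 \<le> y i" "1 \<le> x i" using hypergrid_coord[OF x i] hypergrid_coord[OF y i] by auto
    then have "y i - x i < 2 ^ k" using n by linarith
    then have "axis i (int (y i - x i)) \<in> sumset_pow (dyadic_steps d k) k"
      using i by (intro axis_in_sumset_pow) auto
    moreover have "v I \<in> sumset_pow (dyadic_steps d k) (card I * k)" using insert by simp
    moreover have "v (insert i I) = axis i (int (y i - x i)) + v I"
      using insert.hyps by (auto simp: v_def axis_def fun_eq_iff)
    ultimately have "v (insert i I) \<in> sumset_pow (dyadic_steps d k) (k + card I * k)"
      unfolding sumset_pow_add_iff by blast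
    then show ?case using insert.hyps by simp
  qed
  moreover have "point_vec d y - point_vec d x = v {i\<in>{1..d}. x i \<noteq> y i}"
    using le by (auto simp: v_def point_vec_def coord_le_def fun_eq_iff)
  moreover have "finite {i\<in>{1..d}. x i \<noteq> y i}" "{i\<in>{1..d}. x i \<noteq> y i} \<subseteq> {1..d}" by auto
  ultimately show ?thesis unfolding hamming_def by metis
qed

definition upper_endpoint :: "point \<times> nat \<times> nat \<Rightarrow> point" where
  "upper_endpoint = (\<lambda>(x, i, a). x(i := x i + 2 ^ a))"

definition violating_edges :: "nat \<Rightarrow> nat \<Rightarrow> nat \<Rightarrow> (point \<Rightarrow> bool) \<Rightarrow> (point \<times> nat \<times> nat) set" where
  "violating_edges n d k f = {(x, i, a). i \<in> {1..d} \<and> a < k \<and> x \<in> violations n d f i a}"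

lemma pigeonhole_fibre:
  assumes "finite S" and T: "\<And>s. s \<in> S \<Longrightarrow> T s < (m::nat)" and "0 < m"
  shows "\<exists>t<m. card S \<le> m * card {s\<in>S. T s = t}"
proof (rule ccontr)
  assume "\<not> ?thesis"
  then have lt: "m * card {s\<in>S. T s = t} < card S" if "t < m" for t using that by fastforce
  have "S = (\<Union>t\<in>{..<m}. {s\<in>S. T s = t})" using T by auto
  then have "card S \<le> (\<Sum>t<m. card {s\<in>S. T s = t})"
    by (metis card_UN_le finite_lessThan)
  then have "m * card S \<le> (\<Sum>t<m. m * card {s\<in>S. T s = t})"
    by (simp add: sum_distrib_left[symmetric])
  also have "\<dots> < (\<Sum>t<m. card S)" using lt \<open>0 < m\<close> by (intro sum_strict_mono) auto
  finally show False by simp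
qed

lemma ex_switch:
  fixes Q :: "nat \<Rightarrow> bool"
  shows "Q 0 \<Longrightarrow> \<not> Q m \<Longrightarrow> \<exists>t<m. Q t \<and> \<not> Q (Suc t)"
  by (induction m) (auto simp: less_Suc_eq)

text \<open>Every path of the linkage leads from a point with \<open>f\<close> true to one with
  \<open>f\<close> false, so it uses a violated edge at some time. A most frequent such time is
  fixed, at a loss of \<open>2 ^ q\<close>; paths at the same time are at distinct points, hence the
  edges used then have distinct lower ends and distinct upper ends.\<close>

lemma violating_edges_of_matching:
  assumes n: "n = 2 ^ k" and M: "M \<subseteq> hypergrid n d" and inj: "inj_on \<pi> M"
    and \<pi>: "\<And>y. y \<in> M \<Longrightarrow> \<pi> y \<in> hypergrid n d \<and> f (\<pi> y) \<and> \<not> f y \<and> coord_le d (\<pi> y) y"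
    and near: "\<And>y. y \<in> M \<Longrightarrow> hamming d (\<pi> y) y * k \<le> 2 ^ q"
  shows "\<exists>E \<subseteq> violating_edges n d k f. inj_on fst E \<and> inj_on upper_endpoint E \<and> card M \<le> 2 ^ q * card E"
proof -
  let ?D = "dyadic_steps d k"
  define S where "S = (\<lambda>y. point_vec d (\<pi> y)) ` M"
  define \<phi> where "\<phi> s = point_vec d (inv_into M \<pi> (vec_point d s))" for s
  have finM: "finite M" using M finite_hypergrid by (rule finite_subset)
  have \<phi>: "\<phi> (point_vec d (\<pi> y)) = point_vec d y" if "y \<in> M" for y
    using \<pi>[OF that] vec_point_point_vec[of "\<pi> y" n d] inj that unfolding \<phi>_def by simp
  have inj_pv: "inj_on (point_vec d) (hypergrid n d)" by (metis inj_on_inverseI vec_point_point_vec)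
  have "inj_on (\<lambda>y. point_vec d (\<pi> y)) M"
    using inj inj_pv \<pi> by (auto simp: inj_on_def)
  then have cardS: "card S = card M" unfolding S_def by (rule card_image)
  have finS: "finite S" unfolding S_def using finM by simp
  have inj\<phi>: "inj_on \<phi> S"
    using inj_pv M unfolding S_def by (auto simp: inj_on_def \<phi>)
  have "\<phi> s - s \<in> sumset_pow ?D (2 ^ q)" if s: "s \<in> S" for s
  proof -
    obtain y where y: "y \<in> M" "s = point_vec d (\<pi> y)" using s unfolding S_def by blast
    have "point_vec d y - point_vec d (\<pi> y) \<in> sumset_pow ?D (hamming d (\<pi> y) y * k)"
      using \<pi>[OF y(1)] M y(1) n by (intro point_vec_diff_in_sumset_pow[of _ n]) auto
    then show ?thesis using near[OF y(1)] \<phi>[OF y(1)] sumset_pow_mono[OF zero_in_dyadic_steps] unfolding y(2)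
      by metis
  qed
  from linkage_pow2[OF finS finite_dyadic_steps inj\<phi> this] obtain P where
    P: "\<forall>t\<le>2 ^ q. inj_on (P t) S" "\<forall>s\<in>S. P 0 s = s" "P (2 ^ q) ` S = \<phi> ` S"
      "\<forall>s\<in>S. \<forall>t<2 ^ q. P (Suc t) s - P t s \<in> ?D" by metis
  have nonneg: "0 \<le> e j" if "e \<in> ?D" for e j
    using that unfolding dyadic_steps_def axis_def by auto
  have step: "P t s j \<le> P (Suc t) s j" if "s \<in> S" "t < 2 ^ q" for s t j
  proof -
    have "0 \<le> (P (Suc t) s - P t s) j" using P(4) that nonneg by blast
    then show ?thesis by simp
  qed
  have low: "s j \<le> P t s j" if "s \<in> S" "t \<le> 2 ^ q" for s t j
    using that(2)
  proof (induction t)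
    case 0
    then show ?case using P(2) that(1) by simp
  next
    case (Suc t)
    then show ?case using step[OF that(1), of t j] by simp
  qed
  have high: "P t s j \<le> P (2 ^ q) s j" if "s \<in> S" "t \<le> 2 ^ q" for s t j
    using that(2)
  proof (induction t rule: inc_induct)
    case (step t)
    then show ?case using \<open>\<And>t s j. s \<in> S \<Longrightarrow> t < 2 ^ q \<Longrightarrow> P t s j \<le> P (Suc t) s j\<close>[of s t j] that(1) by simp
  qed simp
  have range: "point_vec d x j \<le> P t s j \<and> P t s j \<le> point_vec d y j"
    if "s \<in> S" "t \<le> 2 ^ q" "s = point_vec d x" "P (2 ^ q) s = point_vec d y" for s t j x y
    using low[OF that(1,2), of j] high[OF that(1,2), of j] that(3,4) by simp
  \<comment> \<open>A path may end at the partner of another start, but every end is an element of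
    \<open>M\<close>, where \<open>f\<close> is false.\<close>
  have ends: "\<exists>x y. s = point_vec d x \<and> x \<in> hypergrid n d \<and> f x \<and> P (2 ^ q) s = point_vec d y \<and> y \<in> hypergrid n d \<and> \<not> f y"
    if "s \<in> S" for s
  proof -
    obtain z where z: "z \<in> M" "s = point_vec d (\<pi> z)" using \<open>s \<in> S\<close> unfolding S_def by blast
    have "P (2 ^ q) s \<in> \<phi> ` S" using P(3) that by blast
    then obtain y where "y \<in> M" "P (2 ^ q) s = point_vec d y" unfolding S_def using \<phi> by auto
    then show ?thesis using z \<pi> M by blast
  qed
  \<comment> \<open>Coordinates never decrease along a path, so it stays in the box spanned by its
    two ends and therefore in the grid.\<close>
  have inside: "vec_point d (P t s) \<in> hypergrid n d \<and> point_vec d (vec_point d (P t s)) = P t s"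
    if s: "s \<in> S" and t: "t \<le> 2 ^ q" for s t
  proof -
    obtain x y where xy: "s = point_vec d x" "x \<in> hypergrid n d" "P (2 ^ q) s = point_vec d y" "y \<in> hypergrid n d"
      using ends[OF s] by blast
    have b: "point_vec d x j \<le> P t s j" "P t s j \<le> point_vec d y j" for j using range[OF s t xy(1,3)] by auto
    have pos: "1 \<le> P t s j \<and> P t s j \<le> int n" if j: "j \<in> {1..d}" for j
      using b[of j] hypergrid_coord[OF xy(2) j] hypergrid_coord[OF xy(4) j] j unfolding point_vec_def by auto
    have out: "P t s j = 0" if j: "j \<notin> {1..d}" for j
      using b[of j] that unfolding point_vec_def by auto
    have "vec_point d (P t s) j \<in> {1..n}" if j: "j \<in> {1..d}" for j
      using pos[OF j] j unfolding vec_point_def by auto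
    then have "vec_point d (P t s) \<in> hypergrid n d"
      unfolding hypergrid_def by (auto simp: PiE_iff extensional_def vec_point_def)
    moreover have "point_vec d (vec_point d (P t s)) = P t s"
    proof
      fix j
      show "point_vec d (vec_point d (P t s)) j = P t s j"
      proof (cases "j \<in> {1..d}")
        case True
        then show ?thesis using pos[OF True] unfolding point_vec_def vec_point_def by simp
      next
        case False
        then show ?thesis using out[OF False] unfolding point_vec_def by auto
      qed
    qed
    ultimately show ?thesis by blast
  qed
  have "\<exists>t<2 ^ q. f (vec_point d (P t s)) \<and> \<not> f (vec_point d (P (Suc t) s))" if s: "s \<in> S" for s
  proof (rule ex_switch)
    obtain x y where xy: "s = point_vec d x" "x \<in> hypergrid n d" "f x" "P (2 ^ q) s = point_vec d y" "y \<in> hypergrid n d" "\<not> f y"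
      using ends[OF s] by blast
    show "f (vec_point d (P 0 s))" using P(2) s xy vec_point_point_vec by metis
    show "\<not> f (vec_point d (P (2 ^ q) s))" using xy vec_point_point_vec by metis
  qed
  then obtain T where T: "\<And>s. s \<in> S \<Longrightarrow> T s < 2 ^ q"
    "\<And>s. s \<in> S \<Longrightarrow> f (vec_point d (P (T s) s))" "\<And>s. s \<in> S \<Longrightarrow> \<not> f (vec_point d (P (Suc (T s)) s))"
    by metis
  have "\<exists>t<2 ^ q. card S \<le> 2 ^ q * card {s\<in>S. T s = t}"
    by (rule pigeonhole_fibre[OF finS]) (use T(1) in auto)
  then obtain t where t: "t < 2 ^ q" "card S \<le> 2 ^ q * card {s\<in>S. T s = t}" by blast
  let ?S = "{s\<in>S. T s = t}"
  have "\<exists>e. e \<in> violating_edges n d k f \<and> fst e = vec_point d (P t s) \<and> upper_endpoint e = vec_point d (P (Suc t) s)" if s: "s \<in> ?S" for s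
  proof -
    let ?x = "vec_point d (P t s)"
    have f: "f ?x" "\<not> f (vec_point d (P (Suc t) s))" using s T(2,3)[of s] by auto
    have "P (Suc t) s - P t s \<in> ?D" using P(4) t(1) s by blast
    moreover have "P (Suc t) s - P t s \<noteq> 0" using f by auto
    ultimately obtain i a where ia: "i \<in> {1..d}" "a < k" "P (Suc t) s - P t s = axis i (2 ^ a)"
      unfolding dyadic_steps_def by auto
    have eq: "P (Suc t) s j = P t s j + (if j = i then 2 ^ a else 0)" for j
      using fun_cong[OF ia(3), of j] unfolding axis_def by (simp add: algebra_simps)
    have in1: "?x \<in> hypergrid n d" "point_vec d ?x = P t s" using inside[of s t] s t by auto
    have in2: "vec_point d (P (Suc t) s) \<in> hypergrid n d" using inside[of s "Suc t"] s t by auto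
    have xi: "int (?x i) = P t s i" using fun_cong[OF in1(2), of i] ia(1) unfolding point_vec_def by simp
    have up: "vec_point d (P (Suc t) s) = ?x(i := ?x i + 2 ^ a)"
    proof
      fix j
      show "vec_point d (P (Suc t) s) j = (?x(i := ?x i + 2 ^ a)) j"
      proof (cases "j = i")
        case True
        have 1: "P (Suc t) s i = int (?x i + 2 ^ a)" using eq[of i] xi by simp
        have "vec_point d (P (Suc t) s) i = nat (P (Suc t) s i)" using ia(1) unfolding vec_point_def by simp
        then show ?thesis unfolding True 1 by (simp only: fun_upd_same nat_int)
      next
        case False
        then show ?thesis using eq[of j] unfolding vec_point_def by simp
      qed
    qed
    have "?x i + 2 ^ a \<le> n" using hypergrid_coord[OF in2 ia(1)] unfolding up by simp
    then have "(?x, i, a) \<in> violating_edges n d k f"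
      using in1(1) f ia(1,2) up unfolding violating_edges_def violations_def by simp
    then show ?thesis using up unfolding upper_endpoint_def by (intro exI[of _ "(?x, i, a)"]) simp
  qed
  then have "\<forall>s\<in>?S. \<exists>e. e \<in> violating_edges n d k f \<and> fst e = vec_point d (P t s) \<and>
      upper_endpoint e = vec_point d (P (Suc t) s)"
    by (rule ballI)
  from bchoice[OF this] obtain \<eta> where
    "\<forall>s\<in>?S. \<eta> s \<in> violating_edges n d k f \<and> fst (\<eta> s) = vec_point d (P t s) \<and>
      upper_endpoint (\<eta> s) = vec_point d (P (Suc t) s)" ..
  then have \<eta>: "\<And>s. s \<in> ?S \<Longrightarrow> \<eta> s \<in> violating_edges n d k f"
    "\<And>s. s \<in> ?S \<Longrightarrow> fst (\<eta> s) = vec_point d (P t s)"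
    "\<And>s. s \<in> ?S \<Longrightarrow> upper_endpoint (\<eta> s) = vec_point d (P (Suc t) s)" by blast+
  have injP: "inj_on (\<lambda>s. vec_point d (P t' s)) ?S" if t': "t' \<le> 2 ^ q" for t'
  proof (rule inj_onI)
    fix s s' assume s: "s \<in> ?S" "s' \<in> ?S" "vec_point d (P t' s) = vec_point d (P t' s')"
    then have "P t' s = P t' s'" using inside[of _ t'] t'
      by (metis (no_types, lifting) mem_Collect_eq)
    then show "s = s'" using P(1) t' s by (metis (no_types, lifting) inj_onD mem_Collect_eq)
  qed
  have "inj_on (fst \<circ> \<eta>) ?S"
  proof (rule inj_onI)
    fix s s' assume s: "s \<in> ?S" "s' \<in> ?S" "(fst \<circ> \<eta>) s = (fst \<circ> \<eta>) s'"
    have "vec_point d (P t s) = vec_point d (P t s')"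
      using s(3) unfolding o_apply \<eta>(2)[OF s(1)] \<eta>(2)[OF s(2)] .
    then show "s = s'" using inj_onD[OF injP[of t] _ s(1,2)] t(1) by simp
  qed
  then have inj_fst: "inj_on fst (\<eta> ` ?S)" by (rule inj_on_imageI)
  have inj_comp: "inj_on (upper_endpoint \<circ> \<eta>) ?S"
  proof (rule inj_onI)
    fix s s' assume s: "s \<in> ?S" "s' \<in> ?S" "(upper_endpoint \<circ> \<eta>) s = (upper_endpoint \<circ> \<eta>) s'"
    have "vec_point d (P (Suc t) s) = vec_point d (P (Suc t) s')"
      using s(3) unfolding o_apply \<eta>(3)[OF s(1)] \<eta>(3)[OF s(2)] .
    then show "s = s'" using inj_onD[OF injP[of "Suc t"] _ s(1,2)] t(1) by simp
  qed
  then have inj_upper: "inj_on upper_endpoint (\<eta> ` ?S)" by (rule inj_on_imageI)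
  have "card (\<eta> ` ?S) = card ?S" using inj_comp by (intro card_image) (rule inj_on_imageI2)
  then have "card M \<le> 2 ^ q * card (\<eta> ` ?S)" using t(2) cardS by simp
  moreover have "\<eta> ` ?S \<subseteq> violating_edges n d k f" using \<eta>(1) by blast
  ultimately show ?thesis using inj_fst inj_upper by blast
qed

lemma ex_power2_between: "1 \<le> x \<Longrightarrow> \<exists>q. x \<le> 2 ^ q \<and> 2 ^ q \<le> 2 * (x::nat)"
proof (induction x rule: dec_induct)
  case base
  show ?case by (intro exI[of _ 0]) simp
next
  case (step x)
  then obtain q where q: "x \<le> 2 ^ q" "2 ^ q \<le> 2 * x" by blast
  show ?case
  proof (cases "Suc x \<le> 2 ^ q")
    case True
    then show ?thesis using q by (intro exI[of _ q]) auto
  next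
    case False
    then show ?thesis using q step.hyps by (intro exI[of _ "Suc q"]) auto
  qed
qed

lemma finite_violating_edges [simp]: "finite (violating_edges n d k f)"
proof -
  have "violating_edges n d k f \<subseteq> hypergrid n d \<times> {1..d} \<times> {..<k}"
    unfolding violating_edges_def violations_def by auto
  then show ?thesis by (rule finite_subset) simp
qed

text \<open>The matching has \<open>m\<close> pairs and total distance at most \<open>8 * V\<close>.
  By Markov's inequality half of the pairs have distance at most \<open>h\<close>, about
  \<open>16 * V / m\<close>, and paths of \<open>h * k\<close> steps, up to a factor
  \<open>2\<close>, keep a share of order \<open>1 / (h * k)\<close> of them. So
  \<open>m * m\<close> is at most \<open>64 * k * card E * V\<close>, and
  \<open>\<epsilon> * N \<le> 2 * m\<close> supplies the last factor \<open>4\<close>.\<close>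

theorem augmented_margulis:
  assumes n: "n = 2 ^ k" and k: "1 \<le> k" and \<epsilon>: "0 < \<epsilon>" and far: "far_from_monotone n d \<epsilon> f"
  shows "\<epsilon> * real (n ^ d) \<le> 16 * real (total_violations n d k f)"
    and "\<exists>E \<subseteq> violating_edges n d k f. inj_on fst E \<and> inj_on upper_endpoint E \<and>
           (\<epsilon> * real (n ^ d))\<^sup>2 \<le> 256 * real k * real (card E) * real (total_violations n d k f)"
proof -
  let ?V = "total_violations n d k f" and ?N = "real (n ^ d)"
  obtain M \<pi> where M: "M \<subseteq> hypergrid n d" "inj_on \<pi> M"
    "\<And>y. y \<in> M \<Longrightarrow> \<pi> y \<in> hypergrid n d \<and> f (\<pi> y) \<and> \<not> f y \<and> coord_le d (\<pi> y) y"
    "\<epsilon> * ?N \<le> 2 * real (card M)" "(\<Sum>y\<in>M. hamming d (\<pi> y) y) \<le> 8 * ?V"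
    using far_from_monotone_matching[OF n far] by blast
  have finM: "finite M" using M(1) finite_hypergrid by (rule finite_subset)
  have "0 < \<epsilon> * ?N" using \<epsilon> n by simp
  then have m0: "0 < card M" using M(4) by linarith
  let ?m = "card M"
  have "1 \<le> hamming d (\<pi> y) y" if "y \<in> M" for y
  proof -
    have "\<pi> y \<noteq> y" using M(3)[OF that] by auto
    moreover have "\<pi> y i = y i" if "i \<notin> {1..d}" for i
      using M(1) M(3)[OF \<open>y \<in> M\<close>] \<open>y \<in> M\<close> that unfolding hypergrid_def PiE_def extensional_def by auto
    ultimately obtain i where "i \<in> {1..d}" "\<pi> y i \<noteq> y i" by (metis ext)
    then have "{i\<in>{1..d}. \<pi> y i \<noteq> y i} \<noteq> {}" by blast
    then have "0 < hamming d (\<pi> y) y" unfolding hamming_def by (subst card_gt_0_iff) auto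
    then show ?thesis by simp
  qed
  then have "(\<Sum>y\<in>M. 1) \<le> (\<Sum>y\<in>M. hamming d (\<pi> y) y)" by (intro sum_mono)
  then have mV: "?m \<le> 8 * ?V" using M(5) by simp
  then show "\<epsilon> * ?N \<le> 16 * real ?V" using M(4) by linarith
  \<comment> \<open>Twice the bound \<open>8 * V / m\<close> on the average distance, so that fewer
    than half of the pairs exceed it. It is at least \<open>1\<close> because the two points of a
    pair differ.\<close>
  define h where "h = (16 * ?V) div ?m"
  have hm: "h * ?m \<le> 16 * ?V" unfolding h_def by simp
  have hm': "16 * ?V < (h + 1) * ?m" unfolding h_def using m0
    by (metis Suc_eq_plus1 dividend_less_div_times mult.commute mult_Suc)
  have "1 \<le> h" using mV m0 unfolding h_def by (simp add: Suc_le_eq div_greater_zero_iff)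
  define M' where "M' = {y\<in>M. hamming d (\<pi> y) y \<le> h}"
  have "(h + 1) * card (M - M') = (\<Sum>y\<in>M - M'. h + 1)" by simp
  also have "\<dots> \<le> (\<Sum>y\<in>M - M'. hamming d (\<pi> y) y)" unfolding M'_def by (intro sum_mono) auto
  also have "\<dots> \<le> 8 * ?V" using finM by (intro order_trans[OF sum_mono2 M(5)]) auto
  finally have "2 * ((h + 1) * card (M - M')) < (h + 1) * ?m" using hm' by simp
  then have "2 * card (M - M') < ?m" by (metis mult.left_commute mult_less_cancel1)
  moreover have "card (M - M') + card M' = ?m"
    using finM unfolding M'_def by (subst card_Un_disjoint[symmetric]) (auto intro!: arg_cong[where f = card])
  ultimately have half: "?m \<le> 2 * card M'" by simp
  have "1 \<le> h * k" using \<open>1 \<le> h\<close> k by simp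
  \<comment> \<open>Linkages are available for path lengths that are powers of two only; rounding up
    loses a factor of at most \<open>2\<close>.\<close>
  then obtain q where q: "h * k \<le> 2 ^ q" "2 ^ q \<le> 2 * (h * k)" using ex_power2_between by blast
  have "\<exists>E \<subseteq> violating_edges n d k f. inj_on fst E \<and> inj_on upper_endpoint E \<and> card M' \<le> 2 ^ q * card E"
  proof (rule violating_edges_of_matching[OF n])
    show "M' \<subseteq> hypergrid n d" "inj_on \<pi> M'" using M(1,2) unfolding M'_def by (auto intro: inj_on_subset)
    show "\<pi> y \<in> hypergrid n d \<and> f (\<pi> y) \<and> \<not> f y \<and> coord_le d (\<pi> y) y" if "y \<in> M'" for y
      using M(3) that unfolding M'_def by blast
    show "hamming d (\<pi> y) y * k \<le> 2 ^ q" if "y \<in> M'" for y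
      using that q(1) unfolding M'_def by (auto intro: order_trans[OF mult_le_mono1])
  qed
  then obtain E where E: "E \<subseteq> violating_edges n d k f" "inj_on fst E" "inj_on upper_endpoint E" "card M' \<le> 2 ^ q * card E"
    by blast
  have "?m * ?m \<le> ?m * (2 * (2 ^ q * card E))" using half E(4) by (intro mult_le_mono2) linarith
  also have "\<dots> \<le> ?m * (2 * (2 * (h * k) * card E))" using q(2) by (intro mult_le_mono2 mult_le_mono1)
  also have "\<dots> = (h * ?m) * (4 * k * card E)" by (simp add: algebra_simps)
  also have "\<dots> \<le> 16 * ?V * (4 * k * card E)" using hm by (intro mult_le_mono1)
  finally have "real (?m * ?m) \<le> real (16 * ?V * (4 * k * card E))" by (simp only: of_nat_le_iff)
  moreover have "(\<epsilon> * ?N)\<^sup>2 \<le> (2 * real ?m)\<^sup>2" using M(4) \<open>0 < \<epsilon> * ?N\<close> by (intro power_mono) auto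
  ultimately have "(\<epsilon> * ?N)\<^sup>2 \<le> 256 * real k * real (card E) * real ?V"
    by (simp add: power2_eq_square algebra_simps)
  then show "\<exists>E \<subseteq> violating_edges n d k f. inj_on fst E \<and> inj_on upper_endpoint E \<and>
      (\<epsilon> * ?N)\<^sup>2 \<le> 256 * real k * real (card E) * real ?V"
    using E by blast
qed

section \<open>Total influence\<close>

lemma sum_PiE_insert:
  assumes "i \<notin> I"
  shows "(\<Sum>x\<in>PiE (insert i I) B. F x) = (\<Sum>y\<in>B i. \<Sum>g\<in>PiE I B. F (g(i := y)))"
proof -
  have "(\<Sum>x\<in>PiE (insert i I) B. F x) = (\<Sum>(y, g)\<in>B i \<times> PiE I B. F (g(i := y)))"
    unfolding PiE_insert_eq using inj_combinator[OF assms] by (subst sum.reindex) (auto simp: case_prod_beta)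
  then show ?thesis by (simp add: sum.cartesian_product)
qed

text \<open>The variance of a sum of independent centred variables: the cross terms vanish since
  \<open>h\<close> sums to \<open>0\<close>. The factor \<open>card B\<close> on the left avoids the
  exponent \<open>card I - 1\<close>.\<close>

lemma sum_PiE_square:
  fixes h :: "'b \<Rightarrow> real"
  assumes "finite I" "finite B" and h: "(\<Sum>t\<in>B. h t) = 0"
  shows "real (card B) * (\<Sum>x\<in>PiE I (\<lambda>_. B). (\<Sum>i\<in>I. h (x i))\<^sup>2)
           = real (card I) * real (card B) ^ card I * (\<Sum>t\<in>B. (h t)\<^sup>2)"
  using assms(1)
proof (induction I rule: finite_induct)
  case empty
  then show ?case by simp
next
  case (insert i I)
  let ?P = "PiE I (\<lambda>_. B)" and ?b = "real (card B)"
  have cardP: "real (card ?P) = ?b ^ card I" using insert.hyps by (simp add: card_PiE)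
  have "(\<Sum>x\<in>PiE (insert i I) (\<lambda>_. B). (\<Sum>j\<in>insert i I. h (x j))\<^sup>2)
      = (\<Sum>y\<in>B. \<Sum>g\<in>?P. (h y + (\<Sum>j\<in>I. h (g j)))\<^sup>2)"
    unfolding sum_PiE_insert[OF insert.hyps(2)]
  proof (intro sum.cong refl)
    fix y g
    have "(\<Sum>j\<in>I. h ((g(i := y)) j)) = (\<Sum>j\<in>I. h (g j))" using insert.hyps by (intro sum.cong) auto
    then show "(\<Sum>j\<in>insert i I. h ((g(i := y)) j))\<^sup>2 = (h y + (\<Sum>j\<in>I. h (g j)))\<^sup>2"
      using insert.hyps by simp
  qed
  also have "\<dots> = (\<Sum>g\<in>?P. \<Sum>y\<in>B. (h y + (\<Sum>j\<in>I. h (g j)))\<^sup>2)" by (rule sum.swap)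
  also have "\<dots> = (\<Sum>g\<in>?P. (\<Sum>y\<in>B. (h y)\<^sup>2) + ?b * (\<Sum>j\<in>I. h (g j))\<^sup>2)"
  proof (intro sum.cong refl)
    fix g
    have "(\<Sum>y\<in>B. (h y + c)\<^sup>2) = (\<Sum>y\<in>B. (h y)\<^sup>2) + 2 * (\<Sum>y\<in>B. h y) * c + ?b * c\<^sup>2" for c
      by (simp add: power2_sum sum.distrib sum_distrib_left sum_distrib_right mult.assoc)
    from this[of "\<Sum>j\<in>I. h (g j)"] show "(\<Sum>y\<in>B. (h y + (\<Sum>j\<in>I. h (g j)))\<^sup>2) = (\<Sum>y\<in>B. (h y)\<^sup>2) + ?b * (\<Sum>j\<in>I. h (g j))\<^sup>2"
      using h by simp
  qed
  also have "\<dots> = ?b ^ card I * (\<Sum>y\<in>B. (h y)\<^sup>2) + ?b * (\<Sum>g\<in>?P. (\<Sum>j\<in>I. h (g j))\<^sup>2)"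
    by (simp add: sum.distrib sum_distrib_left cardP)
  also have "\<dots> = ?b ^ card I * (\<Sum>y\<in>B. (h y)\<^sup>2) + real (card I) * ?b ^ card I * (\<Sum>t\<in>B. (h t)\<^sup>2)"
    using insert.IH by simp
  finally show ?case using insert.hyps by (simp add: algebra_simps)
qed

definition bichromatic :: "nat \<Rightarrow> nat \<Rightarrow> (point \<Rightarrow> bool) \<Rightarrow> nat \<Rightarrow> nat \<Rightarrow> point set" where
  "bichromatic n d f i a = {x\<in>hypergrid n d. x i + 2 ^ a \<le> n \<and> f x \<noteq> f (x(i := x i + 2 ^ a))}"

definition total_influence :: "nat \<Rightarrow> nat \<Rightarrow> nat \<Rightarrow> (point \<Rightarrow> bool) \<Rightarrow> nat" where
  "total_influence n d k f = (\<Sum>i\<in>{1..d}. \<Sum>a<k. card (bichromatic n d f i a))"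

text \<open>In-degree minus out-degree of the position \<open>t\<close> on a line with the edges of
  length \<open>2 ^ a\<close>; this is the weight of \<open>f x\<close> in the sum of
  \<open>f (upper end) - f (lower end)\<close> over the edges.\<close>

definition drift :: "nat \<Rightarrow> nat \<Rightarrow> nat \<Rightarrow> real" where
  "drift n a t = of_bool (2 ^ a < t) - of_bool (t + 2 ^ a \<le> n)"

text \<open>Each edge has one lower and one upper end, so the drift sums to \<open>0\<close>. The
  two terms cancel except at the lowest and the highest \<open>2 ^ a\<close> positions.\<close>

lemma sum_drift:
  assumes "2 ^ a \<le> n"
  shows "(\<Sum>t\<in>{1..n}. drift n a t) = 0" and "(\<Sum>t\<in>{1..n}. (drift n a t)\<^sup>2) \<le> 2 * 2 ^ a"
proof -
  have 1: "{Suc 0..n} \<inter> Collect ((<) (2 ^ a)) = {2 ^ a<..n}"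
    "{Suc 0..n} \<inter> {t. t + 2 ^ a \<le> n} = {Suc 0..n - 2 ^ a}" by auto
  show "(\<Sum>t\<in>{1..n}. drift n a t) = 0"
    unfolding drift_def by (simp add: sum_subtractf 1)
  have "(\<Sum>t\<in>{1..n}. (drift n a t)\<^sup>2) \<le> (\<Sum>t\<in>{1..n}. of_bool (t \<le> 2 ^ a) + of_bool (n < t + 2 ^ a))"
    by (intro sum_mono) (auto simp: drift_def)
  also have "\<dots> = real (card ({1..n} \<inter> {t. t \<le> 2 ^ a})) + real (card ({1..n} \<inter> {t. n < t + 2 ^ a}))"
    by (simp add: sum.distrib)
  also have "{1..n} \<inter> {t. t \<le> 2 ^ a} = {1..2 ^ a}" using assms by auto
  also have "{1..n} \<inter> {t. n < t + 2 ^ a} = {n - 2 ^ a<..n}" using assms by auto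
  finally show "(\<Sum>t\<in>{1..n}. (drift n a t)\<^sup>2) \<le> 2 * 2 ^ a" using assms by simp
qed

text \<open>A bichromatic edge is decreasing or increasing. Increasing minus decreasing edges is the
  telescoped sum of the differences of \<open>f\<close> over all edges, which is then regrouped by
  points.\<close>

lemma bichromatic_le_drift:
  assumes i: "i \<in> {1..d}"
  shows "real (card (bichromatic n d f i a))
      = 2 * real (card (violations n d f i a)) + (\<Sum>x\<in>hypergrid n d. of_bool (f x) * drift n a (x i))"
proof -
  let ?G = "hypergrid n d" and ?u = "\<lambda>x. x(i := x i + 2 ^ a)"
  let ?L = "{x\<in>?G. x i + 2 ^ a \<le> n}" and ?U = "{x\<in>?G. 2 ^ a < x i}"
  have "(\<Sum>x\<in>?L. of_bool (f (?u x)) :: real) = (\<Sum>x\<in>?U. of_bool (f x))"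
  proof (rule sum.reindex_bij_witness[where i = "\<lambda>x. x(i := x i - 2 ^ a)" and j = ?u])
    fix x assume "x \<in> ?U"
    moreover from this have "x i - 2 ^ a \<in> {1..n}" using hypergrid_coord[OF _ i, of x n] by (auto simp: Suc_le_eq)
    ultimately show "x(i := x i - 2 ^ a) \<in> ?L"
      using hypergrid_coord[OF _ i, of x n] hypergrid_upd[OF _ i, of x n "x i - 2 ^ a"] by auto
  next
    fix x assume "x \<in> ?L"
    then show "?u x \<in> ?U"
      using hypergrid_coord[OF _ i, of x n] hypergrid_upd[OF _ i, of x n "x i + 2 ^ a"] by auto
  qed (auto simp: fun_eq_iff)
  also have "\<dots> = (\<Sum>x\<in>?G. of_bool (f x) * of_bool (2 ^ a < x i))"
    by (rule sum.mono_neutral_cong_left) auto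
  finally have up: "(\<Sum>x\<in>?L. of_bool (f (?u x)) :: real) = (\<Sum>x\<in>?G. of_bool (f x) * of_bool (2 ^ a < x i))" .
  have low: "(\<Sum>x\<in>?L. of_bool (f x) :: real) = (\<Sum>x\<in>?G. of_bool (f x) * of_bool (x i + 2 ^ a \<le> n))"
    by (rule sum.mono_neutral_cong_left) auto
  have "real (card (bichromatic n d f i a)) = (\<Sum>x\<in>?L. of_bool (f x \<noteq> f (?u x)))"
    unfolding bichromatic_def by (simp add: Int_def conj_ac)
  also have "\<dots> = (\<Sum>x\<in>?L. 2 * of_bool (f x \<and> \<not> f (?u x)) + (of_bool (f (?u x)) - of_bool (f x)))"
    by (intro sum.cong refl) auto
  also have "\<dots> = 2 * (\<Sum>x\<in>?L. of_bool (f x \<and> \<not> f (?u x))) + ((\<Sum>x\<in>?L. of_bool (f (?u x))) - (\<Sum>x\<in>?L. of_bool (f x)))"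
    by (simp only: sum.distrib sum_subtractf sum_distrib_left)
  also have "(\<Sum>x\<in>?L. of_bool (f x \<and> \<not> f (?u x)) :: real) = real (card (violations n d f i a))"
    unfolding violations_def by (simp add: Int_def conj_ac)
  also have "(\<Sum>x\<in>?L. of_bool (f (?u x)) :: real) - (\<Sum>x\<in>?L. of_bool (f x))
      = (\<Sum>x\<in>?G. of_bool (f x) * drift n a (x i))"
    unfolding up low drift_def by (simp add: sum_subtractf right_diff_distrib)
  finally show ?thesis .
qed

lemma sum_sqrt_power2_le: "(\<Sum>a<k. sqrt (2 * 2 ^ a)) \<le> 4 * sqrt (2 ^ k)"
proof (induction k)
  case (Suc k)
  \<comment> \<open>Any bound of at least \<open>4 / 3\<close> would do for
    \<open>4 + sqrt 2 \<le> 4 * sqrt 2\<close>.\<close>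
  have s: "7 / 5 \<le> sqrt 2" by (rule real_le_rsqrt) (simp add: power2_eq_square)
  have "(\<Sum>a<Suc k. sqrt (2 * 2 ^ a)) \<le> 4 * sqrt (2 ^ k) + sqrt 2 * sqrt (2 ^ k)"
    using Suc by (simp add: real_sqrt_mult)
  also have "\<dots> \<le> 4 * (sqrt 2 * sqrt (2 ^ k))"
  proof -
    have "4 + sqrt 2 \<le> 4 * sqrt 2" using s by simp
    then have "(4 + sqrt 2) * sqrt (2 ^ k) \<le> (4 * sqrt 2) * sqrt (2 ^ k)" by (intro mult_right_mono) auto
    then show ?thesis by (simp add: algebra_simps)
  qed
  finally show ?case by (simp add: real_sqrt_mult)
qed simp

text \<open>
  Increasing minus decreasing edges is the correlation of \<open>f\<close> with the sum of the drifts, which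
  the Cauchy-Schwarz inequality bounds separately on each scale \<open>a\<close>. The bounds form a geometric
  series, so no factor \<open>k\<close> is lost.
\<close>

lemma total_influence_le:
  assumes n: "n = 2 ^ k"
  shows "real (total_influence n d k f) \<le> 2 * real (total_violations n d k f) + 4 * sqrt (real d) * real (n ^ d)"
proof -
  let ?G = "hypergrid n d" and ?N = "real (n ^ d)"
  have scale: "(\<Sum>x\<in>?G. of_bool (f x) * (\<Sum>i\<in>{1..d}. drift n a (x i))) \<le> ?N * sqrt (real d) * (sqrt (2 * 2 ^ a) / sqrt (2 ^ k))"
    if a: "a < k" for a
  proof -
    have le: "2 ^ a \<le> n" using a n by simp
    let ?Z = "\<lambda>x. \<Sum>i\<in>{1..d}. drift n a (x i)"
    have "real n * (\<Sum>x\<in>?G. (?Z x)\<^sup>2) = real d * real n ^ d * (\<Sum>t\<in>{1..n}. (drift n a t)\<^sup>2)"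
      using sum_PiE_square[of "{1..d}" "{1..n}" "drift n a"] sum_drift(1)[OF le] unfolding hypergrid_def by simp
    also have "\<dots> \<le> real d * real n ^ d * (2 * 2 ^ a)"
      using sum_drift(2)[OF le] by (intro mult_left_mono) auto
    finally have sq: "(\<Sum>x\<in>?G. (?Z x)\<^sup>2) \<le> ?N * (real d * (2 * 2 ^ a / 2 ^ k))"
      using n by (simp add: field_simps)
    have "(\<Sum>x\<in>?G. of_bool (f x) * ?Z x) \<le> (\<Sum>x\<in>?G. \<bar>?Z x\<bar>)"
      by (intro sum_mono) (auto simp: abs_ge_self)
    also have "\<dots> \<le> sqrt (?N * (?N * (real d * (2 * 2 ^ a / 2 ^ k))))"
    proof (rule real_le_rsqrt)
      have "(\<Sum>x\<in>?G. \<bar>?Z x\<bar>)\<^sup>2 \<le> (\<Sum>x\<in>?G. \<bar>?Z x\<bar>\<^sup>2) * real (card ?G)"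
        by (rule sum_squared_le_sum_of_squares)
      also have "\<dots> = ?N * (\<Sum>x\<in>?G. (?Z x)\<^sup>2)" by (simp add: card_hypergrid)
      also have "\<dots> \<le> ?N * (?N * (real d * (2 * 2 ^ a / 2 ^ k)))" using sq by (intro mult_left_mono) auto
      finally show "(\<Sum>x\<in>?G. \<bar>?Z x\<bar>)\<^sup>2 \<le> ?N * (?N * (real d * (2 * 2 ^ a / 2 ^ k)))" .
    qed
    also have "\<dots> = ?N * sqrt (real d) * (sqrt (2 * 2 ^ a) / sqrt (2 ^ k))"
      by (simp add: real_sqrt_mult real_sqrt_divide)
    finally show ?thesis .
  qed
  have "real (total_influence n d k f) = 2 * real (total_violations n d k f)
      + (\<Sum>i\<in>{1..d}. \<Sum>a<k. \<Sum>x\<in>?G. of_bool (f x) * drift n a (x i))"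
    unfolding total_influence_def total_violations_def of_nat_sum
    by (simp only: bichromatic_le_drift sum.distrib sum_distrib_left cong: sum.cong)
  also have "(\<Sum>i\<in>{1..d}. \<Sum>a<k. \<Sum>x\<in>?G. of_bool (f x) * drift n a (x i))
      = (\<Sum>a<k. \<Sum>x\<in>?G. of_bool (f x) * (\<Sum>i\<in>{1..d}. drift n a (x i)))"
  proof -
    have "(\<Sum>i\<in>{1..d}. \<Sum>a<k. \<Sum>x\<in>?G. of_bool (f x) * drift n a (x i))
        = (\<Sum>a<k. \<Sum>i\<in>{1..d}. \<Sum>x\<in>?G. of_bool (f x) * drift n a (x i))" by (rule sum.swap)
    also have "\<dots> = (\<Sum>a<k. \<Sum>x\<in>?G. \<Sum>i\<in>{1..d}. of_bool (f x) * drift n a (x i))"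
      by (intro sum.cong refl sum.swap)
    finally show ?thesis by (simp only: sum_distrib_left)
  qed
  also have "\<dots> \<le> (\<Sum>a<k. ?N * sqrt (real d) * (sqrt (2 * 2 ^ a) / sqrt (2 ^ k)))"
    by (intro sum_mono scale) simp
  also have "\<dots> = ?N * sqrt (real d) * ((\<Sum>a<k. sqrt (2 * 2 ^ a)) / sqrt (2 ^ k))"
    by (simp only: sum_distrib_left sum_divide_distrib)
  also have "\<dots> \<le> ?N * sqrt (real d) * 4"
    using sum_sqrt_power2_le[of k] by (intro mult_left_mono) (auto simp: divide_le_eq)
  finally show ?thesis by (simp add: mult_ac)
qed

section \<open>Random walks\<close>

text \<open>The one-dimensional content of \<open>H_edges\<close>: for a fixed scale the two classes
  \<open>c\<close> split the edges of a line into two matchings.\<close>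

definition lower_end :: "nat \<Rightarrow> nat \<Rightarrow> nat \<Rightarrow> nat \<Rightarrow> bool" where
  "lower_end n t a c \<longleftrightarrow> t + 2 ^ a \<le> n \<and> (if c = 0 then t mod 2 ^ (a + 1) < 2 ^ a else t mod 2 ^ (a + 1) \<ge> 2 ^ a)"

definition upper_end :: "nat \<Rightarrow> nat \<Rightarrow> nat \<Rightarrow> nat \<Rightarrow> bool" where
  "upper_end n t a c \<longleftrightarrow> 2 ^ a < t \<and> lower_end n (t - 2 ^ a) a c"

lemma mod_shift_half:
  fixes t :: nat
  shows "(t + 2 ^ a) mod 2 ^ (a + 1) < 2 ^ a \<longleftrightarrow> \<not> t mod 2 ^ (a + 1) < 2 ^ a"
proof -
  let ?m = "2 ^ a :: nat"
  define r where "r = t mod (2 * ?m)"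
  have r: "r < 2 * ?m" unfolding r_def by simp
  have "(t + ?m) mod (2 * ?m) = (r + ?m) mod (2 * ?m)" unfolding r_def by (simp add: mod_add_left_eq)
  also have "\<dots> = (if r < ?m then r + ?m else r - ?m)"
  proof (cases "r < ?m")
    case False
    then have "r + ?m = (r - ?m) + 2 * ?m" by simp
    then have "(r + ?m) mod (2 * ?m) = (r - ?m) mod (2 * ?m)" by (metis mod_add_self2)
    then show ?thesis using False r by simp
  qed simp
  finally have e: "(t + ?m) mod (2 * ?m) = (if r < ?m then r + ?m else r - ?m)" .
  have p: "2 ^ (a + 1) = 2 * ?m" by simp
  show ?thesis unfolding p e r_def[symmetric] using r by auto
qed

text \<open>Adding \<open>2 ^ a\<close> exchanges the two halves of the residues modulo
  \<open>2 ^ (a + 1)\<close>; hence an upper end is never a lower end in the same class.\<close>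

lemma lower_end_shift: "lower_end n t a c \<Longrightarrow> \<not> lower_end n (t + 2 ^ a) a c"
  using mod_shift_half[of t a] unfolding lower_end_def by (auto split: if_splits)

text \<open>The default value \<open>0\<close> outside \<open>{1..d}\<close> agrees with
  \<open>Pi_pmf\<close> in the tester, so the uniform distribution on this set is the joint
  distribution of \<open>a\<close> and \<open>c\<close>.\<close>

definition choices :: "nat \<Rightarrow> nat \<Rightarrow> ((nat \<Rightarrow> nat) \<times> (nat \<Rightarrow> nat)) set" where
  "choices d k = PiE_dflt {1..d} 0 (\<lambda>_. {..<k}) \<times> PiE_dflt {1..d} 0 (\<lambda>_. {0, 1})"

lemma finite_choices [simp]: "finite (choices d k)"
  unfolding choices_def by (intro finite_cartesian_product finite_PiE_dflt) auto

lemma mem_choices: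
  "(a, c) \<in> choices d k \<longleftrightarrow>
     (\<forall>i\<in>{1..d}. a i < k \<and> c i \<in> {0, 1}) \<and> (\<forall>i. i \<notin> {1..d} \<longrightarrow> a i = 0 \<and> c i = 0)"
  unfolding choices_def PiE_dflt_def by auto

lemma choices_upd:
  "(a, c) \<in> choices d k \<Longrightarrow> i \<in> {1..d} \<Longrightarrow> \<alpha> < k \<Longrightarrow> \<gamma> \<in> {0, 1} \<Longrightarrow> (a(i := \<alpha>), c(i := \<gamma>)) \<in> choices d k"
  unfolding mem_choices by auto

text \<open>The pair \<open>(a i, c i)\<close> is uniform on \<open>2 * k\<close> values and
  independent of every quantity that ignores it; overwriting the pair gives bijections between the
  fibres.\<close>

lemma sum_choices_coord:
  fixes F :: "(nat \<Rightarrow> nat) \<Rightarrow> (nat \<Rightarrow> nat) \<Rightarrow> real"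
  assumes i: "i \<in> {1..d}" and \<alpha>: "\<alpha> < k" and \<gamma>: "\<gamma> \<in> {0, 1}"
    and F: "\<And>a c \<alpha>' \<gamma>'. F (a(i := \<alpha>')) (c(i := \<gamma>')) = F a c"
  shows "2 * real k * (\<Sum>(a, c)\<in>choices d k. of_bool (a i = \<alpha> \<and> c i = \<gamma>) * F a c) = (\<Sum>(a, c)\<in>choices d k. F a c)"
proof -
  let ?B = "{..<k} \<times> {0, 1::nat}"
  let ?S = "\<lambda>\<alpha> \<gamma>. {(a, c)\<in>choices d k. a i = \<alpha> \<and> c i = \<gamma>}"
  have restr: "(\<Sum>(a, c)\<in>choices d k. of_bool (a i = \<alpha>' \<and> c i = \<gamma>') * F a c) = (\<Sum>(a, c)\<in>?S \<alpha>' \<gamma>'. F a c)" for \<alpha>' \<gamma>'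
    by (rule sum.mono_neutral_cong_right) auto
  have same: "(\<Sum>(a, c)\<in>?S \<alpha>' \<gamma>'. F a c) = (\<Sum>(a, c)\<in>?S \<alpha> \<gamma>. F a c)" if "(\<alpha>', \<gamma>') \<in> ?B" for \<alpha>' \<gamma>'
    by (rule sum.reindex_bij_witness[where i = "\<lambda>(a, c). (a(i := \<alpha>'), c(i := \<gamma>'))" and j = "\<lambda>(a, c). (a(i := \<alpha>), c(i := \<gamma>))"])
      (use that i \<alpha> \<gamma> in \<open>auto simp: F fun_eq_iff intro!: choices_upd\<close>)
  have "(\<Sum>(a, c)\<in>choices d k. F a c) = (\<Sum>p\<in>?B. \<Sum>z\<in>{z\<in>choices d k. (fst z i, snd z i) = p}. F (fst z) (snd z))"
  proof -
    have im: "(\<lambda>z. (fst z i, snd z i)) ` choices d k \<subseteq> ?B"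
    proof clarify
      fix a c assume "(a, c) \<in> choices d k"
      then show "fst (a, c) i \<in> {..<k} \<and> snd (a, c) i \<in> {0, 1}" using i unfolding mem_choices by auto
    qed
    show ?thesis
      using sum.group[OF finite_choices _ im, of "\<lambda>z. F (fst z) (snd z)"] by (simp add: case_prod_beta)
  qed
  also have "\<dots> = (\<Sum>p\<in>?B. \<Sum>(a, c)\<in>?S \<alpha> \<gamma>. F a c)"
  proof (rule sum.cong[OF refl])
    fix p assume p: "p \<in> ?B"
    have "{z\<in>choices d k. (fst z i, snd z i) = p} = ?S (fst p) (snd p)" by (auto simp: case_prod_beta)
    then have "(\<Sum>z\<in>{z\<in>choices d k. (fst z i, snd z i) = p}. F (fst z) (snd z)) = (\<Sum>(a, c)\<in>?S (fst p) (snd p). F a c)"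
      by (simp add: case_prod_beta)
    also have "\<dots> = (\<Sum>(a, c)\<in>?S \<alpha> \<gamma>. F a c)" using p by (intro same) (auto simp: mem_Times_iff)
    finally show "(\<Sum>z\<in>{z\<in>choices d k. (fst z i, snd z i) = p}. F (fst z) (snd z)) = (\<Sum>(a, c)\<in>?S \<alpha> \<gamma>. F a c)" .
  qed
  also have "\<dots> = 2 * real k * (\<Sum>(a, c)\<in>?S \<alpha> \<gamma>. F a c)"
    by (simp add: card_cartesian_product)
  finally show ?thesis unfolding restr by simp
qed

text \<open>Each edge in direction \<open>i\<close> lies in exactly one of the \<open>2 * k\<close>
  matchings that can be chosen there.\<close>

lemma sum_choices_edge:
  assumes i: "i \<in> {1..d}"
  shows "2 * real k * (\<Sum>(a, c)\<in>choices d k. of_bool (lower_end n t (a i) (c i) \<and> Q (a i)))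
           = real (card (choices d k)) * (\<Sum>\<alpha><k. of_bool (t + 2 ^ \<alpha> \<le> n \<and> Q \<alpha>))"
proof -
  let ?B = "{..<k} \<times> {0, 1::nat}"
  let ?h = "\<lambda>\<alpha> \<gamma>. of_bool (lower_end n t \<alpha> \<gamma> \<and> Q \<alpha>) :: real"
  define X where "X p = (\<Sum>(a, c)\<in>choices d k. of_bool (a i = fst p \<and> c i = snd p) * 1 :: real)" for p
  have "(\<Sum>(a, c)\<in>choices d k. ?h (a i) (c i))
      = (\<Sum>(a, c)\<in>choices d k. \<Sum>p\<in>?B. of_bool (a i = fst p \<and> c i = snd p) * ?h (fst p) (snd p))"
  proof (intro sum.cong refl, clarify)
    fix a c assume "(a, c) \<in> choices d k"
    then have p: "(a i, c i) \<in> ?B" using i unfolding mem_choices by auto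
    have "(\<Sum>p\<in>?B. of_bool (a i = fst p \<and> c i = snd p) * ?h (fst p) (snd p)) = (\<Sum>p\<in>{(a i, c i)}. ?h (fst p) (snd p))"
      using p by (intro sum.mono_neutral_cong_right) auto
    then show "?h (a i) (c i) = (\<Sum>p\<in>?B. of_bool (a i = fst p \<and> c i = snd p) * ?h (fst p) (snd p))" by simp
  qed
  also have "\<dots> = (\<Sum>p\<in>?B. X p * ?h (fst p) (snd p))"
    unfolding X_def case_prod_beta sum_distrib_right by (subst sum.swap) simp
  finally have "2 * real k * (\<Sum>(a, c)\<in>choices d k. ?h (a i) (c i))
      = (\<Sum>p\<in>?B. (2 * real k * X p) * ?h (fst p) (snd p))"
    by (simp only: sum_distrib_left mult.assoc)
  also have "\<dots> = (\<Sum>p\<in>?B. real (card (choices d k)) * ?h (fst p) (snd p))"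
  proof (rule sum.cong[OF refl])
    fix p assume "p \<in> ?B"
    then have "2 * real k * X p = (\<Sum>(a, c)\<in>choices d k. 1)"
      unfolding X_def by (intro sum_choices_coord[OF i]) (auto simp: mem_Times_iff)
    then show "(2 * real k * X p) * ?h (fst p) (snd p)
        = real (card (choices d k)) * ?h (fst p) (snd p)" by simp
  qed
  also have "\<dots> = real (card (choices d k)) * (\<Sum>\<alpha><k. \<Sum>\<gamma>\<in>{0, 1}. ?h \<alpha> \<gamma>)"
    by (simp only: sum_distrib_left[symmetric] sum.cartesian_product case_prod_beta')
  also have "(\<Sum>\<alpha><k. \<Sum>\<gamma>\<in>{0, 1}. ?h \<alpha> \<gamma>) = (\<Sum>\<alpha><k. of_bool (t + 2 ^ \<alpha> \<le> n \<and> Q \<alpha>))"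
    by (intro sum.cong refl) (simp del: sum_of_bool_eq add: lower_end_def)
  finally show ?thesis .
qed

section \<open>Walks and the probability that they change the value of \<open>f\<close>\<close>

definition up_coords :: "nat \<Rightarrow> nat \<Rightarrow> point \<Rightarrow> (nat \<Rightarrow> nat) \<Rightarrow> (nat \<Rightarrow> nat) \<Rightarrow> nat set" where
  "up_coords n d x a c = {i\<in>{1..d}. lower_end n (x i) (a i) (c i)}"

definition down_coords :: "nat \<Rightarrow> nat \<Rightarrow> point \<Rightarrow> (nat \<Rightarrow> nat) \<Rightarrow> (nat \<Rightarrow> nat) \<Rightarrow> nat set" where
  "down_coords n d x a c = {i\<in>{1..d}. upper_end n (x i) (a i) (c i)}"

definition climb :: "point \<Rightarrow> (nat \<Rightarrow> nat) \<Rightarrow> nat set \<Rightarrow> point" where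
  "climb x a T = (\<lambda>i. if i \<in> T then x i + 2 ^ a i else x i)"

definition subsets_of_card :: "nat set \<Rightarrow> nat \<Rightarrow> nat set set" where
  "subsets_of_card S l = {T. T \<subseteq> S \<and> card T = l}"

lemma finite_up_coords [simp]: "finite (up_coords n d x a c)"
  unfolding up_coords_def by simp

lemma finite_down_coords [simp]: "finite (down_coords n d x a c)"
  unfolding down_coords_def by simp

lemma card_up_coords_le: "card (up_coords n d x a c) \<le> d"
proof -
  have "card (up_coords n d x a c) \<le> card {1..d}" unfolding up_coords_def by (intro card_mono) auto
  then show ?thesis by simp
qed

lemma finite_subsets_of_card [simp]: "finite S \<Longrightarrow> finite (subsets_of_card S l)"
  unfolding subsets_of_card_def by (rule finite_subset[of _ "Pow S"]) auto

lemma card_subsets_of_card: "finite S \<Longrightarrow> card (subsets_of_card S l) = card S choose l"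
  unfolding subsets_of_card_def by (rule n_subsets)

lemma climb_hypergrid:
  assumes "x \<in> hypergrid n d" "T \<subseteq> up_coords n d x a c"
  shows "climb x a T \<in> hypergrid n d"
proof -
  have "climb x a T i \<in> {1..n}" if i: "i \<in> {1..d}" for i
    using hypergrid_coord[OF assms(1) i] assms(2) unfolding climb_def up_coords_def lower_end_def by auto
  moreover have "climb x a T i = undefined" if i: "i \<notin> {1..d}" for i
    using i assms unfolding climb_def up_coords_def hypergrid_def PiE_def extensional_def by auto
  ultimately show ?thesis unfolding hypergrid_def by (auto simp: PiE_iff extensional_def)
qed

text \<open>In each direction the selected edges form a matching, so a coordinate that has been
  climbed is exhausted, while the others are unaffected. The restriction to the walks is thus a
  partial cube.\<close>

lemma up_coords_climb: "T \<subseteq> up_coords n d x a c \<Longrightarrow> up_coords n d (climb x a T) a c = up_coords n d x a c - T"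
  using lower_end_shift unfolding up_coords_def climb_def by (fastforce split: if_splits)

lemma down_coords_climb:
  "x \<in> hypergrid n d \<Longrightarrow> T \<subseteq> up_coords n d x a c \<Longrightarrow>
     T \<subseteq> down_coords n d (climb x a T) a c \<and> down_coords n d (climb x a T) a c \<subseteq> down_coords n d x a c \<union> T"
  using hypergrid_coord[of x n d] unfolding up_coords_def down_coords_def climb_def upper_end_def by fastforce

lemma climb_insert: "e \<notin> T \<Longrightarrow> climb (climb x a T) a {e} = climb x a (insert e T)"
  unfolding climb_def by auto

lemma climb_singleton: "climb x a {i} = x(i := x i + 2 ^ a i)"
  unfolding climb_def by auto

definition flips :: "nat \<Rightarrow> nat \<Rightarrow> (point \<Rightarrow> bool) \<Rightarrow> point \<Rightarrow> (nat \<Rightarrow> nat) \<Rightarrow> (nat \<Rightarrow> nat) \<Rightarrow> nat \<Rightarrow> nat" where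
  "flips n d f x a c l = card {T\<in>subsets_of_card (up_coords n d x a c) l. f (climb x a T) \<noteq> f x}"

definition boundary_degree :: "nat \<Rightarrow> nat \<Rightarrow> (point \<Rightarrow> bool) \<Rightarrow> point \<Rightarrow> (nat \<Rightarrow> nat) \<Rightarrow> (nat \<Rightarrow> nat) \<Rightarrow> nat" where
  "boundary_degree n d f x a c = card {e\<in>up_coords n d x a c. f x \<noteq> f (climb x a {e})}"

text \<open>Remove one element \<open>e\<close> from a set \<open>T\<close> of size
  \<open>l + 1\<close> whose walk changes the value: either the walk along \<open>T - {e}\<close>
  has changed it already, or the step along \<open>e\<close> crosses the boundary. Both kinds of
  pairs are counted.\<close>

lemma flips_Suc:
  "(l + 1) * flips n d f x a c (l + 1) \<le> (card (up_coords n d x a c) - l) * flips n d f x a c l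
     + (\<Sum>T\<in>subsets_of_card (up_coords n d x a c) l. boundary_degree n d f (climb x a T) a c)"
proof -
  let ?S = "up_coords n d x a c"
  let ?P = "SIGMA T:{T\<in>subsets_of_card ?S (l + 1). f (climb x a T) \<noteq> f x}. T"
  let ?Q = "SIGMA T:{T\<in>subsets_of_card ?S l. f (climb x a T) \<noteq> f x}. ?S - T"
  let ?R = "SIGMA T:subsets_of_card ?S l. {e\<in>?S - T. f (climb x a T) \<noteq> f (climb x a (insert e T))}"
  have finT: "finite T" if "T \<in> subsets_of_card ?S m" for T m
    using that unfolding subsets_of_card_def by (auto intro: finite_subset[OF _ finite_up_coords])
  have cP: "card ?P = (l + 1) * flips n d f x a c (l + 1)"
  proof -
    have "card ?P = (\<Sum>T\<in>{T\<in>subsets_of_card ?S (l + 1). f (climb x a T) \<noteq> f x}. card T)"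
      by (rule card_SigmaI, simp, blast intro: finT)
    also have "\<dots> = (\<Sum>T\<in>{T\<in>subsets_of_card ?S (l + 1). f (climb x a T) \<noteq> f x}. l + 1)"
      by (intro sum.cong refl) (simp add: subsets_of_card_def)
    finally show ?thesis by (simp add: flips_def)
  qed
  have cQ: "card ?Q = (card ?S - l) * flips n d f x a c l"
  proof -
    have "card ?Q = (\<Sum>T\<in>{T\<in>subsets_of_card ?S l. f (climb x a T) \<noteq> f x}. card (?S - T))"
      by (rule card_SigmaI) simp_all
    also have "\<dots> = (\<Sum>T\<in>{T\<in>subsets_of_card ?S l. f (climb x a T) \<noteq> f x}. card ?S - l)"
    proof (rule sum.cong[OF refl])
      fix T assume T: "T \<in> {T\<in>subsets_of_card ?S l. f (climb x a T) \<noteq> f x}"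
      then have T': "T \<in> subsets_of_card ?S l" by simp
      then have "finite T" by (rule finT)
      moreover have "T \<subseteq> ?S" "card T = l" using T' unfolding subsets_of_card_def by simp_all
      ultimately show "card (?S - T) = card ?S - l" by (simp add: card_Diff_subset)
    qed
    finally show ?thesis by (simp add: flips_def)
  qed
  have cR: "card ?R = (\<Sum>T\<in>subsets_of_card ?S l. boundary_degree n d f (climb x a T) a c)"
  proof -
    have "card ?R = (\<Sum>T\<in>subsets_of_card ?S l. card {e\<in>?S - T. f (climb x a T) \<noteq> f (climb x a (insert e T))})"
      by (rule card_SigmaI) simp_all
    also have "\<dots> = (\<Sum>T\<in>subsets_of_card ?S l. boundary_degree n d f (climb x a T) a c)"
    proof (rule sum.cong[OF refl])
      fix T assume "T \<in> subsets_of_card ?S l"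
      then have "up_coords n d (climb x a T) a c = ?S - T"
        unfolding subsets_of_card_def by (intro up_coords_climb) auto
      then show "card {e\<in>?S - T. f (climb x a T) \<noteq> f (climb x a (insert e T))} = boundary_degree n d f (climb x a T) a c"
        unfolding boundary_degree_def by (intro arg_cong[where f = card]) (auto simp: climb_insert)
    qed
    finally show ?thesis .
  qed
  have "card ?P \<le> card (?Q \<union> ?R)"
  proof (rule card_inj_on_le[where f = "\<lambda>(T, e). (T - {e}, e)"])
    show "inj_on (\<lambda>(T, e). (T - {e}, e)) ?P" by (auto simp: inj_on_def)
    show "finite (?Q \<union> ?R)" by (intro finite_UnI finite_SigmaI) auto
    show "(\<lambda>(T, e). (T - {e}, e)) ` ?P \<subseteq> ?Q \<union> ?R"
    proof (rule image_subsetI)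
      fix p assume "p \<in> ?P"
      then obtain T e where pe: "p = (T, e)" and T: "T \<in> subsets_of_card ?S (l + 1)" "f (climb x a T) \<noteq> f x" "e \<in> T"
        by blast
      have T': "T - {e} \<in> subsets_of_card ?S l" "e \<in> ?S - (T - {e})" "insert e (T - {e}) = T"
        using T(1,3) finT[OF T(1)] unfolding subsets_of_card_def by auto
      show "(\<lambda>(T, e). (T - {e}, e)) p \<in> ?Q \<union> ?R"
      proof (cases "f (climb x a (T - {e})) = f x")
        case True
        then have "f (climb x a (T - {e})) \<noteq> f (climb x a (insert e (T - {e})))" using T(2) T'(3) by simp
        then have "(T - {e}, e) \<in> ?R" using T'(1,2) by blast
        then show ?thesis unfolding pe by simp
      next
        case False
        then have "(T - {e}, e) \<in> ?Q" using T'(1,2) by blast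
        then show ?thesis unfolding pe by simp
      qed
    qed
  qed
  also have "\<dots> \<le> card ?Q + card ?R" by (rule card_Un_le)
  finally show ?thesis unfolding cP cQ cR .
qed

text \<open>A union bound over the steps: the \<open>j\<close>-th summand is the probability that a
  step from a random point at height \<open>j\<close> crosses the boundary. It follows from
  \<open>flips_Suc\<close> through
  \<open>(l + 1) * (s choose (l + 1)) = (s choose l) * (s - l)\<close>.\<close>

lemma flips_fraction_le:
  assumes "l \<le> card (up_coords n d x a c)"
  shows "real (flips n d f x a c l) / real (card (up_coords n d x a c) choose l)
    \<le> (\<Sum>j<l. (\<Sum>T\<in>subsets_of_card (up_coords n d x a c) j. real (boundary_degree n d f (climb x a T) a c))
          / (real (card (up_coords n d x a c) choose j) * real (card (up_coords n d x a c) - j)))"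
  using assms
proof (induction l)
  case 0
  have "subsets_of_card S 0 = {{}}" if "finite S" for S
    using that unfolding subsets_of_card_def by (auto dest: finite_subset)
  then have "{T\<in>subsets_of_card (up_coords n d x a c) 0. f (climb x a T) \<noteq> f x} = {}"
    by (auto simp: climb_def)
  then show ?case by (simp add: flips_def)
next
  case (Suc l)
  let ?s = "card (up_coords n d x a c)"
  let ?b = "\<Sum>T\<in>subsets_of_card (up_coords n d x a c) l. real (boundary_degree n d f (climb x a T) a c)"
  have s: "0 < real (?s - l)" "0 < real (?s choose l)" using Suc.prems by auto
  have C: "real (Suc l) * real (?s choose Suc l) = real (?s choose l) * real (?s - l)"
    unfolding of_nat_mult[symmetric] by (metis binomial_absorb_comp mult.commute Suc_times_binomial_eq binomial_absorption diff_Suc_1)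
  have "real (Suc l) * real (flips n d f x a c (Suc l)) \<le> real (?s - l) * real (flips n d f x a c l) + ?b"
    using flips_Suc[of l n d f x a c] unfolding of_nat_mult[symmetric] of_nat_sum[symmetric] of_nat_add[symmetric] of_nat_le_iff
    by simp
  then have "real (Suc l) * real (flips n d f x a c (Suc l)) / (real (?s choose l) * real (?s - l))
      \<le> (real (?s - l) * real (flips n d f x a c l) + ?b) / (real (?s choose l) * real (?s - l))"
    using s by (intro divide_right_mono) auto
  also have "\<dots> = real (flips n d f x a c l) / real (?s choose l) + ?b / (real (?s choose l) * real (?s - l))"
    using s by (simp add: add_divide_distrib)
  also have "real (Suc l) * real (flips n d f x a c (Suc l)) / (real (?s choose l) * real (?s - l))
      = real (flips n d f x a c (Suc l)) / real (?s choose Suc l)"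
    unfolding C[symmetric] by (simp del: of_nat_Suc binomial_Suc_Suc)
  finally show ?case using Suc by simp
qed

text \<open>The quotient of the two binomials is compared factor by factor; each of the
  \<open>j\<close> factors is at most \<open>1 + \<rho>\<close>, which is at most
  \<open>exp \<rho>\<close>.\<close>

lemma binomial_le_pow:
  assumes "j \<le> s" and "0 \<le> \<rho>" and "real u \<le> (1 + \<rho>) * real (s - j)"
  shows "real (u choose j) \<le> exp (\<rho> * real j) * real (s choose j)"
proof (cases "j \<le> u")
  case True
  have "real (u choose j) = (\<Prod>i = 0..<j. real (u - i) / real (j - i))"
    using True by (rule binomial_altdef_of_nat)
  also have "\<dots> \<le> (\<Prod>i = 0..<j. (1 + \<rho>) * (real (s - i) / real (j - i)))"
  proof (rule prod_mono, intro conjI)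
    fix i assume i: "i \<in> {0..<j}"
    have "real (u - i) \<le> real u" by simp
    also have "\<dots> \<le> (1 + \<rho>) * real (s - j)" by (rule assms(3))
    also have "\<dots> \<le> (1 + \<rho>) * real (s - i)" using i assms(2) by (intro mult_left_mono) auto
    finally show "real (u - i) / real (j - i) \<le> (1 + \<rho>) * (real (s - i) / real (j - i))"
      by (simp add: divide_right_mono)
  qed simp
  also have "\<dots> = (1 + \<rho>) ^ j * (\<Prod>i = 0..<j. real (s - i) / real (j - i))"
    by (simp only: prod.distrib prod_constant card_atLeastLessThan diff_zero)
  also have "(\<Prod>i = 0..<j. real (s - i) / real (j - i)) = real (s choose j)"
    using assms(1) by (rule binomial_altdef_of_nat[symmetric])
  also have "(1 + \<rho>) ^ j \<le> exp \<rho> ^ j" using assms(2) by (intro power_mono) auto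
  also have "exp \<rho> ^ j = exp (\<rho> * real j)" by (simp add: exp_of_nat2_mult)
  finally show ?thesis by (simp add: mult_right_mono)
qed (simp add: binomial_eq_0)

text \<open>The expected number of up coordinates is at least \<open>d / 4\<close>, so
  \<open>d / 8\<close> is a safe lower bound. The second condition keeps the number of walks
  arriving at a point comparable to the number of walks leaving it.\<close>

definition typical :: "nat \<Rightarrow> nat \<Rightarrow> real \<Rightarrow> point \<Rightarrow> (nat \<Rightarrow> nat) \<Rightarrow> (nat \<Rightarrow> nat) \<Rightarrow> bool" where
  "typical n d \<kappa> x a c \<longleftrightarrow> real d / 8 \<le> real (card (up_coords n d x a c)) \<and>
     real (card (down_coords n d x a c)) \<le> real (card (up_coords n d x a c)) + \<kappa>"

text \<open>
  Changing variables from \<open>(x, T)\<close> to the end point \<open>w = climb x a T\<close> of the walk: on typical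
  points the walk from a uniform point is uniform up to a constant factor.
\<close>

lemma sum_typical_boundary_le:
  assumes \<kappa>: "0 \<le> \<kappa>" and j: "real j \<le> real d / 40" and jl: "real j * (\<kappa> + 2 * real j) \<le> 3 / 2 * real d" and d: "0 < d"
  shows "(\<Sum>x\<in>{x\<in>hypergrid n d. typical n d \<kappa> x a c}.
            (\<Sum>T\<in>subsets_of_card (up_coords n d x a c) j. real (boundary_degree n d f (climb x a T) a c))
              / (real (card (up_coords n d x a c) choose j) * real (card (up_coords n d x a c) - j)))
         \<le> exp 15 * (10 / real d) * (\<Sum>w\<in>hypergrid n d. real (boundary_degree n d f w a c))"
proof -
  let ?up = "\<lambda>x. up_coords n d x a c" and ?dn = "\<lambda>x. down_coords n d x a c"
    and ?\<phi> = "\<lambda>w. real (boundary_degree n d f w a c)"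
  let ?X = "{x\<in>hypergrid n d. typical n d \<kappa> x a c}"
  \<comment> \<open>The weight of a walk expressed through its end point \<open>w\<close>. The
    conditions are those of \<open>typical\<close> at the start, weakened: \<open>j\<close> up
    coordinates have been spent and at most \<open>j\<close> down coordinates gained.\<close>
  define H where "H w = (if real d / 8 \<le> real (card (?up w) + j) \<and> real (card (?dn w)) \<le> real (card (?up w)) + \<kappa> + 2 * real j
      then ?\<phi> w / (real ((card (?up w) + j) choose j) * real (card (?up w))) else 0)" for w
  have H0: "0 \<le> H w" for w unfolding H_def by simp
  let ?P = "SIGMA x:?X. subsets_of_card (?up x) j" and ?Q = "SIGMA w:hypergrid n d. subsets_of_card (?dn w) j"
  let ?m = "\<lambda>(x, T). (climb x a T, T)"
  have PD: "x \<in> hypergrid n d" "typical n d \<kappa> x a c" "T \<subseteq> ?up x" "card T = j" "finite T"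
    if "(x, T) \<in> ?P" for x T
    using that unfolding subsets_of_card_def by (auto intro: finite_subset[OF _ finite_up_coords])
  have "(\<Sum>x\<in>?X. (\<Sum>T\<in>subsets_of_card (?up x) j. ?\<phi> (climb x a T)) / (real (card (?up x) choose j) * real (card (?up x) - j)))
      = (\<Sum>(x, T)\<in>?P. ?\<phi> (climb x a T) / (real (card (?up x) choose j) * real (card (?up x) - j)))"
    by (subst sum.Sigma[symmetric]) (auto simp: sum_divide_distrib)
  also have "\<dots> = (\<Sum>p\<in>?P. H (fst (?m p)))"
  proof (rule sum.cong[OF refl])
    fix p assume pP: "p \<in> ?P"
    obtain x T where pe: "p = (x, T)" by (cases p)
    note P = PD[OF pP[unfolded pe]]
    have "card (?up (climb x a T)) = card (?up x) - j"
      using P by (simp add: up_coords_climb card_Diff_subset)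
    moreover have "j \<le> card (?up x)" using P card_mono[of "?up x" T] by simp
    ultimately have u: "card (?up (climb x a T)) + j = card (?up x)" by simp
    have "card (?dn (climb x a T)) \<le> card (?dn x \<union> T)"
      using down_coords_climb[OF P(1,3)] P(5) by (intro card_mono) auto
    also have "\<dots> \<le> card (?dn x) + j" using card_Un_le[of "?dn x" T] P(4) by simp
    finally have "real (card (?dn (climb x a T))) \<le> real (card (?dn x)) + real j" by linarith
    moreover have "real (card (?dn x)) \<le> real (card (?up (climb x a T)) + j) + \<kappa>" "real d / 8 \<le> real (card (?up x))"
      using P(2) unfolding u typical_def by auto
    ultimately have "H (climb x a T) = ?\<phi> (climb x a T) / (real (card (?up x) choose j) * real (card (?up x) - j))"
      unfolding H_def u by (subst if_P) (auto simp flip: u)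
    then show "(case p of (x, T) \<Rightarrow> ?\<phi> (climb x a T) / (real (card (?up x) choose j) * real (card (?up x) - j)))
        = H (fst (?m p))"
      unfolding pe by simp
  qed
  also have "\<dots> = (\<Sum>p\<in>?m ` ?P. H (fst p))"
  proof (rule sum.reindex[symmetric, unfolded o_def])
    show "inj_on ?m ?P"
    proof (rule inj_onI)
      fix p p' assume eq: "?m p = ?m p'"
      obtain x T where pe: "p = (x, T)" by (cases p)
      obtain y T' where pe': "p' = (y, T')" by (cases p')
      have T: "T' = T" and "climb x a T = climb y a T" using eq unfolding pe pe' by auto
      then have "climb x a T i = climb y a T i" for i by simp
      then have "x i = y i" for i unfolding climb_def by (metis add_right_cancel)
      then show "p = p'" unfolding pe pe' T by blast
    qed
  qed
  \<comment> \<open>A walk arriving at \<open>w\<close> has climbed a subset of the down coordinates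
    of \<open>w\<close>; admitting all such subsets of size \<open>j\<close> only adds nonnegative
    terms.\<close>
  also have "\<dots> \<le> (\<Sum>p\<in>?Q. H (fst p))"
  proof (rule sum_mono2)
    show "finite ?Q" by (intro finite_SigmaI) auto
    show "?m ` ?P \<subseteq> ?Q"
    proof (rule image_subsetI)
      fix p assume pP: "p \<in> ?P"
      obtain x T where pe: "p = (x, T)" by (cases p)
      note P = PD[OF pP[unfolded pe]]
      show "?m p \<in> ?Q"
        using climb_hypergrid[OF P(1,3)] down_coords_climb[OF P(1,3)] P(4) unfolding pe subsets_of_card_def by auto
    qed
  qed (use H0 in auto)
  also have "\<dots> = (\<Sum>w\<in>hypergrid n d. real (card (?dn w) choose j) * H w)"
    by (subst sum.Sigma[symmetric, of _ _ "\<lambda>w T. H w", unfolded case_prod_beta]) (auto simp: card_subsets_of_card)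
  also have "\<dots> \<le> (\<Sum>w\<in>hypergrid n d. exp 15 * (10 / real d) * ?\<phi> w)"
  proof (rule sum_mono)
    fix w assume "w \<in> hypergrid n d"
    show "real (card (?dn w) choose j) * H w \<le> exp 15 * (10 / real d) * ?\<phi> w"
    proof (cases "real d / 8 \<le> real (card (?up w) + j) \<and> real (card (?dn w)) \<le> real (card (?up w)) + \<kappa> + 2 * real j")
      case True
      define s where "s = card (?up w)"
      \<comment> \<open>Here \<open>1 / 10 = 1 / 8 - 1 / 40\<close>; the exponent \<open>15\<close>
        below is \<open>3 / 2\<close> divided by this \<open>1 / 10\<close>.\<close>
      have s: "real d / 10 \<le> real s" using True j unfolding s_def by simp
      then have s0: "0 < real s" using d by (metis divide_pos_pos less_le_trans of_nat_0_less_iff zero_less_numeral)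
      define \<rho> where "\<rho> = (\<kappa> + 2 * real j) / real s"
      have \<rho>0: "0 \<le> \<rho>" unfolding \<rho>_def using \<kappa> by simp
      have "real (card (?dn w)) \<le> (1 + \<rho>) * real (s + j - j)"
      proof -
        have "\<rho> * real s = \<kappa> + 2 * real j" unfolding \<rho>_def using s0 by simp
        then show ?thesis using True unfolding s_def by (simp add: distrib_right)
      qed
      then have "real (card (?dn w) choose j) \<le> exp (\<rho> * real j) * real ((s + j) choose j)"
        by (intro binomial_le_pow \<rho>0) auto
      also have "exp (\<rho> * real j) \<le> exp 15"
      proof -
        have "\<rho> * real j = real j * (\<kappa> + 2 * real j) / real s" unfolding \<rho>_def by simp
        also have "\<dots> \<le> (3 / 2 * real d) / real s" using jl s0 by (intro divide_right_mono) auto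
        also have "\<dots> \<le> 15" using s s0 by (simp add: divide_le_eq)
        finally show ?thesis by simp
      qed
      finally have C: "real (card (?dn w) choose j) \<le> exp 15 * real ((s + j) choose j)"
        by (simp add: mult_right_mono)
      have C0: "0 < real ((s + j) choose j)" by simp
      have "real (card (?dn w) choose j) * H w
          = real (card (?dn w) choose j) * (?\<phi> w / (real ((s + j) choose j) * real s))"
        using True unfolding H_def s_def by simp
      also have "\<dots> \<le> (exp 15 * real ((s + j) choose j)) * (?\<phi> w / (real ((s + j) choose j) * real s))"
        using C by (intro mult_right_mono) auto
      also have "\<dots> = exp 15 * (1 / real s) * ?\<phi> w" using C0 by simp
      also have "\<dots> \<le> exp 15 * (10 / real d) * ?\<phi> w"
      proof -
        have "1 / real s \<le> 10 / real d" using s s0 d by (simp add: field_simps)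
        then show ?thesis by (intro mult_right_mono mult_left_mono) auto
      qed
      finally show ?thesis .
    next
      case False
      then show ?thesis unfolding H_def by (auto simp: d)
    qed
  qed
  finally show ?thesis by (simp only: sum_distrib_left)
qed

text \<open>Every bichromatic edge is present with probability \<open>1 / (2 * k)\<close>, by
  \<open>sum_choices_edge\<close>.\<close>

lemma sum_boundary_degree:
  "2 * real k * (\<Sum>(a, c)\<in>choices d k. \<Sum>w\<in>hypergrid n d. real (boundary_degree n d f w a c))
     = real (card (choices d k)) * real (total_influence n d k f)"
proof -
  let ?b = "\<lambda>w i a c. of_bool (lower_end n (w i) (a i) (c i) \<and> f w \<noteq> f (w(i := w i + 2 ^ a i))) :: real"
  have deg: "real (boundary_degree n d f w a c) = (\<Sum>i\<in>{1..d}. ?b w i a c)" for w a c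
    unfolding boundary_degree_def up_coords_def climb_singleton by (simp add: Int_def conj_ac)
  have "(\<Sum>(a, c)\<in>choices d k. \<Sum>w\<in>hypergrid n d. real (boundary_degree n d f w a c))
      = (\<Sum>w\<in>hypergrid n d. \<Sum>i\<in>{1..d}. \<Sum>(a, c)\<in>choices d k. ?b w i a c)"
    unfolding deg case_prod_beta by (subst sum.swap, intro sum.cong refl, subst sum.swap) (rule refl)
  then have "2 * real k * (\<Sum>(a, c)\<in>choices d k. \<Sum>w\<in>hypergrid n d. real (boundary_degree n d f w a c))
      = (\<Sum>w\<in>hypergrid n d. \<Sum>i\<in>{1..d}. 2 * real k * (\<Sum>(a, c)\<in>choices d k. ?b w i a c))"
    by (simp only: sum_distrib_left)
  also have "\<dots> = (\<Sum>w\<in>hypergrid n d. \<Sum>i\<in>{1..d}. real (card (choices d k))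
      * (\<Sum>\<alpha><k. of_bool (w i + 2 ^ \<alpha> \<le> n \<and> f w \<noteq> f (w(i := w i + 2 ^ \<alpha>)))))"
    by (intro sum.cong refl sum_choices_edge)
  also have "\<dots> = real (card (choices d k)) * (\<Sum>w\<in>hypergrid n d. \<Sum>i\<in>{1..d}. \<Sum>\<alpha><k.
      of_bool (w i + 2 ^ \<alpha> \<le> n \<and> f w \<noteq> f (w(i := w i + 2 ^ \<alpha>))))"
    by (simp only: sum_distrib_left)
  also have "(\<Sum>w\<in>hypergrid n d. \<Sum>i\<in>{1..d}. \<Sum>\<alpha><k. of_bool (w i + 2 ^ \<alpha> \<le> n \<and> f w \<noteq> f (w(i := w i + 2 ^ \<alpha>))))
      = (\<Sum>i\<in>{1..d}. \<Sum>\<alpha><k. \<Sum>w\<in>hypergrid n d. of_bool (w i + 2 ^ \<alpha> \<le> n \<and> f w \<noteq> f (w(i := w i + 2 ^ \<alpha>))) :: real)"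
    by (subst sum.swap, intro sum.cong refl, subst sum.swap) (rule refl)
  also have "\<dots> = real (total_influence n d k f)"
    unfolding total_influence_def bichromatic_def of_nat_sum
    by (intro sum.cong refl) (simp add: Int_def)
  finally show ?thesis .
qed

lemma sum_typical_flips_le:
  assumes \<kappa>: "0 \<le> \<kappa>" and l: "real l \<le> real d / 40" and jl: "real l * (\<kappa> + 2 * real l) \<le> 3 / 2 * real d" and d: "0 < d"
  shows "2 * real k * (\<Sum>(a, c)\<in>choices d k. \<Sum>x\<in>{x\<in>hypergrid n d. typical n d \<kappa> x a c}.
            real (flips n d f x a c l) / real (card (up_coords n d x a c) choose l))
         \<le> real l * (exp 15 * (10 / real d)) * (real (card (choices d k)) * real (total_influence n d k f))"
proof -
  let ?X = "\<lambda>a c. {x\<in>hypergrid n d. typical n d \<kappa> x a c}" and ?A = "exp 15 * (10 / real d)"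
  define b where "b x a c j = (\<Sum>T\<in>subsets_of_card (up_coords n d x a c) j. real (boundary_degree n d f (climb x a T) a c))
      / (real (card (up_coords n d x a c) choose j) * real (card (up_coords n d x a c) - j))" for x a c j
  define B where "B a c = (\<Sum>w\<in>hypergrid n d. real (boundary_degree n d f w a c))" for a c
  have one: "(\<Sum>x\<in>?X a c. real (flips n d f x a c l) / real (card (up_coords n d x a c) choose l)) \<le> real l * (?A * B a c)" for a c
  proof -
    have "(\<Sum>x\<in>?X a c. real (flips n d f x a c l) / real (card (up_coords n d x a c) choose l)) \<le> (\<Sum>x\<in>?X a c. \<Sum>j<l. b x a c j)"
    proof (rule sum_mono)
      fix x assume "x \<in> ?X a c"
      then have "real l \<le> real (card (up_coords n d x a c))" using l unfolding typical_def by simp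
      then show "real (flips n d f x a c l) / real (card (up_coords n d x a c) choose l) \<le> (\<Sum>j<l. b x a c j)"
        unfolding b_def by (intro flips_fraction_le) simp
    qed
    also have "\<dots> = (\<Sum>j<l. \<Sum>x\<in>?X a c. b x a c j)" by (rule sum.swap)
    also have "\<dots> \<le> (\<Sum>j<l. ?A * B a c)"
    proof (rule sum_mono)
      fix j assume "j \<in> {..<l}"
      then have j: "real j \<le> real l" by simp
      have "real j * (\<kappa> + 2 * real j) \<le> real l * (\<kappa> + 2 * real l)"
        using j \<kappa> by (intro mult_mono) auto
      then show "(\<Sum>x\<in>?X a c. b x a c j) \<le> ?A * B a c"
        unfolding b_def B_def using j l jl by (intro sum_typical_boundary_le \<kappa> d) auto
    qed
    finally show ?thesis by simp
  qed
  have "2 * real k * (\<Sum>(a, c)\<in>choices d k. \<Sum>x\<in>?X a c. real (flips n d f x a c l) / real (card (up_coords n d x a c) choose l))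
      \<le> 2 * real k * (\<Sum>(a, c)\<in>choices d k. real l * (?A * B a c))"
    using one by (intro mult_left_mono sum_mono) (auto simp: case_prod_beta)
  also have "\<dots> = real l * ?A * (2 * real k * (\<Sum>(a, c)\<in>choices d k. B a c))"
    unfolding case_prod_beta by (simp only: sum_distrib_left mult_ac)
  also have "2 * real k * (\<Sum>(a, c)\<in>choices d k. B a c) = real (card (choices d k)) * real (total_influence n d k f)"
    unfolding B_def by (rule sum_boundary_degree)
  finally show ?thesis .
qed

section \<open>Detection by walks through a violated edge\<close>

definition hits :: "nat \<Rightarrow> nat \<Rightarrow> (point \<Rightarrow> bool) \<Rightarrow> point \<Rightarrow> (nat \<Rightarrow> nat) \<Rightarrow> (nat \<Rightarrow> nat) \<Rightarrow> nat \<Rightarrow> nat" where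
  "hits n d f x a c m = card {T\<in>subsets_of_card (up_coords n d x a c) m. f x \<and> \<not> f (climb x a T)}"

text \<open>
  If fewer than \<open>m\<close> coordinates are available then the division by zero gives \<open>0\<close>, in accordance
  with the tester, which then stays at \<open>x\<close>. The same applies to \<open>falls\<close> below.
\<close>

definition detection :: "nat \<Rightarrow> nat \<Rightarrow> (point \<Rightarrow> bool) \<Rightarrow> point \<Rightarrow> (nat \<Rightarrow> nat) \<Rightarrow> (nat \<Rightarrow> nat) \<Rightarrow> nat \<Rightarrow> real" where
  "detection n d f x a c m = real (hits n d f x a c m) / real (card (up_coords n d x a c) choose m)"

text \<open>The chance that \<open>l\<close> further steps from \<open>v\<close> end at the value
  \<open>False\<close>. Direction \<open>i\<close> is excluded so that this does not depend on
  \<open>a i\<close> and \<open>c i\<close>, hence is independent of the event that a given edge in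
  direction \<open>i\<close> is selected.\<close>

definition falls :: "nat \<Rightarrow> nat \<Rightarrow> (point \<Rightarrow> bool) \<Rightarrow> nat \<Rightarrow> nat \<Rightarrow> point \<Rightarrow> (nat \<Rightarrow> nat) \<Rightarrow> (nat \<Rightarrow> nat) \<Rightarrow> real" where
  "falls n d f i l v a c = real (card {T\<in>subsets_of_card (up_coords n d v a c - {i}) l. \<not> f (climb v a T)})
     / real (card (up_coords n d v a c - {i}) choose l)"

lemma detection_nonneg: "0 \<le> detection n d f x a c m"
  unfolding detection_def by simp

text \<open>The set \<open>T\<close> contains \<open>i\<close> with probability
  \<open>(l + 1) / card S\<close>, which is at least \<open>(l + 1) / d\<close>. Given this, the
  walk from \<open>u\<close> is the step to \<open>v\<close> followed by a uniform walk of
  \<open>l\<close> steps in the other directions.\<close>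

lemma detection_ge_falls:
  assumes i: "i \<in> {1..d}" and f: "f u" and low: "lower_end n (u i) (a i) (c i)" and v: "v = u(i := u i + 2 ^ a i)"
  shows "real (l + 1) / real d * falls n d f i l v a c \<le> detection n d f u a c (l + 1)"
proof -
  let ?S = "up_coords n d u a c"
  have iS: "i \<in> ?S" using i low unfolding up_coords_def by simp
  have K: "up_coords n d v a c - {i} = ?S - {i}" unfolding v up_coords_def by auto
  obtain s where s: "card ?S = Suc s" using iS by (metis card_Suc_Diff1 finite_up_coords)
  have cK: "card (?S - {i}) = s" using iS s by simp
  define m where "m = card {T\<in>subsets_of_card (?S - {i}) l. \<not> f (climb v a T)}"
  have "m \<le> hits n d f u a c (l + 1)"
    unfolding m_def hits_def
  proof (rule card_inj_on_le[where f = "insert i"])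
    show "inj_on (insert i) {T\<in>subsets_of_card (?S - {i}) l. \<not> f (climb v a T)}"
      by (rule inj_onI) (auto simp: subsets_of_card_def)
    show "insert i ` {T\<in>subsets_of_card (?S - {i}) l. \<not> f (climb v a T)}
        \<subseteq> {T\<in>subsets_of_card ?S (l + 1). f u \<and> \<not> f (climb u a T)}"
    proof (rule image_subsetI)
      fix T assume T: "T \<in> {T\<in>subsets_of_card (?S - {i}) l. \<not> f (climb v a T)}"
      then have T1: "T \<subseteq> ?S - {i}" "card T = l" unfolding subsets_of_card_def by auto
      have "finite T" using T1(1) by (rule finite_subset) simp
      then have "insert i T \<in> subsets_of_card ?S (l + 1)"
        using T1 iS unfolding subsets_of_card_def by (auto simp: card_insert_if)
      moreover have "climb v a T = climb u a (insert i T)" using T1(1) unfolding v climb_def by (auto simp: fun_eq_iff)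
      ultimately show "insert i T \<in> {T\<in>subsets_of_card ?S (l + 1). f u \<and> \<not> f (climb u a T)}" using f T by simp
    qed
  qed simp
  then have mh: "real m \<le> real (hits n d f u a c (l + 1))" by simp
  have sd: "real (Suc s) \<le> real d" using card_up_coords_le[of n d u a c] s by simp
  have C: "real (Suc s choose Suc l) * real (Suc l) = real (Suc s) * real (s choose l)"
    unfolding of_nat_mult[symmetric] by (simp only: Suc_times_binomial_eq)
  show ?thesis
  proof (cases "l \<le> s")
    case False
    then have "falls n d f i l v a c = 0" unfolding falls_def K cK by (simp add: binomial_eq_0)
    then show ?thesis using detection_nonneg by simp
  next
    case True
    then have C0: "0 < real (s choose l)" "0 < real (Suc s choose Suc l)" by (simp_all del: binomial_Suc_Suc)
    have "real (l + 1) / real d * falls n d f i l v a c = real (Suc l) / real d * (real m / real (s choose l))"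
      unfolding falls_def K cK m_def by simp
    also have "\<dots> \<le> real (Suc l) / real (Suc s) * (real m / real (s choose l))"
      using sd by (intro mult_right_mono divide_left_mono) auto
    also have "\<dots> = real m / real (Suc s choose Suc l)"
      using C C0 by (simp add: field_simps del: binomial_Suc_Suc of_nat_Suc)
    also have "\<dots> \<le> real (hits n d f u a c (l + 1)) / real (Suc s choose Suc l)"
      using mh by (intro divide_right_mono) auto
    finally show ?thesis unfolding detection_def s by simp
  qed
qed

lemma falls_ge:
  assumes fv: "\<not> f v" and typical: "typical n d \<kappa> v a c" and l: "real l \<le> real d / 40" and d: "0 < d"
  shows "1 - 2 * (real (flips n d f v a c l) / real (card (up_coords n d v a c) choose l)) \<le> falls n d f i l v a c"
proof -
  let ?S = "up_coords n d v a c" and ?K = "up_coords n d v a c - {i}"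
  let ?s = "card ?S"
  have s: "real d / 8 \<le> real ?s" using typical unfolding typical_def by simp
  have s0: "0 < ?s" using s d by (metis divide_pos_pos less_le_trans of_nat_0_less_iff zero_less_numeral)
  have ls: "2 * l \<le> ?s" using s l by linarith
  have CS: "0 < real (?s choose l)" using ls by simp
  \<comment> \<open>Excluding \<open>i\<close> costs at most a factor \<open>2\<close>, because
    \<open>l\<close> is at most half the number of up coordinates.\<close>
  have CK: "real (?s choose l) \<le> 2 * real (card ?K choose l)"
  proof (cases "i \<in> ?S")
    case True
    then have cK: "card ?K = ?s - 1" by simp
    have "real (?s - l) * real (?s choose l) = real ?s * real (card ?K choose l)"
      unfolding cK of_nat_mult[symmetric] by (simp only: binomial_absorb_comp)
    moreover have "real ?s * real (?s choose l) \<le> 2 * (real (?s - l) * real (?s choose l))"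
    proof -
      have "real ?s \<le> 2 * real (?s - l)" using ls by simp
      then have "real ?s * real (?s choose l) \<le> (2 * real (?s - l)) * real (?s choose l)" by (intro mult_right_mono) auto
      then show ?thesis by simp
    qed
    ultimately have "real ?s * real (?s choose l) \<le> real ?s * (2 * real (card ?K choose l))" by simp
    then show ?thesis using s0 by simp
  qed simp
  then have CK0: "0 < real (card ?K choose l)" using CS by linarith
  let ?bad = "{T\<in>subsets_of_card ?K l. f (climb v a T)}" and ?good = "{T\<in>subsets_of_card ?K l. \<not> f (climb v a T)}"
  have "card ?bad \<le> flips n d f v a c l"
    unfolding flips_def using fv by (intro card_mono) (auto simp: subsets_of_card_def[of ?K] subsets_of_card_def[of ?S])
  moreover have "card ?good + card ?bad = card ?K choose l"
  proof -
    have "card ?good + card ?bad = card (?good \<union> ?bad)" by (rule card_Un_disjoint[symmetric]) auto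
    also have "?good \<union> ?bad = subsets_of_card ?K l" by auto
    finally show ?thesis by (simp add: card_subsets_of_card)
  qed
  ultimately have "real (card ?K choose l) \<le> real (card ?good) + real (flips n d f v a c l)" by linarith
  then have "1 \<le> (real (card ?good) + real (flips n d f v a c l)) / real (card ?K choose l)"
    using CK0 by simp
  also have "\<dots> = falls n d f i l v a c + real (flips n d f v a c l) / real (card ?K choose l)"
    unfolding falls_def by (simp add: add_divide_distrib)
  also have "real (flips n d f v a c l) / real (card ?K choose l) \<le> 2 * (real (flips n d f v a c l) / real (?s choose l))"
  proof -
    have "real (flips n d f v a c l) * real (?s choose l) \<le> real (flips n d f v a c l) * (2 * real (card ?K choose l))"
      using CK by (intro mult_left_mono) auto
    then show ?thesis using CS CK0 by (simp add: field_simps)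
  qed
  finally show ?thesis by simp
qed

lemma falls_upd: "falls n d f i l v (a(i := \<alpha>)) (c(i := \<gamma>)) = falls n d f i l v a c"
proof -
  have K: "up_coords n d v (a(i := \<alpha>)) (c(i := \<gamma>)) - {i} = up_coords n d v a c - {i}" unfolding up_coords_def by auto
  have "climb v (a(i := \<alpha>)) T = climb v a T" if "T \<in> subsets_of_card (up_coords n d v a c - {i}) l" for T
    using that unfolding subsets_of_card_def climb_def by (auto simp: fun_eq_iff)
  then have "{T\<in>subsets_of_card (up_coords n d v a c - {i}) l. \<not> f (climb v (a(i := \<alpha>)) T)}
      = {T\<in>subsets_of_card (up_coords n d v a c - {i}) l. \<not> f (climb v a T)}" by auto
  then show ?thesis unfolding falls_def K by simp
qed

text \<open>Edges with distinct lower ends contribute to the detection at distinct starting points.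
  Distinct upper ends ensure that every atypical point and every flip probability is charged to at
  most one edge, so the losses are bounded by sums over the whole grid.\<close>

lemma sum_detection_ge:
  assumes E: "E \<subseteq> violating_edges n d k f" and inj: "inj_on fst E" "inj_on upper_endpoint E"
    and l: "real l \<le> real d / 40" and d: "0 < d"
  shows "real (card E) * real (card (choices d k))
      - (\<Sum>(a, c)\<in>choices d k. real (card {x\<in>hypergrid n d. \<not> typical n d \<kappa> x a c}))
      - 2 * (\<Sum>(a, c)\<in>choices d k. \<Sum>x\<in>{x\<in>hypergrid n d. typical n d \<kappa> x a c}.
            real (flips n d f x a c l) / real (card (up_coords n d x a c) choose l))
    \<le> 2 * real k * real d / real (l + 1) * (\<Sum>(a, c)\<in>choices d k. \<Sum>x\<in>hypergrid n d. detection n d f x a c (l + 1))"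
proof -
  let ?\<Omega> = "choices d k" and ?G = "hypergrid n d"
  define q where "q x a c = real (flips n d f x a c l) / real (card (up_coords n d x a c) choose l)" for x a c
  define low where "low e = fst e" for e :: "point \<times> nat \<times> nat"
  define dir where "dir e = fst (snd e)" for e :: "point \<times> nat \<times> nat"
  define scl where "scl e = snd (snd e)" for e :: "point \<times> nat \<times> nat"
  \<comment> \<open>The class whose matching at this scale contains the edge
    \<open>e\<close>.\<close>
  define cls where "cls e = (if low e (dir e) mod 2 ^ (scl e + 1) < 2 ^ scl e then 0 else 1 :: nat)" for e
  have e: "low e \<in> ?G" "dir e \<in> {1..d}" "scl e < k" "f (low e)" "\<not> f (upper_endpoint e)"
    "low e (dir e) + 2 ^ scl e \<le> n" "upper_endpoint e = (low e)(dir e := low e (dir e) + 2 ^ scl e)" if "e \<in> E" for e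
  proof -
    have "e \<in> violating_edges n d k f" using that E by blast
    then show "low e \<in> ?G" "dir e \<in> {1..d}" "scl e < k" "f (low e)" "\<not> f (upper_endpoint e)"
      "low e (dir e) + 2 ^ scl e \<le> n" "upper_endpoint e = (low e)(dir e := low e (dir e) + 2 ^ scl e)"
      unfolding violating_edges_def violations_def low_def dir_def scl_def upper_endpoint_def by auto
  qed
  have upG: "upper_endpoint e \<in> ?G" if "e \<in> E" for e
  proof -
    have "1 \<le> low e (dir e) + 2 ^ scl e" by (simp add: Suc_le_eq)
    then show ?thesis
      unfolding e(7)[OF that] using e(1,2,6)[OF that] by (intro hypergrid_upd) auto
  qed
  have lowcls: "lower_end n (low e (dir e)) (scl e) (cls e)" if "e \<in> E" for e
    using e(6)[OF that] unfolding lower_end_def cls_def by auto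
  let ?I = "\<lambda>e a c. of_bool (a (dir e) = scl e \<and> c (dir e) = cls e) :: real"
  let ?F = "\<lambda>e a c. falls n d f (dir e) l (upper_endpoint e) a c"
  have step1: "real (l + 1) / real d * (\<Sum>e\<in>E. ?I e a c * ?F e a c) \<le> (\<Sum>x\<in>?G. detection n d f x a c (l + 1))" for a c
  proof -
    have "real (l + 1) / real d * (\<Sum>e\<in>E. ?I e a c * ?F e a c) = (\<Sum>e\<in>E. ?I e a c * (real (l + 1) / real d * ?F e a c))"
      by (simp only: sum_distrib_left mult_ac)
    also have "\<dots> \<le> (\<Sum>e\<in>E. detection n d f (low e) a c (l + 1))"
    proof (rule sum_mono)
      fix e assume eE: "e \<in> E"
      show "?I e a c * (real (l + 1) / real d * ?F e a c) \<le> detection n d f (low e) a c (l + 1)"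
      proof (cases "a (dir e) = scl e \<and> c (dir e) = cls e")
        case True
        then have "real (l + 1) / real d * ?F e a c \<le> detection n d f (low e) a c (l + 1)"
          using e[OF eE] lowcls[OF eE] by (intro detection_ge_falls) auto
        then show ?thesis using True by simp
      next
        case False
        then have "?I e a c = 0" by (simp only: of_bool_eq_0_iff not_False_eq_True)
        then show ?thesis by (simp only: mult_zero_left detection_nonneg)
      qed
    qed
    also have "\<dots> = (\<Sum>x\<in>fst ` E. detection n d f x a c (l + 1))"
      unfolding low_def using inj(1) by (simp add: sum.reindex o_def)
    also have "\<dots> \<le> (\<Sum>x\<in>?G. detection n d f x a c (l + 1))"
      using e(1) detection_nonneg unfolding low_def by (intro sum_mono2) auto
    finally show ?thesis .
  qed
  have step2: "(\<Sum>(a, c)\<in>?\<Omega>. \<Sum>e\<in>E. ?F e a c) = 2 * real k * (\<Sum>(a, c)\<in>?\<Omega>. \<Sum>e\<in>E. ?I e a c * ?F e a c)"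
  proof -
    have "2 * real k * (\<Sum>(a, c)\<in>?\<Omega>. \<Sum>e\<in>E. ?I e a c * ?F e a c)
        = 2 * real k * (\<Sum>e\<in>E. \<Sum>(a, c)\<in>?\<Omega>. ?I e a c * ?F e a c)"
      unfolding case_prod_beta by (subst sum.swap) (rule refl)
    also have "\<dots> = (\<Sum>e\<in>E. 2 * real k * (\<Sum>(a, c)\<in>?\<Omega>. ?I e a c * ?F e a c))" by (rule sum_distrib_left)
    also have "\<dots> = (\<Sum>e\<in>E. \<Sum>(a, c)\<in>?\<Omega>. ?F e a c)"
      using e(2,3) by (intro sum.cong refl sum_choices_coord falls_upd) (auto simp: cls_def)
    also have "\<dots> = (\<Sum>(a, c)\<in>?\<Omega>. \<Sum>e\<in>E. ?F e a c)"
      unfolding case_prod_beta by (rule sum.swap)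
    finally show ?thesis by simp
  qed
  \<comment> \<open>At an atypical upper end the whole contribution \<open>1\<close> is given up; at
    a typical one \<open>falls_ge\<close> applies.\<close>
  have step3: "real (card E) - real (card {x\<in>?G. \<not> typical n d \<kappa> x a c}) - 2 * (\<Sum>x\<in>{x\<in>?G. typical n d \<kappa> x a c}. q x a c)
      \<le> (\<Sum>e\<in>E. ?F e a c)" for a c
  proof -
    let ?g = "\<lambda>x. of_bool (\<not> typical n d \<kappa> x a c) + 2 * (of_bool (typical n d \<kappa> x a c) * q x a c)"
    have q0: "0 \<le> q x a c" for x unfolding q_def by simp
    have "(\<Sum>e\<in>E. 1 - ?g (upper_endpoint e)) \<le> (\<Sum>e\<in>E. ?F e a c)"
    proof (rule sum_mono)
      fix e assume eE: "e \<in> E"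
      show "1 - ?g (upper_endpoint e) \<le> ?F e a c"
      proof (cases "typical n d \<kappa> (upper_endpoint e) a c")
        case True
        then have "1 - 2 * q (upper_endpoint e) a c \<le> ?F e a c"
          unfolding q_def using e(5)[OF eE] l d by (intro falls_ge) auto
        then show ?thesis using True by simp
      next
        case False
        then show ?thesis unfolding falls_def by simp
      qed
    qed
    moreover have "(\<Sum>e\<in>E. ?g (upper_endpoint e)) \<le> (\<Sum>x\<in>?G. ?g x)"
    proof -
      have "(\<Sum>e\<in>E. ?g (upper_endpoint e)) = (\<Sum>x\<in>upper_endpoint ` E. ?g x)"
        using inj(2) by (simp add: sum.reindex o_def)
      also have "\<dots> \<le> (\<Sum>x\<in>?G. ?g x)"
        using upG q0 by (intro sum_mono2) auto
      finally show ?thesis .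
    qed
    moreover have "(\<Sum>x\<in>?G. ?g x) = real (card {x\<in>?G. \<not> typical n d \<kappa> x a c}) + 2 * (\<Sum>x\<in>{x\<in>?G. typical n d \<kappa> x a c}. q x a c)"
    proof -
      have "(\<Sum>x\<in>?G. of_bool (typical n d \<kappa> x a c) * q x a c) = (\<Sum>x\<in>{x\<in>?G. typical n d \<kappa> x a c}. q x a c)"
        by (rule sum.mono_neutral_cong_right) auto
      moreover have "(\<Sum>x\<in>?G. of_bool (\<not> typical n d \<kappa> x a c)) = real (card {x\<in>?G. \<not> typical n d \<kappa> x a c})"
        by (simp add: Int_def)
      ultimately show ?thesis by (simp only: sum.distrib sum_distrib_left[symmetric])
    qed
    ultimately show ?thesis by (simp add: sum_subtractf)
  qed
  have "real (card E) * real (card ?\<Omega>) - (\<Sum>(a, c)\<in>?\<Omega>. real (card {x\<in>?G. \<not> typical n d \<kappa> x a c}))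
      - 2 * (\<Sum>(a, c)\<in>?\<Omega>. \<Sum>x\<in>{x\<in>?G. typical n d \<kappa> x a c}. q x a c)
      = (\<Sum>(a, c)\<in>?\<Omega>. real (card E) - real (card {x\<in>?G. \<not> typical n d \<kappa> x a c}) - 2 * (\<Sum>x\<in>{x\<in>?G. typical n d \<kappa> x a c}. q x a c))"
    unfolding case_prod_beta by (simp add: sum_subtractf sum_distrib_left mult.commute)
  also have "\<dots> \<le> (\<Sum>(a, c)\<in>?\<Omega>. \<Sum>e\<in>E. ?F e a c)"
    using step3 by (intro sum_mono) (auto simp: case_prod_beta)
  also have "\<dots> = 2 * real k * (\<Sum>(a, c)\<in>?\<Omega>. \<Sum>e\<in>E. ?I e a c * ?F e a c)" by (rule step2)
  also have "\<dots> = 2 * real k * real d / real (l + 1) * (\<Sum>(a, c)\<in>?\<Omega>. real (l + 1) / real d * (\<Sum>e\<in>E. ?I e a c * ?F e a c))"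
  proof -
    have "(\<Sum>(a, c)\<in>?\<Omega>. real (l + 1) / real d * (\<Sum>e\<in>E. ?I e a c * ?F e a c))
        = real (l + 1) / real d * (\<Sum>(a, c)\<in>?\<Omega>. \<Sum>e\<in>E. ?I e a c * ?F e a c)"
      unfolding case_prod_beta by (rule sum_distrib_left[symmetric])
    then show ?thesis using d by simp
  qed
  also have "\<dots> \<le> 2 * real k * real d / real (l + 1) * (\<Sum>(a, c)\<in>?\<Omega>. \<Sum>x\<in>?G. detection n d f x a c (l + 1))"
    using step1 by (intro mult_left_mono sum_mono) (auto simp: case_prod_beta)
  finally show ?thesis unfolding q_def .
qed

text \<open>A walk of one step uses a uniform up coordinate, so every violated edge selected at
  \<open>x\<close> is used with probability at least \<open>1 / d\<close>.\<close>

lemma sum_detection_one_ge: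
  "real (card (choices d k)) * real (total_violations n d k f)
    \<le> 2 * real k * real d * (\<Sum>(a, c)\<in>choices d k. \<Sum>x\<in>hypergrid n d. detection n d f x a c 1)"
proof (cases "d = 0")
  case False
  let ?b = "\<lambda>x i a c. of_bool (lower_end n (x i) (a i) (c i) \<and> f x \<and> \<not> f (x(i := x i + 2 ^ a i))) :: real"
  have det: "(\<Sum>i\<in>{1..d}. ?b x i a c) \<le> real d * detection n d f x a c 1" for x a c
  proof -
    let ?S = "up_coords n d x a c"
    have "(\<Sum>i\<in>{1..d}. ?b x i a c) = real (card {i\<in>?S. f x \<and> \<not> f (climb x a {i})})"
      unfolding up_coords_def climb_singleton by (simp add: Int_def conj_ac)
    also have "{T\<in>subsets_of_card ?S 1. f x \<and> \<not> f (climb x a T)} = (\<lambda>i. {i}) ` {i\<in>?S. f x \<and> \<not> f (climb x a {i})}"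
      unfolding subsets_of_card_def by (auto simp: card_1_singleton_iff)
    then have "card {i\<in>?S. f x \<and> \<not> f (climb x a {i})} = hits n d f x a c 1"
      unfolding hits_def by (simp add: card_image)
    finally have eq: "(\<Sum>i\<in>{1..d}. ?b x i a c) = real (hits n d f x a c 1)" .
    show ?thesis
    proof (cases "card ?S = 0")
      case True
      then have "subsets_of_card ?S 1 = {}" unfolding subsets_of_card_def by (auto simp: card_1_singleton_iff)
      then have "hits n d f x a c 1 = 0" unfolding hits_def by simp
      then show ?thesis unfolding eq detection_def by simp
    next
      case False
      then have s: "0 < real (card ?S)" by linarith
      have "real (hits n d f x a c 1) = real (card ?S) * detection n d f x a c 1"
        using s by (auto simp: detection_def)
      also have "\<dots> \<le> real d * detection n d f x a c 1"
        using card_up_coords_le[of n d x a c] detection_nonneg by (intro mult_right_mono) auto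
      finally show ?thesis unfolding eq .
    qed
  qed
  have "real (card (choices d k)) * real (total_violations n d k f)
      = real (card (choices d k)) * (\<Sum>x\<in>hypergrid n d. \<Sum>i\<in>{1..d}. \<Sum>\<alpha><k. of_bool (x i + 2 ^ \<alpha> \<le> n \<and> f x \<and> \<not> f (x(i := x i + 2 ^ \<alpha>))))"
  proof -
    have "real (total_violations n d k f)
        = (\<Sum>i\<in>{1..d}. \<Sum>\<alpha><k. \<Sum>x\<in>hypergrid n d. of_bool (x i + 2 ^ \<alpha> \<le> n \<and> f x \<and> \<not> f (x(i := x i + 2 ^ \<alpha>))))"
      unfolding total_violations_def violations_def of_nat_sum by (intro sum.cong refl) (simp add: Int_def)
    also have "\<dots> = (\<Sum>i\<in>{1..d}. \<Sum>x\<in>hypergrid n d. \<Sum>\<alpha><k. of_bool (x i + 2 ^ \<alpha> \<le> n \<and> f x \<and> \<not> f (x(i := x i + 2 ^ \<alpha>))))"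
      by (intro sum.cong refl sum.swap)
    also have "\<dots> = (\<Sum>x\<in>hypergrid n d. \<Sum>i\<in>{1..d}. \<Sum>\<alpha><k. of_bool (x i + 2 ^ \<alpha> \<le> n \<and> f x \<and> \<not> f (x(i := x i + 2 ^ \<alpha>))))"
      by (rule sum.swap)
    finally show ?thesis by simp
  qed
  also have "\<dots> = (\<Sum>x\<in>hypergrid n d. \<Sum>i\<in>{1..d}. real (card (choices d k)) *
      (\<Sum>\<alpha><k. of_bool (x i + 2 ^ \<alpha> \<le> n \<and> f x \<and> \<not> f (x(i := x i + 2 ^ \<alpha>)))))"
    by (simp only: sum_distrib_left)
  also have "\<dots> = (\<Sum>x\<in>hypergrid n d. \<Sum>i\<in>{1..d}. 2 * real k * (\<Sum>(a, c)\<in>choices d k. ?b x i a c))"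
  proof (intro sum.cong refl)
    fix x i assume i: "i \<in> {1..d}"
    show "real (card (choices d k)) * (\<Sum>\<alpha><k. of_bool (x i + 2 ^ \<alpha> \<le> n \<and> f x \<and> \<not> f (x(i := x i + 2 ^ \<alpha>))))
        = 2 * real k * (\<Sum>(a, c)\<in>choices d k. ?b x i a c)"
      by (rule sum_choices_edge[OF i, symmetric, where Q = "\<lambda>\<alpha>. f x \<and> \<not> f (x(i := x i + 2 ^ \<alpha>))"])
  qed
  also have "\<dots> = 2 * real k * (\<Sum>x\<in>hypergrid n d. \<Sum>i\<in>{1..d}. \<Sum>(a, c)\<in>choices d k. ?b x i a c)"
    by (simp only: sum_distrib_left)
  also have "(\<Sum>x\<in>hypergrid n d. \<Sum>i\<in>{1..d}. \<Sum>(a, c)\<in>choices d k. ?b x i a c)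
      = (\<Sum>(a, c)\<in>choices d k. \<Sum>x\<in>hypergrid n d. \<Sum>i\<in>{1..d}. ?b x i a c)"
  proof -
    have "(\<Sum>x\<in>hypergrid n d. \<Sum>i\<in>{1..d}. \<Sum>(a, c)\<in>choices d k. ?b x i a c)
        = (\<Sum>x\<in>hypergrid n d. \<Sum>(a, c)\<in>choices d k. \<Sum>i\<in>{1..d}. ?b x i a c)"
      unfolding case_prod_beta by (intro sum.cong refl sum.swap)
    also have "\<dots> = (\<Sum>(a, c)\<in>choices d k. \<Sum>x\<in>hypergrid n d. \<Sum>i\<in>{1..d}. ?b x i a c)"
      unfolding case_prod_beta by (rule sum.swap)
    finally show ?thesis .
  qed
  also have "2 * real k * \<dots> \<le> 2 * real k * (\<Sum>(a, c)\<in>choices d k. \<Sum>x\<in>hypergrid n d. real d * detection n d f x a c 1)"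
    using det by (intro mult_left_mono sum_mono) (auto simp: case_prod_beta intro!: sum_mono)
  also have "\<dots> = 2 * real k * real d * (\<Sum>(a, c)\<in>choices d k. \<Sum>x\<in>hypergrid n d. detection n d f x a c 1)"
    unfolding case_prod_beta by (simp only: sum_distrib_left mult_ac)
  finally show ?thesis .
qed (simp add: total_violations_def)

section \<open>Concentration\<close>

text \<open>The random state is a \<open>d\<close>-fold product of independent triples
  \<open>(x i, a i, c i)\<close>, so exponential moments factor over the coordinates.\<close>

lemma sum_prod_states:
  fixes \<phi> :: "nat \<Rightarrow> nat \<Rightarrow> nat \<Rightarrow> real"
  shows "(\<Sum>(a, c)\<in>choices d k. \<Sum>x\<in>hypergrid n d. \<Prod>i\<in>{1..d}. \<phi> (x i) (a i) (c i))
    = (\<Sum>(t, \<alpha>, \<gamma>)\<in>{1..n} \<times> {..<k} \<times> {0, 1}. \<phi> t \<alpha> \<gamma>) ^ d"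
proof -
  let ?B = "{1..n} \<times> {..<k} \<times> {0, 1::nat}"
  let ?\<psi> = "\<lambda>(t, \<alpha>, \<gamma>). \<phi> t \<alpha> \<gamma>"
  let ?to = "\<lambda>((a, c), x). restrict (\<lambda>i. (x i, a i, c i)) {1..d} :: nat \<Rightarrow> nat \<times> nat \<times> nat"
  let ?from = "\<lambda>g :: nat \<Rightarrow> nat \<times> nat \<times> nat. ((\<lambda>i. if i \<in> {1..d} then fst (snd (g i)) else 0, \<lambda>i. if i \<in> {1..d} then snd (snd (g i)) else 0),
      restrict (\<lambda>i. fst (g i)) {1..d})"
  have "(\<Sum>(a, c)\<in>choices d k. \<Sum>x\<in>hypergrid n d. \<Prod>i\<in>{1..d}. \<phi> (x i) (a i) (c i))
      = (\<Sum>p\<in>choices d k \<times> hypergrid n d. \<Prod>i\<in>{1..d}. ?\<psi> (?to p i))"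
    by (simp add: sum.cartesian_product case_prod_beta)
  also have "\<dots> = (\<Sum>g\<in>PiE {1..d} (\<lambda>_. ?B). \<Prod>i\<in>{1..d}. ?\<psi> (g i))"
  proof (rule sum.reindex_bij_witness[where i = ?from and j = ?to])
    fix p assume "p \<in> choices d k \<times> hypergrid n d"
    then obtain a c x where p: "p = ((a, c), x)" "(a, c) \<in> choices d k" "x \<in> hypergrid n d" by auto
    have ext: "x \<in> extensional {1..d}" using p(3) unfolding hypergrid_def PiE_def by simp
    have "(\<lambda>i. if i \<in> {1..d} then a i else 0) = a" "(\<lambda>i. if i \<in> {1..d} then c i else 0) = c"
      using p(2) unfolding mem_choices by (auto simp: fun_eq_iff)
    moreover have "restrict x {1..d} = x" using ext by (rule extensional_restrict)
    ultimately show "?from (?to p) = p" unfolding p(1) by (simp cong: if_cong restrict_cong)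
    show "?to p \<in> PiE {1..d} (\<lambda>_. ?B)"
    proof (rule PiE_I)
      fix i assume i: "i \<in> {1..d}"
      show "?to p i \<in> ?B" using i hypergrid_coord[OF p(3) i] p(2) unfolding p(1) mem_choices by auto
    qed (auto simp: p(1))
  next
    fix g assume g: "g \<in> PiE {1..d} (\<lambda>_. ?B)"
    have gi: "fst (g i) \<in> {1..n}" "fst (snd (g i)) < k" "snd (snd (g i)) \<in> {0, 1}" if "i \<in> {1..d}" for i
      using PiE_mem[OF g that] by (auto simp: mem_Times_iff)
    show "?from g \<in> choices d k \<times> hypergrid n d"
      using gi unfolding hypergrid_def by (auto simp: mem_choices)
    have "g \<in> extensional {1..d}" using g unfolding PiE_def by simp
    then show "?to (?from g) = g" by (auto simp: fun_eq_iff restrict_def extensional_def)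
  qed simp
  also have "\<dots> = (\<Prod>i\<in>{1..d}. \<Sum>s\<in>?B. ?\<psi> s)" by (rule prod_sum_PiE[symmetric]) auto
  finally show ?thesis by simp
qed

definition state_space :: "nat \<Rightarrow> nat \<Rightarrow> nat \<Rightarrow> real" where
  "state_space n d k = real (card (choices d k)) * real (n ^ d)"

lemma state_space_eq: "state_space n d k = (2 * real k * real n) ^ d"
proof -
  have "state_space n d k = (\<Sum>(a, c)\<in>choices d k. \<Sum>x\<in>hypergrid n d. \<Prod>i\<in>{1..d}. 1)"
    unfolding state_space_def by (simp add: card_hypergrid case_prod_beta)
  also have "\<dots> = (2 * real k * real n) ^ d"
    by (subst sum_prod_states) (simp add: card_cartesian_product case_prod_beta mult_ac)
  finally show ?thesis .
qed

definition edge_states :: "nat \<Rightarrow> nat \<Rightarrow> real" where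
  "edge_states n k = (\<Sum>(t, \<alpha>, \<gamma>)\<in>{1..n} \<times> {..<k} \<times> {0, 1}. of_bool (lower_end n t \<alpha> \<gamma>))"

lemma sum_lower_end:
  "(\<Sum>t\<in>{1..n}. \<Sum>\<alpha><k. \<Sum>\<gamma>\<in>{0, 1}. h t \<alpha> \<gamma>) = (\<Sum>(t, \<alpha>, \<gamma>)\<in>{1..n} \<times> {..<k} \<times> {0, 1}. h t \<alpha> \<gamma>)"
  by (simp only: sum.cartesian_product case_prod_beta' fst_conv snd_conv)

text \<open>At scale \<open>\<alpha>\<close> a line has \<open>n - 2 ^ \<alpha>\<close> edges,
  between \<open>n / 2\<close> and \<open>n\<close>. Out of the \<open>2 * k * n\<close> states of a
  coordinate, lower ends thus make up a share between \<open>1 / 4\<close> and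
  \<open>1 / 2\<close>.\<close>

lemma edge_states_bounds:
  assumes n: "n = 2 ^ k"
  shows "real k * real n / 2 \<le> edge_states n k" "edge_states n k \<le> real k * real n"
proof -
  have "edge_states n k = (\<Sum>t\<in>{1..n}. \<Sum>\<alpha><k. of_bool (t + 2 ^ \<alpha> \<le> n))"
    unfolding edge_states_def sum_lower_end[symmetric]
    by (intro sum.cong refl) (simp del: sum_of_bool_eq add: lower_end_def)
  also have "\<dots> = (\<Sum>\<alpha><k. \<Sum>t\<in>{1..n}. of_bool (t + 2 ^ \<alpha> \<le> n))" by (rule sum.swap)
  also have "\<dots> = (\<Sum>\<alpha><k. real (n - 2 ^ \<alpha>))"
  proof (rule sum.cong[OF refl])
    fix \<alpha> :: nat
    have "{1..n} \<inter> {t. t + 2 ^ \<alpha> \<le> n} = {1..n - 2 ^ \<alpha>}" by auto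
    then show "(\<Sum>t\<in>{1..n}. of_bool (t + 2 ^ \<alpha> \<le> n)) = real (n - 2 ^ \<alpha>)" by simp
  qed
  finally have eq: "edge_states n k = (\<Sum>\<alpha><k. real (n - 2 ^ \<alpha>))" .
  have "(\<Sum>\<alpha><k. real n / 2) \<le> (\<Sum>\<alpha><k. real (n - 2 ^ \<alpha>))"
  proof (rule sum_mono)
    fix \<alpha> assume "\<alpha> \<in> {..<k}"
    then have "2 ^ Suc \<alpha> \<le> (2 ^ k :: nat)" by (intro power_increasing) auto
    then have "2 * 2 ^ \<alpha> \<le> n" unfolding n by simp
    then have "n \<le> 2 * (n - 2 ^ \<alpha>)" by linarith
    then have "real n \<le> real (2 * (n - 2 ^ \<alpha>))" by (simp only: of_nat_le_iff)
    then show "real n / 2 \<le> real (n - 2 ^ \<alpha>)" by simp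
  qed
  then show "real k * real n / 2 \<le> edge_states n k" unfolding eq by simp
  have "(\<Sum>\<alpha><k. real (n - 2 ^ \<alpha>)) \<le> (\<Sum>\<alpha><k. real n)" by (intro sum_mono) simp
  then show "edge_states n k \<le> real k * real n" unfolding eq by simp
qed

lemma edge_states_nonneg: "0 \<le> edge_states n k"
  unfolding edge_states_def by (intro sum_nonneg) auto

lemma upper_states_eq:
  "(\<Sum>(t, \<alpha>, \<gamma>)\<in>{1..n} \<times> {..<k} \<times> {0, 1}. of_bool (upper_end n t \<alpha> \<gamma>)) = edge_states n k"
proof -
  let ?B = "{1..n} \<times> {..<k} \<times> {0, 1::nat}"
  have l: "edge_states n k = real (card {(t, \<alpha>, \<gamma>)\<in>?B. lower_end n t \<alpha> \<gamma>})"
    unfolding edge_states_def by (simp add: case_prod_beta' Int_def mem_Times_iff conj_ac)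
  have u: "(\<Sum>(t, \<alpha>, \<gamma>)\<in>?B. of_bool (upper_end n t \<alpha> \<gamma>)) = real (card {(t, \<alpha>, \<gamma>)\<in>?B. upper_end n t \<alpha> \<gamma>})"
    by (simp add: case_prod_beta' Int_def mem_Times_iff conj_ac)
  have "bij_betw (\<lambda>(t, \<alpha>, \<gamma>). (t + 2 ^ \<alpha>, \<alpha>, \<gamma>)) {(t, \<alpha>, \<gamma>)\<in>?B. lower_end n t \<alpha> \<gamma>} {(t, \<alpha>, \<gamma>)\<in>?B. upper_end n t \<alpha> \<gamma>}"
    by (rule bij_betw_byWitness[where f' = "\<lambda>(t, \<alpha>, \<gamma>). (t - 2 ^ \<alpha>, \<alpha>, \<gamma>)"])
      (auto simp: lower_end_def upper_end_def Suc_le_eq trans_less_add1)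
  from bij_betw_same_card[OF this] show ?thesis unfolding l u by simp
qed

lemma exp_le_quadratic:
  fixes \<theta> :: real
  assumes "0 \<le> \<theta>" "\<theta> \<le> 1"
  shows "exp \<theta> \<le> 1 + \<theta> + \<theta>\<^sup>2" and "exp (- \<theta>) \<le> 1 - \<theta> + \<theta>\<^sup>2"
proof -
  show "exp \<theta> \<le> 1 + \<theta> + \<theta>\<^sup>2" using assms by (rule exp_bound)
  have "(1 - \<theta> + \<theta>\<^sup>2) * (1 + \<theta> + \<theta>\<^sup>2 / 2) = 1 + \<theta>\<^sup>2 / 2 + \<theta> ^ 3 / 2 + \<theta> ^ 4 / 2"
    by (simp add: field_simps power2_eq_square power3_eq_cube power4_eq_xxxx)
  then have "1 \<le> (1 - \<theta> + \<theta>\<^sup>2) * (1 + \<theta> + \<theta>\<^sup>2 / 2)" using assms by simp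
  also have "\<dots> \<le> (1 - \<theta> + \<theta>\<^sup>2) * exp \<theta>"
    using assms by (intro mult_left_mono exp_lower_Taylor_quadratic) auto
  finally have "exp (- \<theta>) * 1 \<le> exp (- \<theta>) * ((1 - \<theta> + \<theta>\<^sup>2) * exp \<theta>)" by (intro mult_left_mono) auto
  also have "\<dots> = 1 - \<theta> + \<theta>\<^sup>2" by (simp add: exp_minus field_simps)
  finally show "exp (- \<theta>) \<le> 1 - \<theta> + \<theta>\<^sup>2" by simp
qed

lemma sum_choices_markov:
  assumes "\<And>x a c. Q x a c \<Longrightarrow> exp b \<le> exp (r x a c)"
    and "(\<Sum>(a, c)\<in>choices d k. \<Sum>x\<in>hypergrid n d. exp (r x a c)) \<le> W * exp m"
  shows "(\<Sum>(a, c)\<in>choices d k. real (card {x\<in>hypergrid n d. Q x a c})) \<le> W * exp (m - b)"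
proof -
  have "exp b * (\<Sum>(a, c)\<in>choices d k. real (card {x\<in>hypergrid n d. Q x a c}))
      = (\<Sum>(a, c)\<in>choices d k. \<Sum>x\<in>hypergrid n d. exp b * of_bool (Q x a c))"
    by (simp add: case_prod_beta sum_distrib_left[symmetric] Int_def)
  also have "\<dots> \<le> (\<Sum>(a, c)\<in>choices d k. \<Sum>x\<in>hypergrid n d. exp (r x a c))"
    using assms(1) by (auto intro!: sum_mono simp: case_prod_beta of_bool_def)
  also have "\<dots> \<le> W * exp m" by (rule assms(2))
  finally show ?thesis by (simp add: exp_diff field_simps)
qed

text \<open>A Chernoff bound. Upper and lower ends are equally frequent, so the linear terms of the
  moment generating function cancel and a Gaussian tail remains.\<close>

lemma down_minus_up_tail:
  assumes n: "n = 2 ^ k" and d: "0 < d" and \<kappa>: "0 \<le> \<kappa>" "\<kappa> \<le> 2 * real d"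
  shows "(\<Sum>(a, c)\<in>choices d k. real (card {x\<in>hypergrid n d. real (card (up_coords n d x a c)) + \<kappa> < real (card (down_coords n d x a c))}))
    \<le> state_space n d k * exp (- (\<kappa>\<^sup>2 / (4 * real d)))"
proof -
  \<comment> \<open>This value minimizes the exponent
    \<open>d * \<theta>\<^sup>2 - \<theta> * \<kappa>\<close>.\<close>
  define \<theta> where "\<theta> = \<kappa> / (2 * real d)"
  have \<theta>: "0 \<le> \<theta>" "\<theta> \<le> 1" unfolding \<theta>_def using \<kappa> d by auto
  let ?B = "{1..n} \<times> {..<k} \<times> {0, 1::nat}"
  let ?r = "\<lambda>x a c. \<theta> * (real (card (down_coords n d x a c)) - real (card (up_coords n d x a c)))"
  let ?\<phi> = "\<lambda>t \<alpha> \<gamma>. exp (\<theta> * (of_bool (upper_end n t \<alpha> \<gamma>) - of_bool (lower_end n t \<alpha> \<gamma>)))"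
  have "exp (?r x a c) = (\<Prod>i\<in>{1..d}. ?\<phi> (x i) (a i) (c i))" for x a c
  proof -
    have "?r x a c = (\<Sum>i\<in>{1..d}. \<theta> * (of_bool (upper_end n (x i) (a i) (c i)) - of_bool (lower_end n (x i) (a i) (c i))))"
      unfolding up_coords_def down_coords_def sum_distrib_left[symmetric] sum_subtractf by (simp add: Int_def)
    then show ?thesis by (simp only: exp_sum finite_atLeastAtMost)
  qed
  then have product: "(\<Sum>(a, c)\<in>choices d k. \<Sum>x\<in>hypergrid n d. exp (?r x a c)) = (\<Sum>(t, \<alpha>, \<gamma>)\<in>?B. ?\<phi> t \<alpha> \<gamma>) ^ d"
    by (simp only:) (rule sum_prod_states[where \<phi> = ?\<phi>])
  have "(\<Sum>(t, \<alpha>, \<gamma>)\<in>?B. ?\<phi> t \<alpha> \<gamma>)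
      = (\<Sum>(t, \<alpha>, \<gamma>)\<in>?B. 1 + (exp \<theta> - 1) * of_bool (upper_end n t \<alpha> \<gamma>) + (exp (- \<theta>) - 1) * of_bool (lower_end n t \<alpha> \<gamma>))"
  proof (rule sum.cong[OF refl])
    fix s assume "s \<in> ?B"
    obtain t \<alpha> \<gamma> where s: "s = (t, \<alpha>, \<gamma>)" by (cases s)
    have "upper_end n t \<alpha> \<gamma> \<Longrightarrow> \<not> lower_end n t \<alpha> \<gamma>"
      using lower_end_shift[of n "t - 2 ^ \<alpha>" \<alpha> \<gamma>] unfolding upper_end_def by auto
    then show "(case s of (t, \<alpha>, \<gamma>) \<Rightarrow> ?\<phi> t \<alpha> \<gamma>) = (case s of (t, \<alpha>, \<gamma>) \<Rightarrow>
        1 + (exp \<theta> - 1) * of_bool (upper_end n t \<alpha> \<gamma>) + (exp (- \<theta>) - 1) * of_bool (lower_end n t \<alpha> \<gamma>))"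
      unfolding s by auto
  qed
  also have "\<dots> = 2 * real k * real n + (exp \<theta> - 1) * edge_states n k + (exp (- \<theta>) - 1) * edge_states n k"
  proof -
    have "(\<Sum>(t, \<alpha>, \<gamma>)\<in>?B. 1 + (exp \<theta> - 1) * of_bool (upper_end n t \<alpha> \<gamma>) + (exp (- \<theta>) - 1) * of_bool (lower_end n t \<alpha> \<gamma>))
        = real (card ?B) + (exp \<theta> - 1) * (\<Sum>(t, \<alpha>, \<gamma>)\<in>?B. of_bool (upper_end n t \<alpha> \<gamma>))
          + (exp (- \<theta>) - 1) * (\<Sum>(t, \<alpha>, \<gamma>)\<in>?B. of_bool (lower_end n t \<alpha> \<gamma>))"
      by (simp only: case_prod_beta' sum.distrib sum_distrib_left[symmetric] sum_constant mult_1_right)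
    then show ?thesis unfolding upper_states_eq edge_states_def[symmetric] by (simp add: card_cartesian_product)
  qed
  also have "\<dots> = 2 * real k * real n + (exp \<theta> + exp (- \<theta>) - 2) * edge_states n k"
    by (simp add: algebra_simps)
  also have "\<dots> \<le> 2 * real k * real n + (2 * \<theta>\<^sup>2) * (real k * real n)"
  proof -
    have "exp \<theta> + exp (- \<theta>) - 2 \<le> 2 * \<theta>\<^sup>2" using exp_le_quadratic[OF \<theta>] by simp
    then show ?thesis
      using edge_states_bounds(2)[OF n] edge_states_nonneg by (intro add_left_mono mult_mono) auto
  qed
  also have "\<dots> = 2 * real k * real n * (1 + \<theta>\<^sup>2)" by (simp add: algebra_simps)
  also have "\<dots> \<le> 2 * real k * real n * exp (\<theta>\<^sup>2)" by (intro mult_left_mono) auto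
  finally have "(\<Sum>(a, c)\<in>choices d k. \<Sum>x\<in>hypergrid n d. exp (?r x a c)) \<le> (2 * real k * real n * exp (\<theta>\<^sup>2)) ^ d"
    unfolding product by (rule power_mono) (auto intro: sum_nonneg)
  also have "\<dots> = state_space n d k * exp (real d * \<theta>\<^sup>2)"
    unfolding state_space_eq by (simp add: power_mult_distrib exp_of_nat_mult)
  finally have "(\<Sum>(a, c)\<in>choices d k. real (card {x\<in>hypergrid n d. real (card (up_coords n d x a c)) + \<kappa> < real (card (down_coords n d x a c))}))
      \<le> state_space n d k * exp (real d * \<theta>\<^sup>2 - \<theta> * \<kappa>)"
    by (rule sum_choices_markov[rotated]) (use \<theta> in \<open>auto intro!: mult_left_mono\<close>)
  also have "real d * \<theta>\<^sup>2 - \<theta> * \<kappa> = - (\<kappa>\<^sup>2 / (4 * real d))"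
    unfolding \<theta>_def using d by (simp add: field_simps power2_eq_square)
  finally show ?thesis .
qed

lemma few_up_coords_tail:
  assumes n: "n = 2 ^ k"
  shows "(\<Sum>(a, c)\<in>choices d k. real (card {x\<in>hypergrid n d. real (card (up_coords n d x a c)) < real d / 8}))
    \<le> state_space n d k * exp (- (real d / 64))"
proof -
  let ?B = "{1..n} \<times> {..<k} \<times> {0, 1::nat}"
  \<comment> \<open>With the parameter \<open>1 / 4\<close> each coordinate contributes a factor of
    at most \<open>exp (- 3 / 64)\<close>: the gain is \<open>1 / 4 - 1 / 16 = 3 / 16\<close> on a
    share of at least \<open>1 / 4\<close> of the states. Against the level \<open>d / 8\<close>
    this leaves \<open>- 3 / 64 + 1 / 32 = - 1 / 64\<close> per coordinate.\<close>
  let ?r = "\<lambda>x a c. - (1 / 4) * real (card (up_coords n d x a c))"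
  let ?\<phi> = "\<lambda>t \<alpha> \<gamma>. exp (- (1 / 4) * of_bool (lower_end n t \<alpha> \<gamma>))"
  have "exp (?r x a c) = (\<Prod>i\<in>{1..d}. ?\<phi> (x i) (a i) (c i))" for x a c
  proof -
    have "?r x a c = (\<Sum>i\<in>{1..d}. - (1 / 4) * of_bool (lower_end n (x i) (a i) (c i)))"
      unfolding up_coords_def sum_distrib_left[symmetric] by (simp add: Int_def)
    then show ?thesis by (simp only: exp_sum finite_atLeastAtMost)
  qed
  then have product: "(\<Sum>(a, c)\<in>choices d k. \<Sum>x\<in>hypergrid n d. exp (?r x a c)) = (\<Sum>(t, \<alpha>, \<gamma>)\<in>?B. ?\<phi> t \<alpha> \<gamma>) ^ d"
    by (simp only:) (rule sum_prod_states[where \<phi> = ?\<phi>])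
  have "(\<Sum>(t, \<alpha>, \<gamma>)\<in>?B. ?\<phi> t \<alpha> \<gamma>) = (\<Sum>(t, \<alpha>, \<gamma>)\<in>?B. 1 + (exp (- (1 / 4)) - 1) * of_bool (lower_end n t \<alpha> \<gamma>))"
    by (intro sum.cong refl) auto
  also have "\<dots> = 2 * real k * real n + (exp (- (1 / 4)) - 1) * edge_states n k"
  proof -
    have "(\<Sum>(t, \<alpha>, \<gamma>)\<in>?B. 1 + (exp (- (1 / 4)) - 1) * of_bool (lower_end n t \<alpha> \<gamma>))
        = real (card ?B) + (exp (- (1 / 4)) - 1) * (\<Sum>(t, \<alpha>, \<gamma>)\<in>?B. of_bool (lower_end n t \<alpha> \<gamma>))"
      by (simp only: case_prod_beta' sum.distrib sum_distrib_left[symmetric] sum_constant mult_1_right)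
    then show ?thesis unfolding edge_states_def[symmetric] by (simp add: card_cartesian_product)
  qed
  also have "\<dots> \<le> 2 * real k * real n + (- (3 / 16)) * (real k * real n / 2)"
  proof -
    have "exp (- (1 / 4)) - 1 \<le> (- (3 / 16) :: real)"
      using exp_le_quadratic(2)[of "1 / 4"] by (simp add: power2_eq_square)
    then have "(exp (- (1 / 4)) - 1) * edge_states n k \<le> (- (3 / 16)) * edge_states n k"
      using edge_states_nonneg by (rule mult_right_mono)
    also have "\<dots> \<le> (- (3 / 16)) * (real k * real n / 2)"
      using edge_states_bounds(1)[OF n] by simp
    finally show ?thesis by simp
  qed
  also have "\<dots> = 2 * real k * real n * (1 + - (3 / 64))" by simp
  also have "\<dots> \<le> 2 * real k * real n * exp (- (3 / 64))" by (intro mult_left_mono exp_ge_add_one_self) auto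
  finally have "(\<Sum>(a, c)\<in>choices d k. \<Sum>x\<in>hypergrid n d. exp (?r x a c)) \<le> (2 * real k * real n * exp (- (3 / 64))) ^ d"
    unfolding product by (rule power_mono) (auto intro: sum_nonneg)
  also have "\<dots> = state_space n d k * exp (real d * - (3 / 64))"
    unfolding state_space_eq by (simp only: power_mult_distrib exp_of_nat_mult)
  finally have "(\<Sum>(a, c)\<in>choices d k. real (card {x\<in>hypergrid n d. real (card (up_coords n d x a c)) < real d / 8}))
      \<le> state_space n d k * exp (real d * - (3 / 64) - (- (real d / 32)))"
    by (rule sum_choices_markov[rotated]) auto
  also have "real d * - (3 / 64) - (- (real d / 32)) = - (real d / 64)" by simp
  finally show ?thesis .
qed

lemma nontypical_tail:
  assumes n: "n = 2 ^ k" and d: "0 < d" and \<kappa>: "0 \<le> \<kappa>" "\<kappa> \<le> 2 * real d"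
  shows "(\<Sum>(a, c)\<in>choices d k. real (card {x\<in>hypergrid n d. \<not> typical n d \<kappa> x a c}))
    \<le> state_space n d k * (exp (- (\<kappa>\<^sup>2 / (4 * real d))) + exp (- (real d / 64)))"
proof -
  let ?P = "\<lambda>a c. {x\<in>hypergrid n d. real (card (up_coords n d x a c)) + \<kappa> < real (card (down_coords n d x a c))}"
    and ?Q = "\<lambda>a c. {x\<in>hypergrid n d. real (card (up_coords n d x a c)) < real d / 8}"
  have "real (card {x\<in>hypergrid n d. \<not> typical n d \<kappa> x a c}) \<le> real (card (?P a c)) + real (card (?Q a c))" for a c
  proof -
    have "card {x\<in>hypergrid n d. \<not> typical n d \<kappa> x a c} \<le> card (?P a c \<union> ?Q a c)"
      by (intro card_mono) (auto simp: typical_def)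
    also have "\<dots> \<le> card (?P a c) + card (?Q a c)" by (rule card_Un_le)
    finally show ?thesis by linarith
  qed
  then have "(\<Sum>(a, c)\<in>choices d k. real (card {x\<in>hypergrid n d. \<not> typical n d \<kappa> x a c}))
      \<le> (\<Sum>(a, c)\<in>choices d k. real (card (?P a c)) + real (card (?Q a c)))"
    by (intro sum_mono) (auto simp: case_prod_beta)
  also have "\<dots> = (\<Sum>(a, c)\<in>choices d k. real (card (?P a c))) + (\<Sum>(a, c)\<in>choices d k. real (card (?Q a c)))"
    by (simp only: case_prod_beta' sum.distrib)
  also have "\<dots> \<le> state_space n d k * exp (- (\<kappa>\<^sup>2 / (4 * real d))) + state_space n d k * exp (- (real d / 64))"
    by (intro add_mono down_minus_up_tail[OF n d \<kappa>] few_up_coords_tail[OF n])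
  finally show ?thesis by (simp only: distrib_left)
qed

section \<open>The tester\<close>

lemma prob_bind_pmf_of_set:
  assumes "finite A" "A \<noteq> {}"
  shows "measure_pmf.prob (bind_pmf (pmf_of_set A) F) B = (\<Sum>x\<in>A. measure_pmf.prob (F x) B) / real (card A)"
proof -
  have "ennreal (measure_pmf.prob (bind_pmf (pmf_of_set A) F) B) = (\<integral>\<^sup>+x. emeasure (F x) B \<partial>pmf_of_set A)"
    by (simp add: measure_pmf.emeasure_eq_measure[symmetric])
  also have "\<dots> = (\<Sum>x\<in>A. ennreal (measure_pmf.prob (F x) B)) / ennreal (real (card A))"
    using assms by (simp add: nn_integral_pmf_of_set measure_pmf.emeasure_eq_measure ennreal_of_nat_eq_real_of_nat)
  also have "\<dots> = ennreal ((\<Sum>x\<in>A. measure_pmf.prob (F x) B) / real (card A))"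
    using assms by (simp add: divide_ennreal sum_nonneg card_gt_0_iff)
  finally show ?thesis by (simp add: sum_nonneg)
qed

lemma H_edges_iff_lower_end:
  assumes x: "x \<in> hypergrid n d" and i: "i \<in> {1..d}"
  shows "(\<exists>z. (x, z) \<in> H_edges n d c i a) \<longleftrightarrow> lower_end n (x i) a c"
proof
  assume "\<exists>z. (x, z) \<in> H_edges n d c i a"
  then obtain z where z: "z \<in> hypergrid n d" "int (z i) - int (x i) = 2 ^ a"
    "if c = 0 then x i mod 2 ^ (a + 1) < 2 ^ a else x i mod 2 ^ (a + 1) \<ge> 2 ^ a"
    unfolding H_edges_def by auto
  have "int (z i) = int (x i + 2 ^ a)" using z(2) by simp
  then have "z i = x i + 2 ^ a" by (simp only: of_nat_eq_iff)
  then show "lower_end n (x i) a c" using hypergrid_coord[OF z(1) i] z(3) unfolding lower_end_def by simp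
next
  assume l: "lower_end n (x i) a c"
  have "x i + 2 ^ a \<in> {1..n}" using l unfolding lower_end_def by (simp add: Suc_le_eq)
  then have "x(i := x i + 2 ^ a) \<in> hypergrid n d" using hypergrid_upd[OF x i] by blast
  then have "(x, x(i := x i + 2 ^ a)) \<in> H_edges n d c i a"
    using x l unfolding H_edges_def lower_end_def by (auto split: if_splits)
  then show "\<exists>z. (x, z) \<in> H_edges n d c i a" by blast
qed

definition violation_found :: "nat \<Rightarrow> nat \<Rightarrow> (point \<Rightarrow> bool) \<Rightarrow> (point \<times> point \<times> verdict) set" where
  "violation_found n d f = {(x, y, v). x \<in> hypergrid n d \<and> y \<in> hypergrid n d \<and> coord_le d x y \<and> f x > f y \<and> v = Reject}"

lemma prob_walk_ge_detection:
  assumes x: "x \<in> hypergrid n d"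
  shows "detection n d f x a c \<tau> \<le> measure_pmf.prob
    (do {
       y \<leftarrow> (if card (up_coords n d x a c) < \<tau> then return_pmf x
            else do {
              T \<leftarrow> pmf_of_set {T. T \<subseteq> up_coords n d x a c \<and> card T = \<tau>};
              return_pmf (\<lambda>i. if i \<in> T then x i + 2 ^ a i else x i)
            });
       return_pmf (x, y, if f x > f y then Reject else Accept)
     }) (violation_found n d f)"
proof (cases "card (up_coords n d x a c) < \<tau>")
  case True
  then have "detection n d f x a c \<tau> = 0" unfolding detection_def by (simp add: binomial_eq_0)
  then show ?thesis by simp
next
  case False
  let ?S = "up_coords n d x a c"
  let ?A = "subsets_of_card ?S \<tau>"
  have cA: "card ?A = card ?S choose \<tau>" by (rule card_subsets_of_card) simp
  have finA: "finite ?A" by simp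
  have "0 < card ?A" unfolding cA using False by simp
  then have neA: "?A \<noteq> {}" by auto
  let ?v = "\<lambda>T. (x, climb x a T, if f x > f (climb x a T) then Reject else Accept)"
  have ind: "indicator (violation_found n d f) (?v T) = (of_bool (f x \<and> \<not> f (climb x a T)) :: real)" if "T \<in> ?A" for T
  proof -
    have T: "T \<subseteq> ?S" using that unfolding subsets_of_card_def by simp
    have "coord_le d x (climb x a T)" unfolding coord_le_def climb_def by simp
    then show ?thesis using climb_hypergrid[OF x T] x unfolding violation_found_def by (auto simp: indicator_def)
  qed
  have "measure_pmf.prob (bind_pmf (pmf_of_set ?A) (\<lambda>T. return_pmf (?v T))) (violation_found n d f)
      = (\<Sum>T\<in>?A. indicator (violation_found n d f) (?v T)) / real (card ?A)"
    unfolding prob_bind_pmf_of_set[OF finA neA] by (simp add: measure_return_pmf)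
  also have "(\<Sum>T\<in>?A. indicator (violation_found n d f) (?v T)) = (\<Sum>T\<in>?A. of_bool (f x \<and> \<not> f (climb x a T)) :: real)"
    by (intro sum.cong refl ind)
  also have "\<dots> = real (hits n d f x a c \<tau>)" unfolding hits_def using finA by (simp add: Int_def)
  finally have "measure_pmf.prob (bind_pmf (pmf_of_set ?A) (\<lambda>T. return_pmf (?v T))) (violation_found n d f) = detection n d f x a c \<tau>"
    unfolding detection_def cA .
  then show ?thesis using False
    by (simp add: bind_assoc_pmf bind_return_pmf subsets_of_card_def climb_def)
qed

text \<open>Only the single value \<open>t\<close> among the \<open>max_exponent d + 1\<close>
  possible ones is retained; otherwise the tester is averaging over states.\<close>

lemma prob_tester_ge:
  assumes n: "n = 2 ^ k" and k: "0 < k" and t: "t \<le> max_exponent d"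
  shows "(\<Sum>(a, c)\<in>choices d k. \<Sum>x\<in>hypergrid n d. detection n d f x a c (2 ^ t)) / (real (max_exponent d + 1) * state_space n d k)
    \<le> measure_pmf.prob (tester n d f) (violation_found n d f)"
proof -
  let ?A = "PiE_dflt {1..d} 0 (\<lambda>_. {..<k})" and ?C = "PiE_dflt {1..d} 0 (\<lambda>_. {0, 1::nat})" and ?G = "hypergrid n d"
  let ?p = "max_exponent d" and ?B = "violation_found n d f"
  have log: "log 2 (real n) = real k" unfolding n by (simp add: log_nat_power)
  have exps: "{e::nat. real e \<le> log 2 (real n) - 1} = {..<k}"
  proof -
    have "real e \<le> real k - 1 \<longleftrightarrow> e < k" for e using k by linarith
    then show ?thesis unfolding log by auto
  qed
  have Apmf: "Pi_pmf {1..d} 0 (\<lambda>_. pmf_of_set {..<k}) = pmf_of_set ?A"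
    using k by (intro Pi_pmf_of_set) auto
  have Cpmf: "Pi_pmf {1..d} 0 (\<lambda>_. pmf_of_set {0, 1::nat}) = pmf_of_set ?C"
    by (intro Pi_pmf_of_set) auto
  have fin: "finite ?A" "finite ?C" by (intro finite_PiE_dflt; simp)+
  have "(\<lambda>_. 0) \<in> ?A" "(\<lambda>_. 0) \<in> ?C" using k by (auto simp: PiE_dflt_def)
  then have ne: "?A \<noteq> {}" "?C \<noteq> {}" by blast+
  have "0 < n" unfolding n by simp
  then have "card ?G \<noteq> 0" unfolding card_hypergrid by simp
  then have neG: "?G \<noteq> {}" by auto
  define walk where "walk t x a c =
    do {
       y \<leftarrow> (if card (up_coords n d x a c) < 2 ^ t then return_pmf x
            else do {
              T \<leftarrow> pmf_of_set {T. T \<subseteq> up_coords n d x a c \<and> card T = 2 ^ t};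
              return_pmf (\<lambda>i. if i \<in> T then x i + 2 ^ a i else x i)
            });
       return_pmf (x, y, if f x > f y then Reject else Accept)
     }" for t x a c
  define run where "run t = bind_pmf (pmf_of_set ?G) (\<lambda>x. bind_pmf (pmf_of_set ?A) (\<lambda>a. bind_pmf (pmf_of_set ?C) (\<lambda>c. walk t x a c)))" for t
  have S: "{i\<in>{1..d}. \<exists>z. (x, z) \<in> H_edges n d (c i) i (a i)} = up_coords n d x a c" if "x \<in> ?G" for x a c
    using H_edges_iff_lower_end[OF that] unfolding up_coords_def by blast
  have tester: "tester n d f = bind_pmf (pmf_of_set {0..?p}) run"
    unfolding tester_def exps Apmf Cpmf Let_def run_def
  proof (intro bind_pmf_cong refl)
    fix t x a c assume "x \<in> set_pmf (pmf_of_set ?G)"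
    then have "x \<in> ?G" using neG by simp
    from S[OF this] show "do {
       y \<leftarrow> (if card {i\<in>{1..d}. \<exists>z. (x, z) \<in> H_edges n d (c i) i (a i)} < 2 ^ t then return_pmf x
            else do {
              T \<leftarrow> pmf_of_set {T. T \<subseteq> {i\<in>{1..d}. \<exists>z. (x, z) \<in> H_edges n d (c i) i (a i)} \<and> card T = 2 ^ t};
              return_pmf (\<lambda>i. if i \<in> T then x i + 2 ^ a i else x i)
            });
       return_pmf (x, y, if f x > f y then Reject else Accept)
     } = walk t x a c" unfolding walk_def by simp
  qed
  have "(\<Sum>(a, c)\<in>choices d k. \<Sum>x\<in>?G. detection n d f x a c (2 ^ t)) / state_space n d k
      = (\<Sum>x\<in>?G. \<Sum>a\<in>?A. \<Sum>c\<in>?C. detection n d f x a c (2 ^ t)) / (real (card ?G) * real (card ?A) * real (card ?C))"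
  proof -
    have "(\<Sum>(a, c)\<in>choices d k. \<Sum>x\<in>?G. detection n d f x a c (2 ^ t))
        = (\<Sum>x\<in>?G. \<Sum>(a, c)\<in>choices d k. detection n d f x a c (2 ^ t))"
      unfolding case_prod_beta by (rule sum.swap)
    also have "\<dots> = (\<Sum>x\<in>?G. \<Sum>a\<in>?A. \<Sum>c\<in>?C. detection n d f x a c (2 ^ t))"
      unfolding choices_def by (simp only: sum.cartesian_product)
    finally show ?thesis unfolding state_space_def choices_def by (simp add: card_cartesian_product card_hypergrid mult_ac)
  qed
  also have "\<dots> \<le> (\<Sum>x\<in>?G. \<Sum>a\<in>?A. \<Sum>c\<in>?C. measure_pmf.prob (walk t x a c) ?B) / (real (card ?G) * real (card ?A) * real (card ?C))"
    unfolding walk_def by (intro divide_right_mono sum_mono prob_walk_ge_detection) auto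
  also have "\<dots> = measure_pmf.prob (run t) ?B"
    unfolding run_def prob_bind_pmf_of_set[OF finite_hypergrid neG] prob_bind_pmf_of_set[OF fin(1) ne(1)]
      prob_bind_pmf_of_set[OF fin(2) ne(2)]
    by (simp only: sum_divide_distrib[symmetric] divide_divide_eq_left mult_ac)
  finally have run: "(\<Sum>(a, c)\<in>choices d k. \<Sum>x\<in>?G. detection n d f x a c (2 ^ t)) / state_space n d k \<le> measure_pmf.prob (run t) ?B" .
  have "measure_pmf.prob (tester n d f) ?B = (\<Sum>t\<in>{0..?p}. measure_pmf.prob (run t) ?B) / real (?p + 1)"
    unfolding tester by (subst prob_bind_pmf_of_set) auto
  moreover have "measure_pmf.prob (run t) ?B \<le> (\<Sum>t\<in>{0..?p}. measure_pmf.prob (run t) ?B)"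
    using t by (intro member_le_sum) auto
  ultimately have "measure_pmf.prob (run t) ?B / real (?p + 1) \<le> measure_pmf.prob (tester n d f) ?B"
    by (simp add: divide_right_mono)
  moreover have "(\<Sum>(a, c)\<in>choices d k. \<Sum>x\<in>?G. detection n d f x a c (2 ^ t)) / state_space n d k / real (?p + 1)
      \<le> measure_pmf.prob (run t) ?B / real (?p + 1)"
    using run by (intro divide_right_mono) auto
  ultimately show ?thesis by (simp add: mult.commute divide_divide_eq_left del: of_nat_Suc of_nat_add)
qed

section \<open>The range of the step count\<close>

lemma scale_bound_ge_oneD:
  assumes "1 \<le> scale_bound d"
  shows "1 \<le> log 2 (real d)" "10 * log 2 (real d) \<le> real d" "0 < d"
proof -
  let ?D = "log 2 (real d)"
  have ge: "1 \<le> real d / (10 * ?D)" using assms unfolding scale_bound_def by simp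
  have D0: "0 < ?D"
  proof (rule ccontr)
    assume "\<not> 0 < ?D"
    then have "real d / (10 * ?D) \<le> 0" by (simp add: divide_nonneg_nonpos)
    then show False using ge by simp
  qed
  show "10 * ?D \<le> real d" using ge D0 by (simp add: le_divide_eq)
  show d0: "0 < d" using ge by (cases d) auto
  have "1 < real d" using D0 d0 by (simp add: zero_less_log_cancel_iff)
  then have "2 \<le> real d" by simp
  then show "1 \<le> ?D" using d0 by (simp add: le_log_iff)
qed

lemma max_exponent_props:
  assumes "1 \<le> scale_bound d"
  shows "2 ^ t \<le> scale_bound d \<Longrightarrow> t \<le> max_exponent d" "2 ^ max_exponent d \<le> scale_bound d"
proof -
  have b: "p \<le> nat \<lceil>scale_bound d\<rceil>" if "2 ^ p \<le> scale_bound d" for p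
  proof -
    have "real p < 2 ^ p" by (rule of_nat_less_two_power)
    then have "real p \<le> scale_bound d" using that by linarith
    then show ?thesis by linarith
  qed
  show "2 ^ t \<le> scale_bound d \<Longrightarrow> t \<le> max_exponent d"
    unfolding max_exponent_def using b by (rule Greatest_le_nat[rotated]) auto
  show "2 ^ max_exponent d \<le> scale_bound d"
    unfolding max_exponent_def using GreatestI_nat[of "\<lambda>p. 2 ^ p \<le> scale_bound d" 0 "nat \<lceil>scale_bound d\<rceil>"] assms b by simp
qed

text \<open>Since \<open>2 ^ p\<close> is at most \<open>sqrt d\<close>, the exponent is at most
  half the logarithm of \<open>d\<close>. The random choice of \<open>t\<close> therefore costs one
  logarithmic factor.\<close>

lemma max_exponent_le:
  assumes s: "1 \<le> scale_bound d"
  shows "real (max_exponent d + 1) \<le> 2 * log 2 (real d)"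
proof -
  let ?p = "max_exponent d" and ?D = "log 2 (real d)"
  note D = scale_bound_ge_oneD[OF s]
  have "(2 ^ ?p)\<^sup>2 \<le> (scale_bound d)\<^sup>2" using max_exponent_props(2)[OF s] by (intro power_mono) auto
  also have "\<dots> = real d / (10 * ?D)" unfolding scale_bound_def using D by simp
  also have "\<dots> \<le> real d / 1" using D(1) by (intro divide_left_mono) auto
  also have "\<dots> = real d" by simp
  finally have "2 ^ (2 * ?p) \<le> real d" by (simp add: power_mult[symmetric] mult.commute)
  moreover have "2 powr real (2 * ?p) = 2 ^ (2 * ?p)" by (rule powr_realpow) simp
  ultimately have "2 powr real (2 * ?p) \<le> real d" by simp
  then have "real (2 * ?p) \<le> ?D" using D(3) by (simp add: le_log_iff)
  then show ?thesis using D(1) by simp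
qed

section \<open>The rate\<close>

text \<open>
  The case analysis of the tester. Write \<open>R\<close> for the cube of the claimed rate. If many edges
  are violated or one of the parameters is extreme then single steps suffice (\<open>B1\<close>). Otherwise
  walks of length about \<open>min (\<Gamma> * sqrt d * k) (sqrt (d / D))\<close> are combined with single steps by
  weighted geometric means.
\<close>

lemma detection_rate_cube:
  fixes d D k \<epsilon> \<Phi> \<Gamma> P A :: real
  assumes d: "1 \<le> d" and D: "1 \<le> D" and dD: "10 * D \<le> d" and k: "1 \<le> k" and \<epsilon>: "0 < \<epsilon>" "\<epsilon> \<le> 1" and A: "2 \<le> A"
    and \<Phi>: "\<epsilon> \<le> 16 * \<Phi>" and \<Gamma>: "0 \<le> \<Gamma>" and margulis: "\<epsilon>\<^sup>2 \<le> 256 * k * \<Gamma> * \<Phi>"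
    and B1: "\<Phi> / (4 * d * k * D) \<le> P"
    and B2: "\<And>t::nat. 160 \<le> d \<Longrightarrow> 2 ^ t \<le> sqrt (d / (10 * D)) \<Longrightarrow>
        65 / d + 2 ^ t * (10 * A * (2 * \<Phi> + 4 * sqrt d)) / (d * k) \<le> \<Gamma> / 2 \<Longrightarrow>
        2 ^ t * \<Gamma> / (8 * d * k * D) \<le> P"
  shows "1 / (2 ^ 40 * A) * (\<epsilon> ^ 4 / (d\<^sup>2 * sqrt d * k ^ 4 * (D ^ 4 * sqrt D))) \<le> P ^ 3"
proof -
  let ?s = "sqrt d" and ?u = "sqrt D"
  let ?c = "1 / (2 ^ 40 * A)"
  let ?R = "\<epsilon> ^ 4 / (d\<^sup>2 * ?s * k ^ 4 * (D ^ 4 * ?u))"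
  have s1: "1 \<le> ?s" and u1: "1 \<le> ?u" using d D by simp_all
  have ss: "?s * ?s = d" using d by simp
  have \<Phi>0: "0 < \<Phi>" using \<Phi> \<epsilon> by simp
  have A0: "0 < A" using A by simp
  define b where "b = \<Phi> / (4 * d * k * D)"
  have b0: "0 \<le> b" unfolding b_def using \<Phi>0 d k D by simp
  have bP: "b \<le> P" using B1 unfolding b_def .
  have P0: "0 \<le> P" using b0 bP by simp
  have R_le: "?R \<le> \<epsilon> ^ 4 / (d\<^sup>2 * ?s * k ^ 4 * (D ^ 3 * ?u))"
  proof -
    have "D ^ 3 * ?u \<le> D ^ 4 * ?u" using D by (intro mult_right_mono power_increasing) auto
    then show ?thesis using d k D s1 u1 by (intro divide_left_mono mult_left_mono mult_pos_pos) auto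
  qed
  have R_le': "?R \<le> \<epsilon> ^ 4 / (d\<^sup>2 * ?s * k ^ 4 * D ^ 3)"
  proof -
    have "D ^ 3 * 1 \<le> D ^ 4 * ?u" using D u1 by (intro mult_mono power_increasing) auto
    then show ?thesis using d k D s1 u1 by (intro divide_left_mono mult_left_mono mult_pos_pos) auto
  qed
  \<comment> \<open>When the cube of the single-step rate \<open>b\<close> already dominates: after
    cancelling \<open>d ^ 3 * k ^ 4 * D ^ 3\<close> this is the comparison of
    \<open>\<epsilon> ^ 4 * sqrt d\<close> with \<open>\<Phi> ^ 3 * k\<close>.\<close>
  have easy: "?c * ?R \<le> P ^ 3" if c: "64 * ?c \<le> c" and ge: "c * \<epsilon> ^ 4 * ?s \<le> \<Phi> ^ 3 * k" for c
  proof -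
    have "0 \<le> 64 * ?c" using A0 by simp
    then have c0: "0 \<le> c" using c by linarith
    have "?c * ?R \<le> c / 64 * (\<epsilon> ^ 4 / (d\<^sup>2 * ?s * k ^ 4 * D ^ 3))"
      using c c0 R_le' A0 d k D \<epsilon> by (intro mult_mono) auto
    also have "\<dots> = (c * \<epsilon> ^ 4 * ?s) / (64 * d ^ 3 * k ^ 4 * D ^ 3)"
    proof -
      have "d ^ 3 = d\<^sup>2 * (?s * ?s)" unfolding ss by (simp add: power3_eq_cube power2_eq_square)
      then show ?thesis using d k D s1 by (simp add: field_simps)
    qed
    also have "\<dots> \<le> (\<Phi> ^ 3 * k) / (64 * d ^ 3 * k ^ 4 * D ^ 3)"
      using ge d k D by (intro divide_right_mono) auto
    also have "\<dots> = b ^ 3"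
      unfolding b_def using d k D by (simp add: power_divide power_mult_distrib field_simps eval_nat_numeral)
    also have "\<dots> \<le> P ^ 3" using bP b0 by (rule power_mono)
    finally show ?thesis .
  qed
  have \<Phi>3: "\<epsilon> ^ 4 / 4096 \<le> \<Phi> ^ 3"
  proof -
    have "\<epsilon> ^ 4 \<le> \<epsilon> ^ 3" using \<epsilon> by (intro power_decreasing) auto
    moreover have "(\<epsilon> / 16) ^ 3 \<le> \<Phi> ^ 3" using \<Phi> \<epsilon> by (intro power_mono) auto
    ultimately show ?thesis by (simp add: power_divide)
  qed
  have c_small: "64 * ?c \<le> 1 / (65536 * (240 * A))" using A0 by (simp add: field_simps)
  have c_small': "1 / (65536 * (240 * A)) \<le> 1 / 65536" using A0 A by (simp add: field_simps)
  show ?thesis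
  \<comment> \<open>The complement is what walks need: \<open>160 \<le> d\<close> is required by the
    walk bound, \<open>k < sqrt d\<close> makes the atypical share small against
    \<open>\<Gamma>\<close>, \<open>\<Phi> < sqrt d\<close> makes the influence per point at most
    \<open>6 * sqrt d\<close>, and the last condition admits at least one step.\<close>
  proof (cases "d < 160 \<or> ?s \<le> k \<or> ?s \<le> \<Phi> \<or> \<Gamma> * ?s * k < 240 * A")
    case True
    then consider "d < 160" | "?s \<le> k" | "?s \<le> \<Phi>" | "\<Gamma> * ?s * k < 240 * A" by blast
    then show ?thesis
    proof cases
      case 1
      have "?s \<le> 16" using 1 by (intro real_le_lsqrt) auto
      then have "1 / 65536 * \<epsilon> ^ 4 * ?s \<le> 1 / 65536 * \<epsilon> ^ 4 * 16" using \<epsilon> by (intro mult_left_mono) auto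
      also have "\<dots> \<le> \<Phi> ^ 3 * 1" using \<Phi>3 by simp
      also have "\<dots> \<le> \<Phi> ^ 3 * k" using \<Phi>0 k by (intro mult_left_mono) auto
      finally show ?thesis using c_small c_small' by (intro easy[of "1 / 65536"]) auto
    next
      case 2
      have "1 / 65536 * \<epsilon> ^ 4 * ?s \<le> \<epsilon> ^ 4 / 4096 * k" using 2 \<epsilon> s1 by (intro mult_mono) auto
      also have "\<dots> \<le> \<Phi> ^ 3 * k" using \<Phi>3 k by (intro mult_right_mono) auto
      finally show ?thesis using c_small c_small' by (intro easy[of "1 / 65536"]) auto
    next
      case 3
      have "1 / 65536 * \<epsilon> ^ 4 * ?s \<le> 1 * ?s"
        using \<epsilon> s1 power_le_one[of \<epsilon> 4] by (intro mult_right_mono) auto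
      also have "\<dots> \<le> \<Phi> * 1" using 3 by simp
      also have "\<dots> \<le> \<Phi> * \<Phi>\<^sup>2"
        using 3 s1 \<Phi>0 by (intro mult_left_mono one_le_power) linarith+
      also have "\<dots> = \<Phi> ^ 3 * 1" by (simp add: power2_eq_square power3_eq_cube)
      also have "\<dots> \<le> \<Phi> ^ 3 * k" using \<Phi>0 k by (intro mult_left_mono) auto
      finally show ?thesis using c_small c_small' by (intro easy[of "1 / 65536"]) auto
    next
      case 4
      have "\<epsilon>\<^sup>2 * ?s \<le> (256 * k * \<Gamma> * \<Phi>) * ?s" using margulis s1 by (intro mult_right_mono) auto
      also have "\<dots> = (256 * \<Phi>) * (\<Gamma> * ?s * k)" by (simp add: mult_ac)
      also have "\<dots> \<le> (256 * \<Phi>) * (240 * A)" using 4 \<Phi>0 by (intro mult_left_mono) auto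
      finally have 5: "\<epsilon>\<^sup>2 * ?s / (256 * (240 * A)) \<le> \<Phi>" using A0 by (simp add: divide_le_eq mult_ac)
      have "1 / (65536 * (240 * A)) * \<epsilon> ^ 4 * ?s = (\<epsilon> / 16)\<^sup>2 * (\<epsilon>\<^sup>2 * ?s / (256 * (240 * A)))"
        by (simp add: power_divide power4_eq_xxxx power2_eq_square)
      also have "\<dots> \<le> \<Phi>\<^sup>2 * \<Phi>" using 5 \<Phi> \<epsilon> s1 A0 by (intro mult_mono power_mono) auto
      also have "\<dots> = \<Phi> ^ 3 * 1" by (simp add: power2_eq_square power3_eq_cube)
      also have "\<dots> \<le> \<Phi> ^ 3 * k" using \<Phi>0 k by (intro mult_left_mono) auto
      finally show ?thesis by (intro easy[OF c_small])
    qed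
  next
    case False
    then have d160: "160 \<le> d" and ks: "k < ?s" and \<Phi>s: "\<Phi> < ?s" and y: "240 * A \<le> \<Gamma> * ?s * k" by auto
    \<comment> \<open>The length at which the probability of crossing the boundary reaches
      \<open>\<Gamma> / 4\<close>: the constant is \<open>240 = 4 * 10 * 6\<close>, with the
      \<open>6\<close> from \<open>2 * \<Phi> + 4 * sqrt d \<le> 6 * sqrt d\<close>.\<close>
    define y where "y = \<Gamma> * ?s * k / (240 * A)"
    define z where "z = min y (sqrt (d / (10 * D)))"
    have y1: "1 \<le> y" unfolding y_def using y A0 by simp
    have "1 \<le> sqrt (d / (10 * D))" using dD D by simp
    then have z1: "1 \<le> z" unfolding z_def using y1 by simp
    obtain t :: nat where t: "2 ^ t \<le> z" "z < 2 ^ (t + 1)"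
    proof -
      define t where "t = nat \<lfloor>log 2 z\<rfloor>"
      have l0: "0 \<le> log 2 z" using z1 by simp
      then have "real t \<le> log 2 z" "log 2 z < real (t + 1)" unfolding t_def by linarith+
      then have "2 powr real t \<le> z" "z < 2 powr real (t + 1)" using z1 by (simp_all add: le_log_iff log_less_iff)
      then show ?thesis using that[of t] by (simp only: powr_realpow zero_less_numeral)
    qed
    have walk: "z * \<Gamma> / (16 * d * k * D) \<le> P"
    proof -
      have "65 / d \<le> \<Gamma> / 4"
      proof -
        have "260 \<le> \<Gamma> * ?s * k" using y A by simp
        also have "\<dots> \<le> \<Gamma> * ?s * ?s" using ks \<Gamma> s1 by (intro mult_left_mono) auto
        also have "\<dots> = \<Gamma> * d" using ss by (simp add: mult.assoc)
        finally show ?thesis using d by (simp add: field_simps)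
      qed
      moreover have "2 ^ t * (10 * A * (2 * \<Phi> + 4 * ?s)) / (d * k) \<le> \<Gamma> / 4"
      proof -
        have "2 ^ t * (10 * A * (2 * \<Phi> + 4 * ?s)) \<le> y * (10 * A * (6 * ?s))"
          using t(1) \<Phi>s \<Phi>0 s1 A0 y1 unfolding z_def by (intro mult_mono) auto
        also have "\<dots> = \<Gamma> / 4 * ((?s * ?s) * k)" unfolding y_def using A0 by (simp add: field_simps)
        also have "\<dots> = \<Gamma> / 4 * (d * k)" by (simp only: ss)
        finally show ?thesis using d k by (simp add: divide_le_eq mult_ac)
      qed
      ultimately have "65 / d + 2 ^ t * (10 * A * (2 * \<Phi> + 4 * ?s)) / (d * k) \<le> \<Gamma> / 2" by linarith
      moreover have "2 ^ t \<le> sqrt (d / (10 * D))" using t(1) unfolding z_def by simp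
      ultimately have 1: "2 ^ t * \<Gamma> / (8 * d * k * D) \<le> P" using B2 d160 by blast
      have "z * \<Gamma> / (16 * d * k * D) \<le> (2 * 2 ^ t) * \<Gamma> / (16 * d * k * D)"
        using t(2) \<Gamma> d k D by (intro divide_right_mono mult_right_mono) auto
      also have "\<dots> = 2 ^ t * \<Gamma> / (8 * d * k * D)" using d k D by (simp add: field_simps)
      finally show ?thesis using 1 by linarith
    qed
    \<comment> \<open>The geometric mean with weight two on single steps and one on walks.\<close>
    have cube: "b\<^sup>2 * (z * \<Gamma> / (16 * d * k * D)) \<le> P ^ 3"
    proof -
      have "b\<^sup>2 * (z * \<Gamma> / (16 * d * k * D)) \<le> P\<^sup>2 * P"
        using walk bP b0 \<Gamma> z1 d k D P0 by (intro mult_mono power_mono) auto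
      then show ?thesis by (simp add: power2_eq_square power3_eq_cube)
    qed
    have mg: "\<epsilon>\<^sup>2 / (256 * k) \<le> \<Gamma> * \<Phi>" using margulis k by (simp add: divide_le_eq mult_ac)
    show ?thesis
    proof (cases "y \<le> sqrt (d / (10 * D))")
      case True
      \<comment> \<open>For the length \<open>y\<close>, which is itself proportional to
        \<open>\<Gamma>\<close>, the mean contains \<open>(\<Gamma> * \<Phi>)\<^sup>2\<close>, and
        the isoperimetric bound is used twice.\<close>
      have "?c * ?R \<le> 1 / (65536 * 256 * (240 * A)) * (\<epsilon> ^ 4 / (d\<^sup>2 * ?s * k ^ 4 * D ^ 3))"
        using R_le' A0 \<epsilon> d k D by (intro mult_mono) (auto simp: field_simps)
      also have "\<dots> = (\<epsilon>\<^sup>2 / (256 * k))\<^sup>2 / (256 * (240 * A) * d\<^sup>2 * ?s * k\<^sup>2 * D ^ 3)"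
        using k d D s1 A0 by (simp add: power_divide field_simps eval_nat_numeral)
      also have "\<dots> \<le> (\<Gamma> * \<Phi>)\<^sup>2 / (256 * (240 * A) * d\<^sup>2 * ?s * k\<^sup>2 * D ^ 3)"
        using mg \<epsilon> k d D s1 A0 by (intro divide_right_mono power_mono) auto
      also have "\<dots> = b\<^sup>2 * (y * \<Gamma> / (16 * (?s * ?s) * k * D))"
        unfolding b_def y_def using k d D s1 A0 by (simp add: power_divide field_simps eval_nat_numeral)
      also have "\<dots> = b\<^sup>2 * (z * \<Gamma> / (16 * d * k * D))" using True unfolding z_def ss by simp
      also have "\<dots> \<le> P ^ 3" by (rule cube)
      finally show ?thesis .
    next
      case False
      then have z: "z = sqrt (d / (10 * D))" unfolding z_def by simp
      have "?s / (4 * ?u) \<le> z"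
      proof -
        have "sqrt 10 \<le> 4" by (rule real_le_lsqrt) auto
        then have "sqrt 10 * ?u \<le> 4 * ?u" using u1 by (intro mult_right_mono) auto
        then show ?thesis unfolding z using s1 u1 by (simp add: real_sqrt_divide real_sqrt_mult frac_le)
      qed
      then have zz: "b\<^sup>2 * ((?s / (4 * ?u)) * \<Gamma> / (16 * (?s * ?s) * k * D)) \<le> b\<^sup>2 * (z * \<Gamma> / (16 * d * k * D))"
        unfolding ss using \<Gamma> d k D by (intro mult_left_mono divide_right_mono mult_right_mono) auto
      \<comment> \<open>For the maximal length the mean contains only
        \<open>\<Gamma> * \<Phi>\<^sup>2\<close>; the isoperimetric bound is used once and the
        remaining \<open>\<Phi>\<close> is at least \<open>\<epsilon> / 16\<close>, which gives the
        better power \<open>\<epsilon> ^ 3\<close>.\<close>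
      have "\<epsilon> ^ 4 \<le> \<epsilon> ^ 3" using \<epsilon> by (intro power_decreasing) auto
      then have e3: "\<epsilon> ^ 4 / (d\<^sup>2 * ?s * k ^ 4 * (D ^ 3 * ?u)) \<le> \<epsilon> ^ 3 / (d\<^sup>2 * ?s * k ^ 4 * (D ^ 3 * ?u))"
        using d k D s1 u1 by (intro divide_right_mono) auto
      have "?c * ?R \<le> 1 / (4096 * 1024) * (\<epsilon> ^ 3 / (d\<^sup>2 * ?s * k ^ 4 * (D ^ 3 * ?u)))"
      proof (rule mult_mono)
        show "?c \<le> 1 / (4096 * 1024)" using A by (simp add: field_simps)
        show "?R \<le> \<epsilon> ^ 3 / (d\<^sup>2 * ?s * k ^ 4 * (D ^ 3 * ?u))" using R_le e3 by (rule order_trans)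
      qed (use \<epsilon> d k D in auto)
      also have "\<dots> = (\<epsilon>\<^sup>2 / (256 * k)) * (\<epsilon> / 16) / (1024 * d\<^sup>2 * ?s * k ^ 3 * (D ^ 3 * ?u))"
        using k d D s1 u1 by (simp add: field_simps eval_nat_numeral)
      also have "\<dots> \<le> (\<Gamma> * \<Phi>) * \<Phi> / (1024 * d\<^sup>2 * ?s * k ^ 3 * (D ^ 3 * ?u))"
        using mg \<Phi> \<Gamma> \<Phi>0 \<epsilon> k d D s1 u1 by (intro divide_right_mono mult_mono) auto
      also have "\<dots> = b\<^sup>2 * ((?s / (4 * ?u)) * \<Gamma> / (16 * (?s * ?s) * k * D))"
        unfolding b_def using k d D s1 u1 by (simp add: power_divide field_simps eval_nat_numeral)
      also have "\<dots> \<le> P ^ 3" using zz cube by (rule order_trans)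
      finally show ?thesis .
    qed
  qed
qed

lemma state_space_pos: "0 < k \<Longrightarrow> 0 < n \<Longrightarrow> 0 < state_space n d k"
  unfolding state_space_eq by simp

text \<open>The tester takes \<open>t = 0\<close> with probability at least
  \<open>1 / (2 * log 2 d)\<close>.\<close>

lemma single_step_rate:
  assumes n: "n = 2 ^ k" and k: "0 < k" and s: "1 \<le> scale_bound d"
  shows "real (total_violations n d k f) / real (n ^ d) / (4 * real d * real k * log 2 (real d))
    \<le> measure_pmf.prob (tester n d f) (violation_found n d f)"
proof -
  let ?V = "real (total_violations n d k f)" and ?N = "real (n ^ d)" and ?D = "log 2 (real d)"
    and ?p = "real (max_exponent d + 1)" and ?W = "state_space n d k" and ?c = "real (card (choices d k))"
  define \<Sigma> where "\<Sigma> = (\<Sum>(a, c)\<in>choices d k. \<Sum>x\<in>hypergrid n d. detection n d f x a c 1)"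
  note D = scale_bound_ge_oneD[OF s]
  have n0: "0 < n" using n by simp
  have W: "?W = ?c * ?N" unfolding state_space_def by simp
  have W0: "0 < ?W" using state_space_pos[OF k n0] .
  then have c0: "0 < ?c" unfolding W by (simp add: zero_less_mult_iff)
  have N0: "0 < ?N" using n0 by simp
  have p0: "0 < ?p" by simp
  have "?V / ?N / (4 * real d * real k * ?D) \<le> ?V / ?N / (2 * real d * real k * ?p)"
    using max_exponent_le[OF s] D k N0 p0 by (intro divide_left_mono mult_pos_pos) (auto simp: mult_ac)
  also have "\<dots> = (?c * ?V) / (2 * real k * real d) / (?p * ?W)"
    unfolding W using c0 by (auto simp add: field_simps simp del: of_nat_add of_nat_Suc)
  also have "\<dots> \<le> \<Sigma> / (?p * ?W)"
  proof (rule divide_right_mono)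
    have "?c * ?V \<le> 2 * real k * real d * \<Sigma>" unfolding \<Sigma>_def by (rule sum_detection_one_ge)
    then show "?c * ?V / (2 * real k * real d) \<le> \<Sigma>" using k D by (simp add: divide_le_eq mult_ac)
  qed (use W0 p0 in simp)
  also have "\<dots> \<le> measure_pmf.prob (tester n d f) (violation_found n d f)"
    using prob_tester_ge[OF n k, of 0 d f] unfolding \<Sigma>_def by simp
  finally show ?thesis .
qed

lemma exp_minus_le_inverse: "0 < x \<Longrightarrow> exp (- x) \<le> 1 / (x::real)"
proof -
  assume "0 < x"
  moreover have "x \<le> exp x" using exp_ge_add_one_self[of x] by linarith
  ultimately show ?thesis by (simp add: exp_minus field_simps)
qed

lemma walk_rate:
  assumes n: "n = 2 ^ k" and k: "0 < k" and s: "1 \<le> scale_bound d"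
    and E: "E \<subseteq> violating_edges n d k f" "inj_on fst E" "inj_on upper_endpoint E"
    and d160: "160 \<le> real d" and t: "2 ^ t \<le> scale_bound d"
    and ge: "65 / real d + 2 ^ t * (10 * exp 15 * (2 * (real (total_violations n d k f) / real (n ^ d)) + 4 * sqrt (real d))) / (real d * real k)
        \<le> real (card E) / real (n ^ d) / 2"
  shows "2 ^ t * (real (card E) / real (n ^ d)) / (8 * real d * real k * log 2 (real d))
    \<le> measure_pmf.prob (tester n d f) (violation_found n d f)"
proof -
  let ?V = "real (total_violations n d k f)" and ?N = "real (n ^ d)" and ?D = "log 2 (real d)"
    and ?p = "real (max_exponent d + 1)" and ?W = "state_space n d k" and ?c = "real (card (choices d k))"
    and ?\<Gamma> = "real (card E) / real (n ^ d)" and ?s = "sqrt (real d)"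
  note D = scale_bound_ge_oneD[OF s]
  have n0: "0 < n" using n by simp
  have W: "?W = ?c * ?N" unfolding state_space_def by simp
  have W0: "0 < ?W" using state_space_pos[OF k n0] .
  then have c0: "0 < ?c" unfolding W by (simp add: zero_less_mult_iff)
  have N0: "0 < ?N" using n0 by simp
  have d0: "0 < real d" using D by simp
  define \<tau> where "\<tau> = (2 ^ t :: real)"
  \<comment> \<open>One of the \<open>2 ^ t\<close> steps is spent on the violated edge;
    \<open>l\<close> steps remain.\<close>
  define l where "l = (2 ^ t - 1 :: nat)"
  have l1: "l + 1 = 2 ^ t" unfolding l_def by simp
  have rl: "real (l + 1) = \<tau>" unfolding l1 \<tau>_def by simp
  have \<tau>0: "1 \<le> \<tau>" unfolding \<tau>_def by simp
  have l\<tau>: "real l \<le> \<tau>" using rl by simp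
  have \<tau>s: "\<tau> \<le> sqrt (real d / (10 * ?D))" using t unfolding \<tau>_def scale_bound_def .
  have \<tau>2: "\<tau>\<^sup>2 \<le> real d / (10 * ?D)"
  proof -
    have "\<tau>\<^sup>2 \<le> (sqrt (real d / (10 * ?D)))\<^sup>2" using \<tau>s \<tau>0 by (intro power_mono) auto
    then show ?thesis using D by simp
  qed
  have \<tau>10: "\<tau>\<^sup>2 \<le> real d / 10"
  proof -
    have "real d / (10 * ?D) \<le> real d / 10" using D by (intro divide_left_mono) auto
    then show ?thesis using \<tau>2 by linarith
  qed
  \<comment> \<open>This is where \<open>160 \<le> d\<close> enters: it is equivalent to
    \<open>d / 10 \<le> (d / 40)\<^sup>2\<close>.\<close>
  have l40: "real l \<le> real d / 40"
  proof -
    have "real d / 10 \<le> (real d / 40)\<^sup>2" using d160 by (simp add: power2_eq_square)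
    then have "\<tau>\<^sup>2 \<le> (real d / 40)\<^sup>2" using \<tau>10 by linarith
    then have "\<tau> \<le> real d / 40" by (rule power2_le_imp_le) simp
    then show ?thesis using l\<tau> by simp
  qed
  \<comment> \<open>Large enough that the tail exponent \<open>\<kappa>\<^sup>2 / (4 * d)\<close>
    equals \<open>4 * log 2 d\<close>, and small enough that walks of length
    \<open>sqrt (d / (10 * log 2 d))\<close> satisfy
    \<open>\<tau> * \<kappa> \<le> 13 / 10 * d\<close>. This is the reason for the cutoff in
    \<open>scale_bound\<close>.\<close>
  define \<kappa> where "\<kappa> = 4 * sqrt (real d * ?D)"
  have \<kappa>0: "0 \<le> \<kappa>" unfolding \<kappa>_def using D by simp
  have \<kappa>2: "\<kappa>\<^sup>2 = 16 * (real d * ?D)" unfolding \<kappa>_def using D by (simp add: power_mult_distrib)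
  have \<kappa>d: "\<kappa> \<le> 2 * real d"
  proof (rule power2_le_imp_le)
    have "16 * (real d * ?D) \<le> 4 * (real d * real d)" using D d0 by simp
    then show "\<kappa>\<^sup>2 \<le> (2 * real d)\<^sup>2" unfolding \<kappa>2 by (simp add: power2_eq_square)
  qed simp
  have \<kappa>\<tau>: "\<tau> * \<kappa> \<le> 13 / 10 * real d"
  proof (rule power2_le_imp_le)
    have "(\<tau> * \<kappa>)\<^sup>2 = \<tau>\<^sup>2 * (16 * (real d * ?D))" by (simp add: power_mult_distrib \<kappa>2)
    also have "\<dots> \<le> real d / (10 * ?D) * (16 * (real d * ?D))" using \<tau>2 D by (intro mult_right_mono) auto
    also have "\<dots> = 8 / 5 * (real d * real d)"
    proof -
      have "?D \<noteq> 0" using D(1) by linarith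
      then show ?thesis by simp
    qed
    also have "\<dots> \<le> (13 / 10 * real d)\<^sup>2" by (simp add: power2_eq_square)
    finally show "(\<tau> * \<kappa>)\<^sup>2 \<le> (13 / 10 * real d)\<^sup>2" .
  qed simp
  have jl: "real l * (\<kappa> + 2 * real l) \<le> 3 / 2 * real d"
  proof -
    have "real l * (\<kappa> + 2 * real l) \<le> \<tau> * (\<kappa> + 2 * \<tau>)" using l\<tau> \<kappa>0 by (intro mult_mono) auto
    also have "\<dots> = \<tau> * \<kappa> + 2 * \<tau>\<^sup>2" by (simp add: algebra_simps power2_eq_square)
    also have "\<dots> \<le> 3 / 2 * real d" using \<kappa>\<tau> \<tau>10 by simp
    finally show ?thesis .
  qed
  define \<Sigma> where "\<Sigma> = (\<Sum>(a, c)\<in>choices d k. \<Sum>x\<in>hypergrid n d. detection n d f x a c (l + 1))"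
  define NT where "NT = (\<Sum>(a, c)\<in>choices d k. real (card {x\<in>hypergrid n d. \<not> typical n d \<kappa> x a c}))"
  define FL where "FL = (\<Sum>(a, c)\<in>choices d k. \<Sum>x\<in>{x\<in>hypergrid n d. typical n d \<kappa> x a c}.
            real (flips n d f x a c l) / real (card (up_coords n d x a c) choose l))"
  have main: "real (card E) * ?c - NT - 2 * FL \<le> 2 * real k * real d / \<tau> * \<Sigma>"
    unfolding NT_def FL_def \<Sigma>_def rl[symmetric]
    using E l40 D(3) by (intro sum_detection_ge)
  \<comment> \<open>The constant is \<open>65 = 1 + 64\<close>, one summand for each of the two
    tails.\<close>
  have NT: "NT \<le> ?W * (65 / real d)"
  proof -
    have "exp (- (\<kappa>\<^sup>2 / (4 * real d))) \<le> 1 / real d"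
    proof -
      have "ln (real d) = ?D * ln 2" by (simp add: log_def)
      also have "\<dots> \<le> ?D * 4" using D ln_2_less_1 by (intro mult_left_mono) auto
      also have "\<dots> = \<kappa>\<^sup>2 / (4 * real d)" unfolding \<kappa>2 using d0 by simp
      finally have "exp (- (\<kappa>\<^sup>2 / (4 * real d))) \<le> exp (- ln (real d))" by simp
      then show ?thesis using d0 by (simp add: exp_minus inverse_eq_divide)
    qed
    moreover have "exp (- (real d / 64)) \<le> 64 / real d" using exp_minus_le_inverse[of "real d / 64"] d0 by simp
    ultimately have "exp (- (\<kappa>\<^sup>2 / (4 * real d))) + exp (- (real d / 64)) \<le> 65 / real d"
      using add_divide_distrib[of 1 64 "real d"] by linarith
    then have "?W * (exp (- (\<kappa>\<^sup>2 / (4 * real d))) + exp (- (real d / 64))) \<le> ?W * (65 / real d)"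
      using W0 by (intro mult_left_mono) auto
    then show ?thesis using nontypical_tail[OF n D(3) \<kappa>0 \<kappa>d] unfolding NT_def by linarith
  qed
  have FL: "2 * FL \<le> ?W * (\<tau> * (10 * exp 15 * (2 * (?V / ?N) + 4 * ?s)) / (real d * real k))"
  proof -
    let ?I = "real (total_influence n d k f)"
    have I: "?I \<le> ?N * (2 * (?V / ?N) + 4 * ?s)"
    proof -
      have "?N * (2 * v + 4 * ?s) = 2 * (?N * v) + 4 * ?s * ?N" for v by (simp only: distrib_left mult_ac)
      moreover have "?N * (?V / ?N) = ?V" using N0 by simp
      ultimately have "?N * (2 * (?V / ?N) + 4 * ?s) = 2 * ?V + 4 * ?s * ?N" by (simp only:)
      then show ?thesis using total_influence_le[OF n, of d f] by (simp only:)
    qed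
    have "2 * real k * FL \<le> real l * (exp 15 * (10 / real d)) * (?c * ?I)"
      unfolding FL_def using \<kappa>0 l40 jl D(3) by (intro sum_typical_flips_le)
    also have "\<dots> \<le> \<tau> * (exp 15 * (10 / real d)) * (?c * (?N * (2 * (?V / ?N) + 4 * ?s)))"
      using l\<tau> I c0 by (intro mult_mono) auto
    also have "\<dots> = ?W * (\<tau> * (10 * exp 15 * (2 * (?V / ?N) + 4 * ?s)) / (real d * real k)) * real k"
      unfolding W using k d0 by (simp add: field_simps)
    finally have "(2 * FL) * real k \<le> ?W * (\<tau> * (10 * exp 15 * (2 * (?V / ?N) + 4 * ?s)) / (real d * real k)) * real k"
      by (simp add: mult_ac)
    then show ?thesis using k by (simp only: mult_le_cancel_right_pos of_nat_0_less_iff)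
  qed
  have "real (card E) * ?c = ?W * ?\<Gamma>" unfolding W using n0 by simp
  then have "?W * (?\<Gamma> - 65 / real d - \<tau> * (10 * exp 15 * (2 * (?V / ?N) + 4 * ?s)) / (real d * real k)) \<le> real (card E) * ?c - NT - 2 * FL"
    using NT FL by (simp add: right_diff_distrib)
  \<comment> \<open>By the assumption \<open>ge\<close>, atypical points and flips together spoil at
    most half of the matched edges.\<close>
  moreover have "?W * (?\<Gamma> / 2) \<le> ?W * (?\<Gamma> - 65 / real d - \<tau> * (10 * exp 15 * (2 * (?V / ?N) + 4 * ?s)) / (real d * real k))"
    using ge W0 unfolding \<tau>_def by (intro mult_left_mono) linarith+
  ultimately have "?W * (?\<Gamma> / 2) \<le> 2 * real k * real d / \<tau> * \<Sigma>" using main by linarith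
  then have S: "\<tau> * ?\<Gamma> / (4 * real d * real k) \<le> \<Sigma> / ?W"
    using W0 \<tau>0 k d0 N0 by (simp add: field_simps)
  have t_le: "t \<le> max_exponent d" using max_exponent_props(1)[OF s t] .
  have "\<tau> * ?\<Gamma> / (8 * real d * real k * ?D) = \<tau> * ?\<Gamma> / (4 * real d * real k) / (2 * ?D)" by simp
  also have "\<dots> \<le> \<tau> * ?\<Gamma> / (4 * real d * real k) / ?p"
    using max_exponent_le[OF s] \<tau>0 by (intro divide_left_mono) auto
  also have "\<dots> \<le> \<Sigma> / ?W / ?p" using S by (intro divide_right_mono) auto
  also have "\<dots> = \<Sigma> / (?p * ?W)" by (simp add: mult.commute)
  also have "\<dots> \<le> measure_pmf.prob (tester n d f) (violation_found n d f)"
    using prob_tester_ge[OF n k t_le, of f] unfolding \<Sigma>_def l1 .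
  finally show ?thesis unfolding \<tau>_def .
qed

lemma rate_cube:
  fixes \<epsilon> d D k :: real
  assumes "0 < \<epsilon>" "0 < d" "0 < D" "0 < k"
  shows "(\<epsilon> powr (4 / 3) / (d powr (5 / 6) * D powr (3 / 2) * k powr (4 / 3))) ^ 3
    = \<epsilon> ^ 4 / (d\<^sup>2 * sqrt d * k ^ 4 * (D ^ 4 * sqrt D))"
proof -
  have "(\<epsilon> powr (4 / 3)) ^ 3 = \<epsilon> ^ 4" "(k powr (4 / 3)) ^ 3 = k ^ 4"
    using assms by (simp_all add: powr_power powr_numeral)
  moreover have "(d powr (5 / 6)) ^ 3 = d\<^sup>2 * sqrt d"
  proof -
    have "(d powr (5 / 6)) ^ 3 = d powr (2 + 1 / 2)" using assms by (simp add: powr_power)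
    also have "\<dots> = d powr 2 * d powr (1 / 2)" by (rule powr_add)
    also have "\<dots> = d\<^sup>2 * sqrt d" using assms by (simp add: powr_half_sqrt powr_numeral)
    finally show ?thesis .
  qed
  moreover have "(D powr (3 / 2)) ^ 3 = D ^ 4 * sqrt D"
  proof -
    have "(D powr (3 / 2)) ^ 3 = D powr (4 + 1 / 2)" using assms by (simp add: powr_power)
    also have "\<dots> = D powr 4 * D powr (1 / 2)" by (rule powr_add)
    also have "\<dots> = D ^ 4 * sqrt D" using assms by (simp add: powr_half_sqrt powr_numeral)
    finally show ?thesis .
  qed
  ultimately show ?thesis by (simp add: power_divide power_mult_distrib mult_ac)
qed

lemma far_from_monotone_le_one:
  assumes "0 < n" "far_from_monotone n d \<epsilon> f"
  shows "\<epsilon> \<le> 1"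
proof -
  have "grid_monotone n d (\<lambda>_. True)" unfolding grid_monotone_def by (simp add: monotone_on_def)
  then have "\<epsilon> * real (n ^ d) \<le> real (card {x\<in>hypergrid n d. f x \<noteq> True})"
    using assms(2) unfolding far_from_monotone_def card_hypergrid by blast
  also have "\<dots> \<le> real (card (hypergrid n d))" by (intro of_nat_mono card_mono) auto
  finally have "\<epsilon> * real (n ^ d) \<le> 1 * real (n ^ d)" by (simp add: card_hypergrid)
  then show ?thesis using assms(1) by (simp only: mult_le_cancel_right_pos of_nat_0_less_iff zero_less_power)
qed

theorem theorem1p2:
  "\<exists>C::real. C > 0 \<and>
     (\<forall>(n::nat) (d::nat) (\<epsilon>::real) (f::point \<Rightarrow> bool).
        (\<exists>k::nat. n = 2 ^ k) \<longrightarrow> scale_bound d \<ge> 1 \<longrightarrow> \<epsilon> > 0 \<longrightarrow> far_from_monotone n d \<epsilon> f \<longrightarrow>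
        measure_pmf.prob (tester n d f)
          {(x, y, v). x \<in> hypergrid n d \<and> y \<in> hypergrid n d \<and>
             coord_le d x y \<and> f x > f y \<and> v = Reject}
        \<ge> C * (\<epsilon> powr (4 / 3) /
            (real d powr (5 / 6) * log 2 (real d) powr (3 / 2) * log 2 (real n) powr (4 / 3))))"
proof -
  \<comment> \<open>The factor \<open>exp 15\<close> is the loss in comparing the walk with the
    uniform distribution; \<open>2 ^ 40\<close> is a round bound for the other constants.\<close>
  define C :: real where "C = 1 / (2 ^ 40 * exp 15)"
  have C0: "0 < C" unfolding C_def by simp
  \<comment> \<open>The rate lemma puts \<open>C\<close> in front of the cube of the rate; because
    \<open>C ^ 3 \<le> C\<close>, cube roots can be taken with the same \<open>C\<close>.\<close>
  have C3: "C ^ 3 \<le> C"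
  proof -
    have "1 * 1 \<le> 2 ^ 40 * exp (15::real)" by (intro mult_mono) auto
    then have "C \<le> 1" unfolding C_def by (simp add: divide_le_eq)
    then show ?thesis using C0 power_decreasing[of 1 3 C] by simp
  qed
  have "C * (\<epsilon> powr (4 / 3) / (real d powr (5 / 6) * log 2 (real d) powr (3 / 2) * log 2 (real n) powr (4 / 3)))
      \<le> measure_pmf.prob (tester n d f) (violation_found n d f)"
    if n: "n = 2 ^ k" and s: "1 \<le> scale_bound d" and \<epsilon>: "0 < \<epsilon>" and far: "far_from_monotone n d \<epsilon> f"
    for n d k :: nat and \<epsilon> f
  proof (cases "k = 0")
    \<comment> \<open>For \<open>n = 1\<close> the logarithm of \<open>n\<close> is
      \<open>0\<close>, so the denominator vanishes and the claimed bound is \<open>0\<close> by the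
      convention for division.\<close>
    case True
    then show ?thesis using n by simp
  next
    case False
    then have k: "0 < k" "1 \<le> k" by simp_all
    let ?P = "measure_pmf.prob (tester n d f) (violation_found n d f)" and ?D = "log 2 (real d)"
      and ?V = "real (total_violations n d k f)" and ?N = "real (n ^ d)"
    let ?rate = "\<epsilon> powr (4 / 3) / (real d powr (5 / 6) * ?D powr (3 / 2) * real k powr (4 / 3))"
    note D = scale_bound_ge_oneD[OF s]
    have N0: "0 < ?N" using n by simp
    obtain E where E: "E \<subseteq> violating_edges n d k f" "inj_on fst E" "inj_on upper_endpoint E"
      "(\<epsilon> * ?N)\<^sup>2 \<le> 256 * real k * real (card E) * ?V"
      using augmented_margulis(2)[OF n k(2) \<epsilon> far] by blast
    have "C * (\<epsilon> ^ 4 / ((real d)\<^sup>2 * sqrt (real d) * real k ^ 4 * (?D ^ 4 * sqrt ?D))) \<le> ?P ^ 3"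
      unfolding C_def
    proof (rule detection_rate_cube[where \<Phi> = "?V / ?N" and \<Gamma> = "real (card E) / ?N"])
      show "\<epsilon> \<le> 1" using far_from_monotone_le_one[OF _ far] n by simp
      show "\<epsilon> \<le> 16 * (?V / ?N)" using augmented_margulis(1)[OF n k(2) \<epsilon> far] N0 by (simp add: field_simps)
      show "\<epsilon>\<^sup>2 \<le> 256 * real k * (real (card E) / ?N) * (?V / ?N)"
        using E(4) N0 by (simp add: field_simps power2_eq_square)
      show "?V / ?N / (4 * real d * real k * ?D) \<le> ?P" by (rule single_step_rate[OF n k(1) s])
      show "2 ^ t * (real (card E) / ?N) / (8 * real d * real k * ?D) \<le> ?P"
        if "160 \<le> real d" "2 ^ t \<le> sqrt (real d / (10 * ?D))"
          "65 / real d + 2 ^ t * (10 * exp 15 * (2 * (?V / ?N) + 4 * sqrt (real d))) / (real d * real k) \<le> real (card E) / ?N / 2" for t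
        using that(2) by (intro walk_rate[OF n k(1) s E(1-3) that(1) _ that(3)]) (simp add: scale_bound_def)
      show "2 \<le> exp (15::real)" using exp_ge_add_one_self[of "15::real"] by linarith
    qed (use D k \<epsilon> in auto)
    then have "C * ?rate ^ 3 \<le> ?P ^ 3" using rate_cube[of \<epsilon> "real d" ?D "real k"] \<epsilon> D k by simp
    moreover have "(C * ?rate) ^ 3 \<le> C * ?rate ^ 3"
      unfolding power_mult_distrib using C3 D k by (intro mult_right_mono) auto
    ultimately have "(C * ?rate) ^ Suc 2 \<le> ?P ^ Suc 2" by simp
    then have "C * ?rate \<le> ?P" by (rule power_le_imp_le_base) simp
    then show ?thesis unfolding n by (simp add: log_nat_power)
  qed
  then show ?thesis using C0 unfolding violation_found_def by blast
qed

end
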